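(* Let $\Phi=\{\phi_\ell(x)=Ax+a_\ell\}_{\ell=1}^m$ be an affinely irreducible homogeneous affine IFS on $\mathbb{R}^d$. Then there exists a strictly positive probability vector $\boldsymbol{p}=(p_\ell)_{\ell=1}^m$ such that the self-affine measure associated with $\Phi$ and $\boldsymbol{p}$ is non-Rajchman if and only if $\Phi$ is a generalized Pisot IFS.
   Context: A homogeneous affine IFS on $\mathbb{R}^d$ ($d\ge 1$) is a finite family $\Phi=\{\phi_\ell(x)=Ax+a_\ell\}_{\ell=1}^m$ with $A\in GL_d(\mathbb{R})$ of spectral radius less than $1$ and $a_\ell\in\mathbb{R}^d$. It is affinely irreducible if there is no proper affine subspace $V$ of $\mathbb{R}^d$ with $\phi_\ell(V)=V$ for all $1\le \ell\le m$. For a probability vector $\boldsymbol{p}=(p_\ell)_{\ell=1}^m$, the associated self-affine measure is the unique Borel probability measure $\mu$ on $\mathbb{R}^d$ with $\mu=\sum_{\ell=1}^m p_\ell\,\mu\circ\phi_\ell^{-1}$. The Fourier transform of a Borel probability measure $\nu$ on $\mathbb{R}^d$ is $\widehat\nu(\xi)=\int e^{2\pi i\langle \xi,x\rangle}\,d\nu(x)$; $\nu$ is Rajchman if $|\widehat\nu(\xi)|\to0$ as $|\xi|\to\infty$, and non-Rajchman otherwise. On $\mathbb{C}^d$, $\langle z,w\rangle=\sum_j z_j\overline{w_j}$. Pisot tuple: a finite collection $\{\beta_1,\dots,\beta_k\}$ of distinct algebraic integers (real or complex) such that (i) $|\beta_j|>1$ for all $j$; (ii) there is a monic $P\in\mathbb{Z}[x]$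 with $P(\beta_j)=0$ for all $1\le j\le k$ such that every other root $z$ of $P$, if any, satisfies $|z|<1$. Generalized Pisot IFS: a homogeneous affine IFS $\{Ax+a_\ell\}_{\ell=1}^m$ on $\mathbb{R}^d$ for which there exist $k\ge1$, $\beta_1,\dots,\beta_k\in\mathbb{C}$ and $\zeta_1,\dots,\zeta_k\in\mathbb{C}^d\setminus\{0\}$ such that: (i) $\{\beta_1,\dots,\beta_k\}$ is a Pisot tuple; (ii) $A^{\top}\zeta_j=\beta_j^{-1}\zeta_j$ for $1\le j\le k$; (iii) for every $1\le\ell\le m$ there is $P_\ell\in\mathbb{Z}[x]$ with $\langle\zeta_j,a_\ell-a_1\rangle=P_\ell(\beta_j)$ for all $1\le j\le k$. *)

theory Defs
  imports "HOL-Probability.Probability" "HOL-Computational_Algebra.Computational_Algebra"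
begin

definition cvec :: "real ^ 'd \<Rightarrow> complex ^ 'd" where
  "cvec v = (\<chi> i. complex_of_real (v $ i))"

definition cmat :: "real ^ 'd ^ 'd \<Rightarrow> complex ^ 'd ^ 'd" where
  "cmat A = map_matrix complex_of_real A"

text \<open>The library's \<^const>\<open>inner\<close> on \<^typ>\<open>complex ^ 'd\<close> is real-valued; this is the
  Hermitian product, linear in the first argument.\<close>

definition cinner :: "complex ^ 'd \<Rightarrow> complex ^ 'd \<Rightarrow> complex" where
  "cinner z w = (\<Sum>i\<in>UNIV. z $ i * cnj (w $ i))"

text \<open>The spectrum is that of the complexified matrix, so non-real eigenvalues count.\<close>

definition spectral_radius :: "real ^ 'd ^ 'd \<Rightarrow> real" where
  "spectral_radius A = Max (cmod ` {z. \<exists>v. v \<noteq> 0 \<and> cmat A *v v = z *s v})"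

text \<open>An IFS with linear part \<open>A\<close> is the family of maps \<open>ifs_map A (a l)\<close> with \<open>l \<in> {1..m}\<close>;
  values of \<open>a\<close>, and of weights \<open>p\<close>, at other indices are irrelevant. Repeated maps are
  allowed.\<close>

definition ifs_map :: "real ^ 'd ^ 'd \<Rightarrow> real ^ 'd \<Rightarrow> real ^ 'd \<Rightarrow> real ^ 'd" where
  "ifs_map A b x = A *v x + b"

definition homogeneous_affine_ifs :: "nat \<Rightarrow> real ^ 'd ^ 'd \<Rightarrow> (nat \<Rightarrow> real ^ 'd) \<Rightarrow> bool" where
  "homogeneous_affine_ifs m A a \<longleftrightarrow> m \<ge> 1 \<and> invertible A \<and> spectral_radius A < 1"

text \<open>The library predicate \<^const>\<open>affine\<close> holds of the empty set, which is not an affine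
  subspace and has to be excluded.\<close>

definition affinely_irreducible :: "nat \<Rightarrow> real ^ 'd ^ 'd \<Rightarrow> (nat \<Rightarrow> real ^ 'd) \<Rightarrow> bool" where
  "affinely_irreducible m A a \<longleftrightarrow>
     \<not> (\<exists>V. affine V \<and> V \<noteq> {} \<and> V \<noteq> UNIV \<and> (\<forall>l\<in>{1..m}. ifs_map A (a l) ` V = V))"

definition strictly_positive_prob_vector :: "nat \<Rightarrow> (nat \<Rightarrow> real) \<Rightarrow> bool" where
  "strictly_positive_prob_vector m p \<longleftrightarrow> (\<forall>l\<in>{1..m}. p l > 0) \<and> (\<Sum>l=1..m. p l) = 1"

definition borel_prob_measure :: "'a::topological_space measure \<Rightarrow> bool" where
  "borel_prob_measure \<nu> \<longleftrightarrow> prob_space \<nu> \<and> sets \<nu> = sets borel"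

definition self_affine_measure ::
  "nat \<Rightarrow> real ^ 'd ^ 'd \<Rightarrow> (nat \<Rightarrow> real ^ 'd) \<Rightarrow> (nat \<Rightarrow> real) \<Rightarrow> (real ^ 'd) measure" where
  "self_affine_measure m A a p =
     (THE \<mu>. borel_prob_measure \<mu> \<and>
        (\<forall>E\<in>sets borel. measure \<mu> E = (\<Sum>l=1..m. p l * measure \<mu> (ifs_map A (a l) -` E))))"

definition fourier_transform :: "(real ^ 'd) measure \<Rightarrow> real ^ 'd \<Rightarrow> complex" where
  "fourier_transform \<nu> \<xi> = (\<integral>x. exp (2 * pi * \<i> * complex_of_real (\<xi> \<bullet> x)) \<partial>\<nu>)"

definition rajchman :: "(real ^ 'd) measure \<Rightarrow> bool" where
  "rajchman \<nu> \<longleftrightarrow> ((\<lambda>\<xi>. cmod (fourier_transform \<nu> \<xi>)) \<longlongrightarrow> 0) at_infinity"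

definition pisot_tuple :: "nat \<Rightarrow> (nat \<Rightarrow> complex) \<Rightarrow> bool" where
  "pisot_tuple k \<beta> \<longleftrightarrow>
     inj_on \<beta> {1..k} \<and>
     (\<forall>j\<in>{1..k}. algebraic_int (\<beta> j)) \<and>
     (\<forall>j\<in>{1..k}. cmod (\<beta> j) > 1) \<and>
     (\<exists>P :: int poly. lead_coeff P = 1 \<and>
        (\<forall>j\<in>{1..k}. poly (map_poly of_int P) (\<beta> j) = 0) \<and>
        (\<forall>z :: complex. poly (map_poly of_int P) z = 0 \<and> z \<notin> \<beta> ` {1..k} \<longrightarrow> cmod z < 1))"

definition generalized_pisot_ifs :: "nat \<Rightarrow> real ^ 'd ^ 'd \<Rightarrow> (nat \<Rightarrow> real ^ 'd) \<Rightarrow> bool" where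
  "generalized_pisot_ifs m A a \<longleftrightarrow>
     homogeneous_affine_ifs m A a \<and>
     (\<exists>k \<beta> \<zeta>. k \<ge> 1 \<and> (\<forall>j\<in>{1..k}. \<zeta> j \<noteq> 0) \<and>
        pisot_tuple k \<beta> \<and>
        (\<forall>j\<in>{1..k}. transpose (cmat A) *v \<zeta> j = inverse (\<beta> j) *s \<zeta> j) \<and>
        (\<forall>l\<in>{1..m}. \<exists>P :: int poly. \<forall>j\<in>{1..k}.
           cinner (\<zeta> j) (cvec (a l - a 1)) = poly (map_poly of_int P) (\<beta> j)))"

end

theory Submission
  imports Defs "HOL-Library.Function_Algebras"
begin

text \<open>Write \<open>B\<close> for the transpose of \<open>A\<close>, \<open>M\<close> for its inverse and \<open>b l = a l - a 1\<close>. The Fourier transform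
  satisfies \<open>|\<mu>^(\<xi>)| = |F(\<xi>)| |\<mu>^(B \<xi>)|\<close> for a trigonometric polynomial \<open>F\<close> with \<open>|F(\<xi>)|\<close> close to \<open>1\<close> exactly
  when all \<open>\<langle>\<xi>, b l\<rangle>\<close> are close to integers.

  For a generalized Pisot system, weighting the eigenvectors by root multiplicities gives a backward
  \<open>B\<close>-orbit along which \<open>\<langle>\<xi>, b l\<rangle>\<close> is exponentially close to a power sum of all roots of an integer
  polynomial, hence to an integer; if \<open>p 1 > 1/2\<close> no factor vanishes and the product stays away from \<open>0\<close>.

  Conversely, if \<open>\<mu>^\<close> does not vanish at infinity, compactness yields \<open>\<eta> \<noteq> 0\<close> such that the distances of
  \<open>\<langle>M\<^sup>k \<eta>, b l\<rangle>\<close> to the integers are square summable. As in Pisot's theorem, a pigeonhole argument and a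
  Noetherian argument show that the nearest integers satisfy a monic integral recurrence. Choosing the
  vector and the recurrence \<open>Q\<close> with \<open>Q\<close> of least degree makes \<open>Q\<close> behave like an irreducible polynomial;
  \<open>Q / (X - z)\<close> applied to that vector is then an eigenvector for each root \<open>z\<close> outside the unit disc, and
  no root lies on the unit circle.\<close>

section \<open>Polynomials acting on vectors and sequences\<close>

text \<open>In the converse, the product formula yields only square summability and the annihilating
  polynomial of \<open>M\<close> is merely real: the nearest integers obey its recurrence up to a
  square-summable error, with no exact relation in sight. The pigeonhole argument therefore averages
  over integer combinations, and what it delivers is a relation with uncontrolled leading
  coefficient. It has to be made monic, because the roots must be algebraic integers. No
  factorization into irreducibles is used: minimality ranges over vector, integer sequences and
  recurrence jointly, so a proper factor of the recurrence either annihilates the vector or leads to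
  a new vector with the complementary factor, and both lower the degree. Affine irreducibility is
  used in one form: a vector whose pairings with all \<open>b l\<close> tend to 0 along its orbit
  under \<open>M\<close> is 0. In the Pisot direction, eigenvectors for conjugate roots need not be
  conjugate, so the orbit is built over the complex numbers and its real part is taken; the same
  fact shows that this real part is not zero.\<close>

locale module_endo = module scale
  for scale :: "'a::comm_ring_1 \<Rightarrow> 'b::ab_group_add \<Rightarrow> 'b" +
  fixes g :: "'b \<Rightarrow> 'b"
  assumes g_add: "g (v + w) = g v + g w"
    and g_scale: "g (scale c v) = scale c (g v)"
begin

text \<open>The module structure over the polynomial ring in which the variable acts by
  \<open>g\<close>. It serves both matrices over a field and shifts of sequences over a ring such as
  the integers.\<close>

definition pact :: "'a poly \<Rightarrow> 'b \<Rightarrow> 'b" where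
  "pact p v = fold_coeffs (\<lambda>a w. scale a v + g w) p 0"

lemma g_0 [simp]: "g 0 = 0"
  using g_add[of 0 0] by simp

lemma pact_0 [simp]: "pact 0 v = 0"
  by (simp add: pact_def)

lemma pact_pCons [simp]: "pact (pCons a p) v = scale a v + g (pact p v)"
  by (cases "p = 0 \<and> a = 0") (auto simp: pact_def)

lemma pact_1 [simp]: "pact 1 v = v"
  by (simp add: one_pCons)

lemma pact_add: "pact (p + q) v = pact p v + pact q v"
  by (induction p q rule: poly_induct2) (simp_all add: g_add scale_left_distrib algebra_simps)

lemma pact_smult: "pact (smult c p) v = scale c (pact p v)"
  by (induction p) (simp_all add: g_scale scale_right_distrib)

lemma pact_mult: "pact (p * q) v = pact p (pact q v)"
  by (induction p) (simp_all add: pact_add pact_smult)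

lemma pact_commute: "pact p (pact q v) = pact q (pact p v)"
  by (simp flip: pact_mult add: mult.commute)

lemma pact_add_right: "pact p (v + w) = pact p v + pact p w"
  by (induction p) (simp_all add: g_add scale_right_distrib algebra_simps)

lemma pact_scale_right: "pact p (scale c v) = scale c (pact p v)"
  by (induction p) (simp_all add: g_scale scale_right_distrib mult.commute)

lemma pact_0_right [simp]: "pact p 0 = 0"
  by (induction p) simp_all

lemma pact_eq_sum: "pact p v = (\<Sum>i\<le>degree p. scale (coeff p i) ((g ^^ i) v))"
proof (induction p)
  case (pCons a p)
  have gs: "g (\<Sum>i\<in>I. h i) = (\<Sum>i\<in>I. g (h i))" for h and I :: "nat set"
    by (induction I rule: infinite_finite_induct) (simp_all add: g_add)
  show ?case
  proof (cases "p = 0")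
    case False
    then show ?thesis using pCons
      by (simp add: sum.atMost_Suc_shift gs g_scale del: sum.atMost_Suc)
  qed simp
qed simp

lemma pact_monom: "pact (monom c n) v = scale c ((g ^^ n) v)"
  by (induction n arbitrary: v) (simp_all add: monom_0 monom_Suc g_scale)

lemma pact_sum: "pact (\<Sum>i\<in>I. p i) v = (\<Sum>i\<in>I. pact (p i) v)"
  by (induction I rule: infinite_finite_induct) (simp_all add: pact_add)

lemma pact_diff: "pact (p - q) v = pact p v - pact q v"
  using pact_add[of "p - q" q v] by simp

lemma pact_eigenvector:
  assumes "g v = scale z v"
  shows "pact p v = scale (poly p z) v"
proof (induction p)
  case (pCons a p)
  then show ?case
    by (simp add: g_scale assms scale_left_distrib mult.commute)
qed simp

end

text \<open>Applied with \<open>h\<close> sending a vector to its sequence of pairings along an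
  orbit: polynomials in the matrix become recurrence operators.\<close>

lemma pact_hom:
  assumes "module_endo s1 g1" "module_endo s2 g2"
    and "\<And>v w. h (v + w) = h v + h w" "\<And>c v. h (s1 c v) = s2 c (h v)" "\<And>v. h (g1 v) = g2 (h v)"
  shows "h (module_endo.pact s1 g1 p v) = module_endo.pact s2 g2 p (h v)"
proof -
  interpret m1: module_endo s1 g1 by fact
  interpret m2: module_endo s2 g2 by fact
  have h0: "h 0 = 0" using assms(3)[of 0 0] by simp
  show ?thesis
    by (induction p) (simp_all add: h0 assms)
qed

section \<open>Sequences and vectors as modules over polynomials\<close>

abbreviation (input) shift :: "(nat \<Rightarrow> 'a) \<Rightarrow> nat \<Rightarrow> 'a" where
  "shift y \<equiv> \<lambda>k. y (Suc k)"

interpretation sq: module_endo "\<lambda>c (y :: nat \<Rightarrow> 'a::comm_ring_1) k. c * y k" shift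
  by standard (auto simp: fun_eq_iff algebra_simps)

interpretation vc: module_endo "(*s)" "(*v) M" for M :: "'a::field^'n^'n"
  by standard (auto simp: vec_eq_iff algebra_simps matrix_vector_mult_def sum.distrib sum_distrib_left
      intro!: sum.cong)

lemma shift_funpow: "(shift ^^ i) y = (\<lambda>k. y (k + i))"
  by (induction i) auto

lemma sum_seq_apply: "(\<Sum>i\<in>I. h i) k = (\<Sum>i\<in>I. h i k)" for h :: "'i \<Rightarrow> nat \<Rightarrow> 'a::ab_group_add"
  by (induction I rule: infinite_finite_induct) simp_all

lemma sq_pact_eq_sum: "sq.pact p y k = (\<Sum>i\<le>degree p. coeff p i * y (k + i))"
  by (simp add: sq.pact_eq_sum shift_funpow sum_seq_apply)

lemma sq_pact_sum_monom: "sq.pact (\<Sum>i\<in>I. monom (c i) i) y k = (\<Sum>i\<in>I. c i * y (k + i))"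
  by (simp add: sq.pact_sum sum_seq_apply sq.pact_monom shift_funpow)

lemma sq_pact_drop: "sq.pact p (\<lambda>k. y (k + n)) k = sq.pact p y (k + n)"
  by (simp add: sq_pact_eq_sum add_ac)

lemma sq_pact_diff: "sq.pact p (\<lambda>k. x k - y k) = (\<lambda>k. sq.pact p x k - sq.pact p y k)"
  by (simp add: fun_eq_iff sq_pact_eq_sum algebra_simps sum_subtractf)

lemma sq_pact_of_int:
  "sq.pact (map_poly of_int p) (\<lambda>k. of_int (y k)) k = (of_int (sq.pact p y k) :: 'a::{comm_ring_1,ring_char_0})"
proof -
  have "degree (map_poly of_int p :: 'a poly) = degree p"
    by (rule degree_map_poly) auto
  then show ?thesis
    by (simp add: sq_pact_eq_sum coeff_map_poly)
qed

lemma sq_pact_tendsto_0: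
  fixes y :: "nat \<Rightarrow> 'a::{real_normed_algebra_1,comm_ring_1}"
  assumes "y \<longlonglongrightarrow> 0"
  shows "sq.pact p y \<longlonglongrightarrow> 0"
proof -
  have "(\<lambda>k. \<Sum>i\<le>degree p. coeff p i * y (k + i)) \<longlonglongrightarrow> (\<Sum>i\<le>degree p. coeff p i * 0)"
    by (intro tendsto_intros LIMSEQ_ignore_initial_segment assms)
  then show ?thesis
    by (simp add: sq_pact_eq_sum[abs_def])
qed

text \<open>The recurrence need not be monic, so \<open>y\<close> is determined by its first terms only because
  the ring has no zero divisors.\<close>

lemma sq_pact_eq_0_imp_eq_0:
  fixes y :: "nat \<Rightarrow> 'a::idom"
  assumes "p \<noteq> 0" "\<And>k. k + degree p < n \<Longrightarrow> sq.pact p y k = 0"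
    and "\<And>k. k < degree p \<Longrightarrow> y k = 0"
    and "k < n"
  shows "y k = 0"
  using assms(4)
proof (induction k rule: less_induct)
  case (less k)
  show ?case
  proof (cases "k < degree p")
    case False
    define j where "j = k - degree p"
    have k: "k = j + degree p" using False by (simp add: j_def)
    have "0 = (\<Sum>i\<le>degree p. coeff p i * y (j + i))"
      using assms(2)[of j] less.prems k by (simp add: sq_pact_eq_sum)
    also have "\<dots> = (\<Sum>i<degree p. coeff p i * y (j + i)) + lead_coeff p * y k"
      by (simp add: lessThan_Suc_atMost[symmetric] k)
    also have "(\<Sum>i<degree p. coeff p i * y (j + i)) = 0"
      using less k by (intro sum.neutral) auto
    finally show ?thesis using assms(1) by simp
  qed (use assms(3) in auto)
qed

section \<open>Contractions and irreducibility\<close>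

abbreviation mpow :: "'a::semiring_1 ^ 'n ^ 'n \<Rightarrow> nat \<Rightarrow> 'a ^ 'n \<Rightarrow> 'a ^ 'n" where
  "mpow A k \<equiv> ((*v) A) ^^ k"

lemma mpow_add_right: "mpow A k (v + w) = mpow A k v + mpow A k w"
  by (induction k) (simp_all add: matrix_vector_right_distrib)

lemma mpow_scale: "mpow A k (c *s v) = c *s mpow A k v" for A :: "'a::field^'n^'n"
  by (induction k) (simp_all add: vc.g_scale)

lemma mpow_0_right [simp]: "mpow A k 0 = 0"
  by (induction k) simp_all

lemma mpow_sum: "mpow A k (\<Sum>i\<in>I. f i) = (\<Sum>i\<in>I. mpow A k (f i))"
  by (induction I rule: infinite_finite_induct) (simp_all add: mpow_add_right)

lemma mpow_eigenvector:
  fixes A :: "'a::field^'n^'n"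
  assumes "A *v v = z *s v"
  shows "mpow A k v = z ^ k *s v"
  by (induction k) (simp_all add: vc.g_scale assms mult.commute)

lemma mpow_inverse:
  assumes "\<And>v. A *v (B *v v) = v"
  shows "mpow A k (mpow B k v) = v"
  by (induction k arbitrary: v) (simp_all add: funpow_swap1 assms)

section \<open>Annihilating polynomials and eigenvalues of a matrix\<close>

lemma ex_annihilating_poly_vec:
  fixes A :: "'a::field^'n^'n"
  shows "\<exists>p. p \<noteq> 0 \<and> vc.pact A p v = 0"
proof -
  let ?f = "\<lambda>k. mpow A k v"
  let ?N = "{..CARD('n)}"
  have "\<exists>c. (\<exists>k\<in>?N. c k \<noteq> 0) \<and> (\<Sum>k\<in>?N. c k *s ?f k) = 0"
  \<comment> \<open>Linear dependence is a property of sets, so a repetition in the orbit is treated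
    apart: there the difference of two monomials annihilates \<open>v\<close>.\<close>
  proof (cases "inj_on ?f ?N")
    case True
    then have "card (?f ` ?N) = Suc CARD('n)" by (simp add: card_image)
    then have "vec.dependent (?f ` ?N)"
      using vec.independent_bound_general[of "?f ` ?N"] dim_subset_UNIV_cart_gen[of "?f ` ?N"]
      by auto
    then obtain u where u: "\<exists>w\<in>?f ` ?N. u w \<noteq> 0" "(\<Sum>w\<in>?f ` ?N. u w *s w) = 0"
      by (subst (asm) vec.dependent_finite) auto
    show ?thesis
      using u by (intro exI[of _ "\<lambda>k. u (?f k)"]) (simp add: sum.reindex[OF True])
  next
    case False
    then obtain i j where ij: "i \<in> ?N" "j \<in> ?N" "?f i = ?f j" "i \<noteq> j"
      by (auto simp: inj_on_def)
    let ?c = "\<lambda>k. (if k = i then 1 else 0) - (if k = j then 1 else 0) :: 'a"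
    have "(\<Sum>k\<in>?N. ?c k *s ?f k) = (\<Sum>k\<in>?N. (if k = i then ?f k else 0) - (if k = j then ?f k else 0))"
      by (intro sum.cong) (auto simp: vector_sub_rdistrib)
    also have "\<dots> = 0"
      using ij by (simp add: sum_subtractf)
    finally show ?thesis
      using ij by (intro exI[of _ ?c]) auto
  qed
  then obtain c k0 where c: "k0 \<in> ?N" "c k0 \<noteq> 0" "(\<Sum>k\<in>?N. c k *s ?f k) = 0" by auto
  define p where "p = (\<Sum>k\<in>?N. monom (c k) k)"
  have cp: "coeff p k = (if k \<le> CARD('n) then c k else 0)" for k
    by (simp add: p_def coeff_sum sum.delta)
  have "degree p \<le> CARD('n)"
    by (rule degree_le) (simp add: cp)
  then have "vc.pact A p v = (\<Sum>k\<in>?N. coeff p k *s ?f k)"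
    unfolding vc.pact_eq_sum by (intro sum.mono_neutral_left) (auto simp: coeff_eq_0)
  also have "\<dots> = 0" using c(3) by (simp add: cp)
  finally show ?thesis
    using c cp[of k0] by (intro exI[of _ p]) auto
qed

text \<open>Annihilators of the basis vectors are multiplied together; as they commute, the product
  kills every basis vector.\<close>

lemma ex_annihilating_poly:
  fixes A :: "'a::field^'n^'n"
  shows "\<exists>p. p \<noteq> 0 \<and> (\<forall>v. vc.pact A p v = 0)"
proof -
  obtain P where P: "\<And>i. P i \<noteq> 0" "\<And>i. vc.pact A (P i) (axis i 1) = 0"
    using ex_annihilating_poly_vec[of A "axis _ 1"] by metis
  define p where "p = (\<Prod>i\<in>UNIV. P i)"
  have "vc.pact A p (axis i 1) = 0" for i
  proof -
    have "p = (\<Prod>i\<in>UNIV - {i}. P i) * P i"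
      by (simp add: p_def prod.remove[of UNIV i] mult.commute)
    then show ?thesis by (simp add: vc.pact_mult P)
  qed
  moreover have "vc.pact A p (\<Sum>i\<in>I. v $ i *s axis i 1) = (\<Sum>i\<in>I. v $ i *s vc.pact A p (axis i 1))" for v I
    by (induction I rule: infinite_finite_induct) (simp_all add: vc.pact_add_right vc.pact_scale_right)
  ultimately have "vc.pact A p v = 0" for v
    using basis_expansion[of v] by (metis (no_types, lifting) sum.neutral vector_smult_rzero)
  moreover have "p \<noteq> 0" by (simp add: p_def P)
  ultimately show ?thesis by blast
qed

lemma finite_eigenvalues: "finite {z. \<exists>v. v \<noteq> 0 \<and> A *v v = z *s v}"
  for A :: "'a::field^'n^'n"
proof -
  obtain p where p: "p \<noteq> 0" "\<And>v. vc.pact A p v = 0" using ex_annihilating_poly[of A] by blast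
  have "poly p z = 0" if "v \<noteq> 0" "A *v v = z *s v" for z v
    using vc.pact_eigenvector[of A v z p] that p by simp
  then show ?thesis
    using poly_roots_finite[OF p(1)] by (elim finite_subset[rotated]) blast
qed

text \<open>Any annihilating polynomial of least degree will do.\<close>

lemma ex_annihilating_poly_roots:
  fixes A :: "'a::field^'n^'n"
  shows "\<exists>p. p \<noteq> 0 \<and> (\<forall>v. vc.pact A p v = 0) \<and> (\<forall>z. poly p z = 0 \<longrightarrow> (\<exists>v. v \<noteq> 0 \<and> A *v v = z *s v))"
proof -
  let ?P = "\<lambda>p. p \<noteq> 0 \<and> (\<forall>v. vc.pact A p v = 0)"
  obtain p where p: "?P p" "\<And>q. ?P q \<Longrightarrow> degree p \<le> degree q"
    using ex_has_least_nat[of ?P _ degree] ex_annihilating_poly[of A] by metis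
  have "\<exists>v. v \<noteq> 0 \<and> A *v v = z *s v" if "poly p z = 0" for z
  proof -
    obtain q where q: "p = [:-z, 1:] * q"
      using \<open>poly p z = 0\<close> by (auto simp: poly_eq_0_iff_dvd dvd_def)
    with p(1) have "q \<noteq> 0" by auto
    then have "degree p = Suc (degree q)" unfolding q by (subst degree_mult_eq) auto
    with p(2)[of q] \<open>q \<noteq> 0\<close> obtain v where v: "vc.pact A q v \<noteq> 0" by auto
    have "vc.pact A [:-z, 1:] (vc.pact A q v) = 0"
      using p(1) by (simp only: q flip: vc.pact_mult)
    then have "A *v vc.pact A q v = z *s vc.pact A q v"
      by (simp add: vc.g_add eq_neg_iff_add_eq_0 vector_smult_lneg)
    with v show ?thesis by blast
  qed
  with p show ?thesis by blast
qed

section \<open>Summability of orbits for spectral radius below one\<close>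

lemma summable_norm_recurrence:
  fixes y :: "nat \<Rightarrow> complex"
  assumes "summable (\<lambda>k. norm (y (Suc k) - z * y k))" "norm z < 1"
  shows "summable (\<lambda>k. norm (y k))"
proof (rule summableI_nonneg_bounded)
  let ?W = "\<Sum>k. norm (y (Suc k) - z * y k)"
  fix n
  let ?S = "\<Sum>k<n. norm (y k)"
  have "?S \<le> norm (y 0) + (\<Sum>k<n. norm (y (Suc k)))"
    using sum_mono2[of "{..<Suc n}" "{..<n}" "\<lambda>k. norm (y k)"]
    by (simp add: sum.lessThan_Suc_shift del: sum.lessThan_Suc)
  also have "(\<Sum>k<n. norm (y (Suc k))) \<le> (\<Sum>k<n. norm (y (Suc k) - z * y k) + norm z * norm (y k))"
    by (intro sum_mono) (metis add.commute diff_add_cancel norm_mult norm_triangle_ineq)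
  also have "\<dots> \<le> ?W + norm z * ?S"
    using sum_le_suminf[OF assms(1), of "{..<n}"] by (simp add: sum.distrib sum_distrib_left)
  \<comment> \<open>The partial sum reappears on the right with factor \<open>norm z < 1\<close>; it
    is absorbed on the left, uniformly in \<open>n\<close>.\<close>
  finally have "?S * (1 - norm z) \<le> norm (y 0) + ?W" by (simp add: algebra_simps)
  then show "?S \<le> (norm (y 0) + ?W) / (1 - norm z)"
    using assms(2) by (simp add: pos_le_divide_eq)
qed auto

text \<open>Each root contributes a first-order recurrence that can be undone without losing
  summability, since the root lies inside the unit disc. Splitting off roots one at a time handles
  repeated roots without a Jordan form.\<close>

lemma summable_mpow_of_poly:
  fixes A :: "complex^'n^'n"
  assumes "q \<noteq> 0" "\<And>z. poly q z = 0 \<Longrightarrow> norm z < 1"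
    and "\<And>i. summable (\<lambda>k. norm (mpow A k (vc.pact A q v) $ i))"
  shows "summable (\<lambda>k. norm (mpow A k v $ i))"
  using assms
proof (induction "degree q" arbitrary: q i)
  case 0
  then obtain c where c: "q = [:c:]" "c \<noteq> 0" by (metis degree_eq_zeroE pCons_0_0)
  then show ?case
    using summable_mult[OF 0(4)[of i], of "norm (1 / c)"] by (simp add: mpow_scale norm_mult norm_divide)
next
  case (Suc n)
  then obtain z where z: "poly q z = 0"
    using alg_closed_imp_poly_has_root[of q] by (metis zero_less_Suc)
  then obtain r where r: "q = [:-z, 1:] * r" by (auto simp: poly_eq_0_iff_dvd dvd_def)
  with Suc.prems have "r \<noteq> 0" by auto
  then have "n = degree r" using Suc.hyps unfolding r by (subst (asm) degree_mult_eq) auto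
  moreover have "summable (\<lambda>k. norm (mpow A k (vc.pact A r v) $ j))" for j
  proof (rule summable_norm_recurrence)
    have "mpow A k (vc.pact A q v) = mpow A (Suc k) (vc.pact A r v) - z *s mpow A k (vc.pact A r v)" for k
    proof -
      have "vc.pact A q v = A *v vc.pact A r v + (- z) *s vc.pact A r v"
        unfolding r vc.pact_mult by (simp add: vc.g_add)
      then show ?thesis
        by (simp only: mpow_add_right mpow_scale) (simp add: funpow_swap1 vector_smult_lneg)
    qed
    then show "summable (\<lambda>k. norm (mpow A (Suc k) (vc.pact A r v) $ j - z * mpow A k (vc.pact A r v) $ j))"
      using Suc.prems(3)[of j] by simp
  qed (use Suc.prems(2) z in auto)
  ultimately show ?case
    using Suc.hyps(1)[of r] \<open>r \<noteq> 0\<close> Suc.prems(2) by (auto simp: r)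
qed

lemma cmat_cvec: "cmat A *v cvec v = cvec (A *v v)"
  by (simp add: cmat_def cvec_def map_matrix_def matrix_vector_mult_def vec_eq_iff)

lemma mpow_cmat_cvec: "mpow (cmat A) k (cvec v) = cvec (mpow A k v)"
  by (induction k) (simp_all add: cmat_cvec)

lemma cvec_0 [simp]: "cvec 0 = 0"
  by (simp add: cvec_def vec_eq_iff)

lemma cvec_eq_0_iff [simp]: "cvec v = 0 \<longleftrightarrow> v = 0"
  by (simp add: cvec_def vec_eq_iff)

lemma spectral_radius_less_1_imp_summable:
  assumes "spectral_radius A < 1"
  shows "summable (\<lambda>k. norm (mpow A k v))"
proof -
  obtain p where p: "p \<noteq> 0" "\<And>v. vc.pact (cmat A) p v = 0"
      "\<And>z. poly p z = 0 \<Longrightarrow> \<exists>v. v \<noteq> 0 \<and> cmat A *v v = z *s v"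
    using ex_annihilating_poly_roots[of "cmat A"] by metis
  have "norm z < 1" if "poly p z = 0" for z
    using that assms p(3)[OF that] finite_eigenvalues[of "cmat A"] unfolding spectral_radius_def
    by (subst (asm) Max_less_iff) auto
  from summable_mpow_of_poly[OF p(1) this, of "cmat A" "cvec v"] p(2)
  have "summable (\<lambda>k. norm (mpow (cmat A) k (cvec v) $ i))" for i by simp
  then have "summable (\<lambda>k. \<Sum>i\<in>UNIV. \<bar>mpow A k v $ i\<bar>)"
    by (intro summable_sum) (simp add: mpow_cmat_cvec, simp add: cvec_def)
  then show ?thesis
    by (rule summable_comparison_test'[where N = 0]) (simp add: norm_le_l1_cart)
qed

section \<open>The contraction, its adjoint and the expanding inverse\<close>

locale contraction =
  fixes A :: "real^'d^'d"
  assumes invertible_A: "invertible A" and radius: "spectral_radius A < 1"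
begin

definition "B = transpose A"
definition "M = matrix_inv B"

lemma B_M [simp]: "B *v (M *v v) = v" and M_B [simp]: "M *v (B *v v) = v"
proof -
  have "invertible B" using invertible_A unfolding B_def by (rule transpose_invertible)
  then have "B ** M = mat 1 \<and> M ** B = mat 1"
    unfolding M_def matrix_inv_def invertible_def by (rule someI_ex)
  then show "B *v (M *v v) = v" "M *v (B *v v) = v"
    by (simp_all add: matrix_vector_mul_assoc)
qed

lemma summable_mpow: "summable (\<lambda>k. norm (mpow A k v))"
  using spectral_radius_less_1_imp_summable[OF radius] .

lemma mpow_tendsto_0: "(\<lambda>k. mpow A k v) \<longlonglongrightarrow> 0"
  using summable_LIMSEQ_zero[OF summable_mpow] by (simp add: tendsto_norm_zero_iff)

lemma inner_mpow: "mpow B k v \<bullet> w = v \<bullet> mpow A k w"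
proof (induction k arbitrary: w)
  case (Suc k)
  have "(B *v u) \<bullet> w = u \<bullet> (A *v w)" for u
    by (simp add: B_def dot_lmul_matrix)
  then show ?case by (simp add: Suc) (simp add: funpow_swap1)
qed simp

lemma mpow_B_tendsto_0: "(\<lambda>n. mpow B n \<xi>) \<longlonglongrightarrow> 0"
proof (rule vec_tendstoI)
  fix i
  have "(\<lambda>n. \<xi> \<bullet> mpow A n (axis i 1)) \<longlonglongrightarrow> \<xi> \<bullet> 0" by (intro tendsto_intros mpow_tendsto_0)
  then show "(\<lambda>n. mpow B n \<xi> $ i) \<longlonglongrightarrow> 0 $ i"
    by (simp add: inner_mpow[symmetric] inner_axis)
qed

lemma cinner_cmat_B: "cinner (cmat B *v v) (cvec w) = cinner v (cvec (A *v w))"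
proof -
  have "cinner (cmat B *v v) (cvec w) = (\<Sum>i\<in>UNIV. \<Sum>j\<in>UNIV. of_real (A $ j $ i) * v $ j * of_real (w $ i))"
    by (simp add: B_def cinner_def cmat_def cvec_def map_matrix_def matrix_vector_mult_def transpose_def sum_distrib_right)
  also have "\<dots> = (\<Sum>j\<in>UNIV. \<Sum>i\<in>UNIV. of_real (A $ j $ i) * v $ j * of_real (w $ i))"
    by (rule sum.swap)
  also have "\<dots> = cinner v (cvec (A *v w))"
    by (simp add: cinner_def cvec_def matrix_vector_mult_def sum_distrib_left mult_ac)
  finally show ?thesis .
qed

lemma cinner_mpow_B: "cinner (mpow (cmat B) k v) (cvec w) = cinner v (cvec (mpow A k w))"
proof (induction k arbitrary: w)
  case (Suc k)
  then show ?case by (simp add: cinner_cmat_B) (simp add: funpow_swap1)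
qed simp

lemma cmat_B_M [simp]: "cmat B *v (cmat M *v v) = v"
  and cmat_M_B [simp]: "cmat M *v (cmat B *v v) = v"
proof -
  have decomp: "v = cvec (\<chi> i. Re (v $ i)) + \<i> *s cvec (\<chi> i. Im (v $ i))"
    by (simp add: vec_eq_iff cvec_def complex_eq_iff)
  show "cmat B *v (cmat M *v v) = v" "cmat M *v (cmat B *v v) = v"
    by (subst (2) decomp, subst decomp, simp only: matrix_vector_right_distrib vc.g_scale cmat_cvec B_M M_B)+
qed

lemma cinner_axis: "cinner v (cvec (axis i 1)) = v $ i"
proof -
  have "cinner v (cvec (axis i 1)) = (\<Sum>j\<in>UNIV. if j = i then v $ j else 0)"
    unfolding cinner_def by (intro sum.cong) (auto simp: cvec_def axis_def)
  then show ?thesis by simp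
qed

text \<open>Powers of \<open>M\<close> on the vector are balanced by powers of \<open>A\<close> on
  the test vector. As the latter contract to 0, any bound on the orbit of \<open>v\<close> under
  \<open>M\<close> forces \<open>v\<close> to vanish.\<close>

lemma component_eq: "v $ i = cinner (mpow (cmat M) k v) (cvec (mpow A k (axis i 1)))"
  using mpow_inverse[of "cmat B" "cmat M" k v]
  by (simp add: cinner_axis flip: cinner_mpow_B)

lemma tendsto_cinner:
  assumes "v \<longlonglongrightarrow> v0" "w \<longlonglongrightarrow> w0"
  shows "(\<lambda>k. cinner (v k) (cvec (w k))) \<longlonglongrightarrow> cinner v0 (cvec w0)"
  unfolding cinner_def cvec_def using assms by (auto intro!: tendsto_intros)

text \<open>For \<open>norm z \<le> 1\<close> the orbit of \<open>v\<close> under \<open>M\<close>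
  would stay bounded, which \<open>component_eq\<close> excludes. This avoids comparing the spectra
  of \<open>A\<close>, of its transpose and of the inverse.\<close>

lemma eigenvalue_M_norm_gt_1:
  assumes "cmat M *v v = z *s v" "v \<noteq> 0"
  shows "norm z > 1"
proof (rule ccontr)
  assume z: "\<not> norm z > 1"
  have "v $ i = 0" for i
  proof (rule tendsto_unique[of sequentially])
    have "(\<lambda>k. cinner v (cvec (mpow A k (axis i 1)))) \<longlonglongrightarrow> 0"
      using tendsto_cinner[OF tendsto_const mpow_tendsto_0] by (simp add: cinner_def)
    moreover have "norm (v $ i) \<le> norm (cinner v (cvec (mpow A k (axis i 1)))) * 1" for k
    proof -
      have "v $ i = z ^ k * cinner v (cvec (mpow A k (axis i 1)))"
        unfolding component_eq[of v i k] mpow_eigenvector[OF assms(1)]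
        by (simp add: cinner_def sum_distrib_left mult_ac)
      then have "norm (v $ i) = norm z ^ k * norm (cinner v (cvec (mpow A k (axis i 1))))"
        by (simp add: norm_mult norm_power)
      then show ?thesis
        using z by (simp add: mult_left_le_one_le power_le_one)
    qed
    ultimately show "(\<lambda>k. v $ i) \<longlonglongrightarrow> 0"
      by (intro Lim_null_comparison[of "\<lambda>k. v $ i" "\<lambda>k. norm (cinner v (cvec (mpow A k (axis i 1))))"])
        (auto intro: tendsto_norm_zero)
  qed auto
  then show False using assms(2) by (simp add: vec_eq_iff)
qed

lemma ex_fixed_point: "\<exists>x. A *v x + b = x"
proof -
  let ?x = "\<Sum>k. mpow A k b"
  have s: "summable (\<lambda>k. mpow A k b)" using summable_norm_cancel[OF summable_mpow] .
  have "?x = b + (\<Sum>k. mpow A (Suc k) b)"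
    using suminf_split_head[OF s] by simp
  also have "(\<Sum>k. mpow A (Suc k) b) = A *v ?x"
    using bounded_linear.suminf[OF matrix_vector_mul_bounded_linear s, of A] by simp
  finally show ?thesis by (metis add.commute)
qed

text \<open>The translate of \<open>W\<close> through the fixed point of the first map is preserved
  by every map, since the other maps differ from the first by vectors of \<open>W\<close>.\<close>

lemma irreducible_invariant_subspace:
  assumes "affinely_irreducible m A a" "m \<ge> 1"
    and W: "subspace W" "\<And>u. u \<in> W \<Longrightarrow> A *v u \<in> W" "\<And>l. l \<in> {1..m} \<Longrightarrow> a l - a 1 \<in> W"
  shows "W = UNIV"
proof -
  obtain x where x: "A *v x + a 1 = x" using ex_fixed_point by blast
  have injA: "inj ((*v) A)" using invertible_A by (metis invertible_left_inverse matrix_left_invertible_injective)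
  \<comment> \<open>Irreducibility speaks of equality of image and subspace, so inclusion is not
    enough; injectivity of \<open>A\<close> and dimension upgrade it.\<close>
  have AW: "(*v) A ` W = W"
  proof (rule subspace_dim_equal)
    have "dim ((*v) A ` W) = dim W"
      by (rule dim_image_eq) (auto intro: inj_on_subset[OF injA] simp: W)
    then show "dim ((*v) A ` W) \<ge> dim W" by simp
  qed (use W in \<open>auto intro: linear_subspace_image\<close>)
  define V where "V = (+) x ` W"
  have "ifs_map A (a l) ` V = V" if "l \<in> {1..m}" for l
  proof -
    have "ifs_map A (a l) (x + w) = x + (A *v w + (a l - a 1))" for w
      using arg_cong[OF x, of "\<lambda>u. u + (A *v w + (a l - a 1))"]
      by (simp add: ifs_map_def matrix_vector_right_distrib algebra_simps)
    then have "ifs_map A (a l) ` V = (+) x ` ((\<lambda>w. w + (a l - a 1)) ` (*v) A ` W)"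
      by (force simp: V_def image_image)
    also have "(\<lambda>w. w + (a l - a 1)) ` (*v) A ` W = W"
      unfolding AW using W(3)[OF that] W(1)
      by (force simp: image_iff subspace_add subspace_diff intro: bexI[of _ "_ - (a l - a 1)"])
    finally show ?thesis by (simp add: V_def)
  qed
  then have invariant: "\<forall>l\<in>{1..m}. ifs_map A (a l) ` V = V" by blast
  have "affine V" "V \<noteq> {}"
    using W(1) subspace_0[OF W(1)] unfolding V_def
    by (auto simp flip: affine_translation intro: subspace_imp_affine)
  then have "V = UNIV"
    using assms(1) invariant unfolding affinely_irreducible_def by metis
  then show ?thesis
    unfolding V_def by (metis (no_types) UNIV_eq_I add_diff_cancel_left' imageE iso_tuple_UNIV_I)
qed

end

locale irreducible_ifs = contraction A for A :: "real^'d^'d" +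
  fixes m :: nat and a :: "nat \<Rightarrow> real^'d"
  assumes m1: "m \<ge> 1" and irred: "affinely_irreducible m A a"
begin

definition "b l = a l - a 1"

text \<open>The test vectors along which the pairings tend to 0 form a subspace, invariant under
  \<open>A\<close> because \<open>A\<close> merely delays the sequence by one. By irreducibility it
  is everything, so the orbit under \<open>M\<close> tends to 0, and \<open>component_eq\<close>
  gives \<open>v = 0\<close>.\<close>

lemma cinner_mpow_tendsto_0_imp_eq_0:
  assumes "\<And>l. l \<in> {1..m} \<Longrightarrow> (\<lambda>k. cinner (mpow (cmat M) k v) (cvec (b l))) \<longlonglongrightarrow> 0"
  shows "v = 0"
proof -
  define W where "W = {u. (\<lambda>k. cinner (mpow (cmat M) k v) (cvec u)) \<longlonglongrightarrow> 0}"
  have "W = UNIV"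
  proof (rule irreducible_invariant_subspace[OF irred m1])
    have "cinner w (cvec (u + u')) = cinner w (cvec u) + cinner w (cvec u')"
         "cinner w (cvec (c *\<^sub>R u)) = c * cinner w (cvec u)" for w :: "complex^'d" and u u' c
      by (simp_all add: cinner_def cvec_def algebra_simps sum.distrib sum_distrib_left)
    then show "subspace W"
      by (auto simp: subspace_def W_def cinner_def[of _ 0] intro!: tendsto_add_zero tendsto_mult_right_zero)
    show "A *v u \<in> W" if "u \<in> W" for u
    proof -
      have "cinner (mpow (cmat M) (Suc k) v) (cvec (A *v u)) = cinner (mpow (cmat M) k v) (cvec u)" for k
        by (simp flip: cinner_cmat_B)
      then have "(\<lambda>k. cinner (mpow (cmat M) (Suc k) v) (cvec (A *v u))) \<longlonglongrightarrow> 0"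
        using that by (simp add: W_def)
      then show ?thesis
        unfolding W_def mem_Collect_eq by (rule LIMSEQ_imp_Suc)
    qed
  qed (use assms in \<open>auto simp: W_def b_def\<close>)
  then have W: "(\<lambda>k. cinner (mpow (cmat M) k v) (cvec u)) \<longlonglongrightarrow> 0" for u by (auto simp: W_def)
  have "(\<lambda>k. mpow (cmat M) k v) \<longlonglongrightarrow> 0"
    using W[of "axis _ 1"] by (intro vec_tendstoI) (simp add: cinner_axis)
  from tendsto_cinner[OF this mpow_tendsto_0[of "axis _ 1"]] have "(\<lambda>k. v $ i) \<longlonglongrightarrow> 0" for i
    by (simp add: cinner_def[of 0] flip: component_eq)
  then show ?thesis by (simp add: vec_eq_iff LIMSEQ_const_iff)
qed

end

section \<open>The self-affine measure and its Fourier transform\<close>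

text \<open>Cut-offs of the distance to a closed set are bounded, Lipschitz and converge to its
  indicator, and closed sets generate the Borel sets. Lipschitz functions are the class that
  iterates of the transfer operator flatten.\<close>

lemma measure_eqI_lipschitz:
  fixes \<mu> \<nu> :: "'a::metric_space measure"
  assumes \<mu>: "borel_prob_measure \<mu>" and \<nu>: "borel_prob_measure \<nu>"
    and eq: "\<And>(g :: 'a \<Rightarrow> real) K. (\<And>x y. \<bar>g x - g y\<bar> \<le> K * dist x y) \<Longrightarrow> (\<And>x. \<bar>g x\<bar> \<le> 1) \<Longrightarrow>
               (\<integral>x. g x \<partial>\<mu>) = (\<integral>x. g x \<partial>\<nu>)"
  shows "\<mu> = \<nu>"
proof (rule measure_eqI_generator_eq[where E = "Collect closed" and \<Omega> = UNIV and A = "\<lambda>_. UNIV"])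
  interpret \<mu>: prob_space \<mu> using \<mu> by (simp add: borel_prob_measure_def)
  interpret \<nu>: prob_space \<nu> using \<nu> by (simp add: borel_prob_measure_def)
  have sets[measurable_cong]: "sets \<mu> = sets borel" "sets \<nu> = sets borel"
    using \<mu> \<nu> by (auto simp: borel_prob_measure_def)
  show "emeasure \<mu> F = emeasure \<nu> F" if "F \<in> Collect closed" for F
  proof (cases "F = {}")
    case False
    define g where "g n x = max 0 (1 - real n * infdist x F)" for n x
    have g: "\<bar>g n x - g n y\<bar> \<le> real n * dist x y" "\<bar>g n x\<bar> \<le> 1" for n x y
    proof -
      have "real n * \<bar>infdist x F - infdist y F\<bar> \<le> real n * dist x y"
        by (intro mult_left_mono infdist_triangle_abs) auto
      then have "\<bar>real n * infdist x F - real n * infdist y F\<bar> \<le> real n * dist x y"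
        by (simp add: abs_mult flip: right_diff_distrib)
      then show "\<bar>g n x - g n y\<bar> \<le> real n * dist x y" by (auto simp: g_def max_def abs_if split: if_splits)
      show "\<bar>g n x\<bar> \<le> 1" by (auto simp: g_def max_def infdist_nonneg)
    qed
    have g_meas[measurable]: "g n \<in> borel_measurable borel" for n
      unfolding g_def by (intro borel_measurable_continuous_onI continuous_intros)
    have lim: "(\<lambda>n. g n x) \<longlonglongrightarrow> indicator F x" for x
    proof (cases "x \<in> F")
      case False
      then have "infdist x F > 0"
        using that \<open>F \<noteq> {}\<close> by (auto intro: infdist_pos_not_in_closed)
      then obtain N where N: "1 < real N * infdist x F"
        using reals_Archimedean3 by blast
      have "g n x = 0" if "n \<ge> N" for n
      proof -
        have "real N * infdist x F \<le> real n * infdist x F"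
          using that by (intro mult_right_mono) (auto simp: infdist_nonneg)
        with N show ?thesis by (simp add: g_def)
      qed
      then have "eventually (\<lambda>n. g n x = 0) sequentially" by (auto simp: eventually_sequentially)
      then show ?thesis using False by (simp add: tendsto_eventually)
    qed (simp add: g_def)
    have [measurable]: "F \<in> sets borel" using that by simp
    have "(\<lambda>n. \<integral>x. g n x \<partial>\<mu>) \<longlonglongrightarrow> (\<integral>x. indicator F x \<partial>\<mu>)"
      by (rule integral_dominated_convergence[where w = "\<lambda>_. 1"]) (use lim g in auto)
    moreover have "(\<lambda>n. \<integral>x. g n x \<partial>\<nu>) \<longlonglongrightarrow> (\<integral>x. indicator F x \<partial>\<nu>)"
      by (rule integral_dominated_convergence[where w = "\<lambda>_. 1"]) (use lim g in auto)
    moreover have "(\<integral>x. g n x \<partial>\<mu>) = (\<integral>x. g n x \<partial>\<nu>)" for n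
      using g by (rule eq)
    ultimately have "(\<integral>x. indicator F x \<partial>\<mu>) = (\<integral>x. (indicator F x :: real) \<partial>\<nu>)"
      by (metis (no_types, lifting) LIMSEQ_unique ext)
    then show ?thesis
      by (simp add: \<mu>.emeasure_eq_measure \<nu>.emeasure_eq_measure sets_eq_imp_space_eq[OF sets(1)] sets_eq_imp_space_eq[OF sets(2)])
  qed simp
  show "sets \<mu> = sigma_sets UNIV (Collect closed)" "sets \<nu> = sigma_sets UNIV (Collect closed)"
    unfolding sets by (simp_all add: borel_eq_closed)
  show "emeasure \<mu> UNIV \<noteq> \<infinity>" by simp
qed (auto simp: Int_stable_def)

locale weighted_ifs = irreducible_ifs A m a for A :: "real^'d^'d" and m a +
  fixes p :: "nat \<Rightarrow> real"
  assumes p: "strictly_positive_prob_vector m p"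
begin

lemma p_pos: "l \<in> {1..m} \<Longrightarrow> p l > 0" and p_sum: "(\<Sum>l=1..m. p l) = 1"
  using p by (auto simp: strictly_positive_prob_vector_def)

definition "P = embed_pmf (\<lambda>l. if l \<in> {1..m} then p l else 0)"

lemma pmf_P: "pmf P l = (if l \<in> {1..m} then p l else 0)"
  unfolding P_def
proof (rule pmf_embed_pmf)
  have "(\<integral>\<^sup>+ l. ennreal (if l \<in> {1..m} then p l else 0) \<partial>count_space UNIV) = (\<Sum>l=1..m. ennreal (p l))"
    by (subst nn_integral_count_space'[of "{1..m}"]) (auto intro: sum.cong)
  also have "\<dots> = 1" using p_pos p_sum by (subst sum_ennreal) (auto intro: less_imp_le)
  finally show "(\<integral>\<^sup>+ l. ennreal (if l \<in> {1..m} then p l else 0) \<partial>count_space UNIV) = 1" .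
qed (use p_pos in \<open>auto intro: less_imp_le\<close>)

lemma set_P: "set_pmf P = {1..m}"
  using p_pos by (force simp: set_pmf_eq pmf_P)

text \<open>The default 0 makes the series in \<open>addr\<close> converge for every stream rather
  than almost every one. \<open>addr\<close> is the coding map from symbol streams to
  points.\<close>

definition "offset l = (if l \<in> {1..m} then a l else 0)"
definition "addr \<omega> = (\<Sum>k. mpow A k (offset (\<omega> !! k)))" for \<omega> :: "nat stream"

lemma summable_addr: "summable (\<lambda>k. mpow A k (offset (\<omega> !! k)))"
proof (rule summable_norm_cancel, rule summable_comparison_test'[where N = 0])
  show "summable (\<lambda>k. \<Sum>l\<in>{1..m}. norm (mpow A k (a l)))"
    by (intro summable_sum summable_mpow)
  have "norm (mpow A k (a l)) \<le> (\<Sum>l\<in>{1..m}. norm (mpow A k (a l)))" if "l \<in> {1..m}" for k l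
    using that by (rule member_le_sum) auto
  then show "norm (norm (mpow A k (offset (\<omega> !! k)))) \<le> (\<Sum>l\<in>{1..m}. norm (mpow A k (a l)))" for k
    by (auto simp: offset_def sum_nonneg)
qed

lemma addr_SCons: "addr (l ## \<omega>) = A *v addr \<omega> + offset l"
proof -
  have "addr (l ## \<omega>) = offset l + (\<Sum>k. A *v (mpow A k (offset (\<omega> !! k))))"
    unfolding addr_def using suminf_split_head[OF summable_addr[of "l ## \<omega>"]] by simp
  also have "(\<Sum>k. A *v (mpow A k (offset (\<omega> !! k)))) = A *v addr \<omega>"
    unfolding addr_def
    using bounded_linear.suminf[OF matrix_vector_mul_bounded_linear summable_addr, of A \<omega>] by simp
  finally show ?thesis by simp
qed

lemma continuous_mult_vec [continuous_intros]:
  "continuous_on S f \<Longrightarrow> continuous_on S (\<lambda>x. C *v f x)" for C :: "real^'d^'d"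
  by (rule bounded_linear.continuous_on[OF matrix_vector_mul_bounded_linear])

lemma measurable_ifs_map [measurable]: "ifs_map A c \<in> borel_measurable borel"
  unfolding ifs_map_def by (intro borel_measurable_continuous_onI continuous_intros)

lemma measurable_addr [measurable]: "addr \<in> borel_measurable (stream_space (measure_pmf P))"
proof -
  have [measurable]: "(\<lambda>l. mpow A k (offset l)) \<in> borel_measurable (measure_pmf P)" for k
    by simp
  have "(\<lambda>\<omega>. mpow A k (offset (\<omega> !! k))) \<in> borel_measurable (stream_space (measure_pmf P))" for k
    by measurable
  then show ?thesis
    unfolding addr_def by (rule borel_measurable_suminf)
qed

abbreviation (input) invariant :: "(real^'d) measure \<Rightarrow> bool" where
  "invariant \<mu> \<equiv> borel_prob_measure \<mu> \<and>
     (\<forall>E\<in>sets borel. measure \<mu> E = (\<Sum>l=1..m. p l * measure \<mu> (ifs_map A (a l) -` E)))"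

text \<open>The law of the coding map under independent symbols is invariant: splitting off the
  first symbol applies the corresponding map of the system.\<close>

lemma ex_invariant: "\<exists>\<mu>. invariant \<mu>"
proof -
  interpret S: prob_space "stream_space (measure_pmf P)"
    by (rule prob_space.prob_space_stream_space) (rule prob_space_measure_pmf)
  define \<mu> where "\<mu> = distr (stream_space (measure_pmf P)) borel addr"
  interpret \<mu>: prob_space \<mu> unfolding \<mu>_def by (rule S.prob_space_distr) simp
  have "borel_prob_measure \<mu>"
    using \<mu>.prob_space_axioms by (simp add: borel_prob_measure_def \<mu>_def)
  moreover have "measure \<mu> E = (\<Sum>l=1..m. p l * measure \<mu> (ifs_map A (a l) -` E))"
    if [measurable]: "E \<in> sets borel" for E
  proof -
    have pre: "ifs_map A (a l) -` E \<in> sets borel" for l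
      using measurable_sets[OF measurable_ifs_map that, of "a l"] by simp
    have em: "emeasure \<mu> F = (\<integral>\<^sup>+\<omega>. indicator F (addr \<omega>) \<partial>stream_space (measure_pmf P))"
      if [measurable]: "F \<in> sets borel" for F
    proof -
      have "emeasure \<mu> F = (\<integral>\<^sup>+x. indicator F x \<partial>\<mu>)"
        by (simp add: \<mu>_def)
      then show ?thesis unfolding \<mu>_def by (simp add: nn_integral_distr del: nn_integral_indicator)
    qed
    have "emeasure \<mu> E = (\<integral>\<^sup>+l. (\<integral>\<^sup>+\<omega>. indicator E (addr (l ## \<omega>)) \<partial>stream_space (measure_pmf P)) \<partial>measure_pmf P)"
      unfolding em[OF that] by (rule prob_space.nn_integral_stream_space[OF prob_space_measure_pmf]) simp
    also have "\<dots> = (\<Sum>l\<in>{1..m}. (\<integral>\<^sup>+\<omega>. indicator E (addr (l ## \<omega>)) \<partial>stream_space (measure_pmf P)) * p l)"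
      by (subst nn_integral_measure_pmf_finite) (auto simp: set_P pmf_P intro!: sum.cong)
    also have "\<dots> = (\<Sum>l\<in>{1..m}. emeasure \<mu> (ifs_map A (a l) -` E) * p l)"
      unfolding em[OF pre]
      by (intro sum.cong refl) (auto simp: addr_SCons offset_def ifs_map_def indicator_def)
    also have "\<dots> = (\<Sum>l\<in>{1..m}. ennreal (p l * measure \<mu> (ifs_map A (a l) -` E)))"
      using p_pos by (intro sum.cong refl) (auto simp: \<mu>.emeasure_eq_measure ennreal_mult mult.commute less_imp_le)
    also have "\<dots> = ennreal (\<Sum>l\<in>{1..m}. p l * measure \<mu> (ifs_map A (a l) -` E))"
      using p_pos by (subst sum_ennreal) (simp_all add: less_imp_le)
    finally show ?thesis
      using p_pos
      by (subst (asm) \<mu>.emeasure_eq_measure, subst (asm) ennreal_inj)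
        (auto intro!: sum_nonneg mult_nonneg_nonneg simp: less_imp_le)
  qed
  ultimately show ?thesis by blast
qed

text \<open>Invariance says that \<open>\<mu>\<close> is the law of a random map of the system
  applied to an independent point with law \<open>\<mu>\<close>. Fubini then carries it from sets to
  bounded integrands, complex exponentials included.\<close>

lemma invariant_integral:
  fixes g :: "real^'d \<Rightarrow> 'b::{banach, second_countable_topology}"
  assumes \<mu>: "invariant \<mu>" and g[measurable]: "g \<in> borel_measurable borel" and bd: "\<And>x. norm (g x) \<le> K"
  shows "(\<integral>x. g x \<partial>\<mu>) = (\<Sum>l=1..m. p l *\<^sub>R (\<integral>x. g (ifs_map A (a l) x) \<partial>\<mu>))"
proof -
  interpret \<mu>: prob_space \<mu> using \<mu> by (simp add: borel_prob_measure_def)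
  interpret PS: pair_prob_space "measure_pmf P" \<mu> ..
  have sets[measurable_cong]: "sets \<mu> = sets borel"
    using \<mu> by (auto simp: borel_prob_measure_def)
  define f where "f = (\<lambda>(l, x). ifs_map A (a l) x)"
  have [measurable]: "f \<in> borel_measurable (measure_pmf P \<Otimes>\<^sub>M \<mu>)"
  proof -
    have "(\<lambda>z. ifs_map A (a (fst z)) (snd z)) \<in> borel_measurable (measure_pmf P \<Otimes>\<^sub>M \<mu>)"
      by (rule measurable_compose_countable[where g = fst and f = "\<lambda>l z. ifs_map A (a l) (snd z)"]) auto
    then show ?thesis by (simp add: f_def case_prod_unfold)
  qed
  have "\<mu> = distr (measure_pmf P \<Otimes>\<^sub>M \<mu>) borel f"
  proof (rule measure_eqI)
    fix E assume "E \<in> sets \<mu>"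
    then have [measurable]: "E \<in> sets borel" by (simp add: sets)
    have "emeasure (distr (measure_pmf P \<Otimes>\<^sub>M \<mu>) borel f) E =
        (\<integral>\<^sup>+l. emeasure \<mu> (Pair l -` (f -` E \<inter> space (measure_pmf P \<Otimes>\<^sub>M \<mu>))) \<partial>measure_pmf P)"
      by (subst emeasure_distr, simp, simp, rule \<mu>.emeasure_pair_measure_alt) measurable
    also have "\<dots> = (\<integral>\<^sup>+l. emeasure \<mu> (ifs_map A (a l) -` E) \<partial>measure_pmf P)"
      by (intro nn_integral_cong arg_cong[where f = "emeasure \<mu>"])
        (auto simp: f_def space_pair_measure sets_eq_imp_space_eq[OF sets])
    also have "\<dots> = (\<Sum>l\<in>{1..m}. emeasure \<mu> (ifs_map A (a l) -` E) * p l)"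
      by (subst nn_integral_measure_pmf_finite) (auto simp: set_P pmf_P intro!: sum.cong)
    also have "\<dots> = (\<Sum>l\<in>{1..m}. ennreal (p l * measure \<mu> (ifs_map A (a l) -` E)))"
      using p_pos by (intro sum.cong refl) (auto simp: \<mu>.emeasure_eq_measure ennreal_mult mult.commute less_imp_le)
    also have "\<dots> = ennreal (\<Sum>l\<in>{1..m}. p l * measure \<mu> (ifs_map A (a l) -` E))"
      using p_pos by (subst sum_ennreal) (simp_all add: less_imp_le)
    also have "\<dots> = emeasure \<mu> E"
      using \<mu> by (simp add: \<mu>.emeasure_eq_measure)
    finally show "emeasure \<mu> E = emeasure (distr (measure_pmf P \<Otimes>\<^sub>M \<mu>) borel f) E" ..
  qed (simp add: sets)
  then have "(\<integral>x. g x \<partial>\<mu>) = (\<integral>x. g x \<partial>distr (measure_pmf P \<Otimes>\<^sub>M \<mu>) borel f)" by simp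
  also have "\<dots> = (\<integral>z. g (f z) \<partial>(measure_pmf P \<Otimes>\<^sub>M \<mu>))"
    by (rule integral_distr) auto
  also have "\<dots> = (\<integral>l. (\<integral>x. g (f (l, x)) \<partial>\<mu>) \<partial>measure_pmf P)"
    by (rule PS.integral_fst'[symmetric], rule PS.P.integrable_const_bound[where B = K]) (auto simp: bd)
  also have "\<dots> = (\<Sum>l=1..m. p l *\<^sub>R (\<integral>x. g (ifs_map A (a l) x) \<partial>\<mu>))"
    by (subst integral_measure_pmf[of "{1..m}"]) (auto simp: set_P pmf_P f_def intro!: sum.cong)
  finally show ?thesis .
qed

section \<open>Uniqueness of the invariant measure\<close>

definition transfer :: "(real^'d \<Rightarrow> real) \<Rightarrow> real^'d \<Rightarrow> real" where
  "transfer g x = (\<Sum>l=1..m. p l * g (ifs_map A (a l) x))"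

lemma transfer_bound:
  assumes "\<And>x. \<bar>g x\<bar> \<le> 1"
  shows "\<bar>transfer g x\<bar> \<le> 1"
proof -
  have "\<bar>transfer g x\<bar> \<le> (\<Sum>l=1..m. p l * 1)"
    unfolding transfer_def using p_pos assms
    by (intro order.trans[OF sum_abs] sum_mono) (simp add: abs_mult less_imp_le)
  then show ?thesis using p_sum by simp
qed

lemma transfer_funpow_bound: "(\<And>x. \<bar>g x\<bar> \<le> 1) \<Longrightarrow> \<bar>(transfer ^^ n) g x\<bar> \<le> 1"
  by (induction n arbitrary: x) (simp_all add: transfer_bound)

text \<open>The bound keeps \<open>mpow A n\<close> applied to the difference instead of a power of
  a contraction ratio, because the norm of \<open>A\<close> may exceed 1.\<close>

lemma transfer_funpow_lipschitz:
  assumes "\<And>x y. \<bar>g x - g y\<bar> \<le> K * dist x y"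
  shows "\<bar>(transfer ^^ n) g x - (transfer ^^ n) g y\<bar> \<le> K * norm (mpow A n (x - y))"
proof (induction n arbitrary: x y)
  case 0
  then show ?case using assms by (simp add: dist_norm)
next
  case (Suc n)
  let ?h = "(transfer ^^ n) g"
  have "\<bar>transfer ?h x - transfer ?h y\<bar> \<le> (\<Sum>l=1..m. p l * \<bar>?h (ifs_map A (a l) x) - ?h (ifs_map A (a l) y)\<bar>)"
    unfolding transfer_def using p_pos
    by (simp flip: sum_subtractf right_diff_distrib)
      (intro order.trans[OF sum_abs] sum_mono, simp add: abs_mult less_imp_le)
  also have "\<dots> \<le> (\<Sum>l=1..m. p l * (K * norm (mpow A (Suc n) (x - y))))"
  proof (intro sum_mono mult_left_mono)
    fix l
    have "ifs_map A (a l) x - ifs_map A (a l) y = A *v (x - y)"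
      by (simp add: ifs_map_def matrix_vector_mult_diff_distrib)
    then show "\<bar>?h (ifs_map A (a l) x) - ?h (ifs_map A (a l) y)\<bar> \<le> K * norm (mpow A (Suc n) (x - y))"
      using Suc[of "ifs_map A (a l) x" "ifs_map A (a l) y"] by (simp add: funpow_swap1)
  qed (use p_pos in \<open>auto intro: less_imp_le\<close>)
  also have "\<dots> = K * norm (mpow A (Suc n) (x - y))"
    using p_sum by (simp flip: sum_distrib_right)
  finally show ?case by simp
qed

lemma measurable_transfer: "g \<in> borel_measurable borel \<Longrightarrow> transfer g \<in> borel_measurable borel"
  unfolding transfer_def using measurable_compose[OF measurable_ifs_map, of g]
  by (intro borel_measurable_sum borel_measurable_times) auto

lemma transfer_funpow_measurable: "g \<in> borel_measurable borel \<Longrightarrow> (transfer ^^ n) g \<in> borel_measurable borel"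
  by (induction n) (simp_all add: measurable_transfer)

lemma integral_transfer_funpow:
  assumes \<mu>: "invariant \<mu>" and g: "g \<in> borel_measurable borel" "\<And>x. \<bar>g x\<bar> \<le> 1"
  shows "(\<integral>x. (transfer ^^ n) g x \<partial>\<mu>) = (\<integral>x. g x \<partial>\<mu>)"
proof (induction n)
  case (Suc n)
  interpret \<mu>: prob_space \<mu> using \<mu> by (simp add: borel_prob_measure_def)
  have sets[measurable_cong]: "sets \<mu> = sets borel"
    using \<mu> by (auto simp: borel_prob_measure_def)
  let ?h = "(transfer ^^ n) g"
  have h[measurable]: "?h \<in> borel_measurable borel" using g by (simp add: transfer_funpow_measurable)
  have "(\<integral>x. transfer ?h x \<partial>\<mu>) = (\<Sum>l=1..m. \<integral>x. p l * ?h (ifs_map A (a l) x) \<partial>\<mu>)"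
    unfolding transfer_def[of ?h]
    by (intro Bochner_Integration.integral_sum integrable_mult_right \<mu>.integrable_const_bound[where B = 1])
      (auto simp: transfer_funpow_bound g)
  also have "\<dots> = (\<integral>x. ?h x \<partial>\<mu>)"
    using invariant_integral[OF \<mu> h, of 1] transfer_funpow_bound[of g] g by simp
  finally show ?case using Suc by simp
qed simp

text \<open>The iterates of the transfer operator flatten a Lipschitz function, which pins down its integral
  as the limit of their values at \<open>0\<close>.\<close>

lemma integral_eq_lim_transfer:
  assumes \<mu>: "invariant \<mu>" and lip: "\<And>x y. \<bar>g x - g y\<bar> \<le> K * dist x y" and bd: "\<And>x. \<bar>g x\<bar> \<le> 1"
  shows "(\<lambda>n. (transfer ^^ n) g 0) \<longlonglongrightarrow> (\<integral>x. g x \<partial>\<mu>)"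
proof -
  interpret \<mu>: prob_space \<mu> using \<mu> by (simp add: borel_prob_measure_def)
  have sets[measurable_cong]: "sets \<mu> = sets borel"
    using \<mu> by (auto simp: borel_prob_measure_def)
  have "continuous_on UNIV g"
  proof (rule continuous_on_eq_continuous_within[THEN iffD2], intro ballI)
    fix x
    have "(g \<longlongrightarrow> g x) (at x)"
    proof (rule LIM_zero_cancel, rule Lim_null_comparison)
      show "eventually (\<lambda>y. norm (g y - g x) \<le> K * dist y x) (at x)" using lip by simp
      have "((\<lambda>y. K * dist y x) \<longlongrightarrow> K * dist x x) (at x)" by (intro tendsto_intros)
      then show "((\<lambda>y. K * dist y x) \<longlongrightarrow> 0) (at x)" by simp
    qed
    then show "continuous (at x) g" by (simp add: continuous_at)
  qed
  then have g: "g \<in> borel_measurable borel" by (rule borel_measurable_continuous_onI)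
  have h[measurable]: "(transfer ^^ n) g \<in> borel_measurable borel" for n
    using g by (simp add: transfer_funpow_measurable)
  have "(\<lambda>n. \<integral>x. (transfer ^^ n) g x - (transfer ^^ n) g 0 \<partial>\<mu>) \<longlonglongrightarrow> (\<integral>x. 0 \<partial>\<mu>)"
  proof (rule integral_dominated_convergence[where w = "\<lambda>_. 2"])
    show "AE x in \<mu>. (\<lambda>n. (transfer ^^ n) g x - (transfer ^^ n) g 0) \<longlonglongrightarrow> 0"
    proof (rule AE_I2, rule Lim_null_comparison)
      fix x
      show "eventually (\<lambda>n. norm ((transfer ^^ n) g x - (transfer ^^ n) g 0) \<le> K * norm (mpow A n (x - 0))) sequentially"
        unfolding real_norm_def by (intro always_eventually allI transfer_funpow_lipschitz lip)
      show "(\<lambda>n. K * norm (mpow A n (x - 0))) \<longlonglongrightarrow> 0"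
        by (intro tendsto_mult_right_zero tendsto_norm_zero mpow_tendsto_0)
    qed
    show "AE x in \<mu>. norm ((transfer ^^ n) g x - (transfer ^^ n) g 0) \<le> 2" for n
    proof (rule AE_I2)
      show "norm ((transfer ^^ n) g x - (transfer ^^ n) g 0) \<le> 2" for x
        using transfer_funpow_bound[of g n x, OF bd] transfer_funpow_bound[of g n 0, OF bd]
        unfolding real_norm_def abs_le_iff by linarith
    qed
  qed auto
  moreover have "(\<integral>x. (transfer ^^ n) g x - (transfer ^^ n) g 0 \<partial>\<mu>) = (\<integral>x. g x \<partial>\<mu>) - (transfer ^^ n) g 0" for n
    by (subst Bochner_Integration.integral_diff)
      (auto simp: integral_transfer_funpow[OF \<mu> g bd] \<mu>.prob_space transfer_funpow_bound[OF bd]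
        intro!: \<mu>.integrable_const_bound[where B = 1])
  ultimately have "(\<lambda>n. (\<integral>x. g x \<partial>\<mu>) - (transfer ^^ n) g 0) \<longlonglongrightarrow> 0" by simp
  from tendsto_diff[OF tendsto_const[of "\<integral>x. g x \<partial>\<mu>"] this] show ?thesis by simp
qed

section \<open>The Fourier transform of the self-affine measure\<close>

abbreviation "\<mu> \<equiv> self_affine_measure m A a p"

text \<open>The coding construction gives existence and the limits of transfer iterates give
  uniqueness, so the definite description in \<open>self_affine_measure\<close> denotes.\<close>

lemma invariant_self_affine: "invariant \<mu>"
proof -
  have "\<exists>!\<mu>. invariant \<mu>"
  proof (rule ex_ex1I[OF ex_invariant])
    fix \<mu> \<nu> assume "invariant \<mu>" "invariant \<nu>"
    then show "\<mu> = \<nu>"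
      by (intro measure_eqI_lipschitz)
        (blast, blast, rule LIMSEQ_unique[OF integral_eq_lim_transfer integral_eq_lim_transfer])
  qed
  then show ?thesis unfolding self_affine_measure_def by (rule theI')
qed

sublocale \<mu>: prob_space \<mu>
  using invariant_self_affine by (simp add: borel_prob_measure_def)

lemma sets_\<mu> [measurable_cong, simp]: "sets \<mu> = sets borel"
  using invariant_self_affine by (auto simp: borel_prob_measure_def)

text \<open>The Fourier transform of the discrete measure with mass \<open>p l\<close> at
  \<open>a l\<close>.\<close>

definition mask :: "real^'d \<Rightarrow> complex" where
  "mask \<xi> = (\<Sum>l=1..m. p l *\<^sub>R exp (2 * pi * \<i> * complex_of_real (\<xi> \<bullet> a l)))"

lemma norm_exp_2pi [simp]: "norm (exp (2 * pi * \<i> * complex_of_real t)) = 1"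
  by (simp add: norm_exp_eq_Re)

lemma measurable_exp_inner: "(\<lambda>x. exp (2 * pi * \<i> * complex_of_real (\<xi> \<bullet> x))) \<in> borel_measurable borel" for \<xi> :: "real^'d"
  by (intro borel_measurable_continuous_onI continuous_intros)

lemma fourier_self_affine: "fourier_transform \<mu> \<xi> = mask \<xi> * fourier_transform \<mu> (B *v \<xi>)"
proof -
  have "exp (2 * pi * \<i> * complex_of_real (\<xi> \<bullet> ifs_map A (a l) x)) =
      exp (2 * pi * \<i> * complex_of_real (\<xi> \<bullet> a l)) * exp (2 * pi * \<i> * complex_of_real ((B *v \<xi>) \<bullet> x))" for l x
  proof -
    have "\<xi> \<bullet> ifs_map A (a l) x = \<xi> \<bullet> a l + (B *v \<xi>) \<bullet> x"
      using inner_mpow[of 1 \<xi> x] by (simp add: ifs_map_def inner_add_right)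
    then show ?thesis by (simp only: of_real_add distrib_left exp_add)
  qed
  then show ?thesis
    unfolding fourier_transform_def
    by (subst invariant_integral[OF invariant_self_affine measurable_exp_inner, of _ 1])
      (simp_all add: mask_def sum_distrib_right)
qed

lemma norm_fourier_le_1: "norm (fourier_transform \<mu> \<xi>) \<le> 1"
proof -
  have "norm (fourier_transform \<mu> \<xi>) \<le> (\<integral>x. norm (exp (2 * pi * \<i> * complex_of_real (\<xi> \<bullet> x))) \<partial>\<mu>)"
    unfolding fourier_transform_def by (rule integral_norm_bound)
  then show ?thesis by (simp add: \<mu>.prob_space)
qed

lemma fourier_tendsto_1:
  assumes "\<xi> \<longlonglongrightarrow> 0"
  shows "(\<lambda>k. fourier_transform \<mu> (\<xi> k)) \<longlonglongrightarrow> 1"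
proof -
  have "(\<lambda>k. fourier_transform \<mu> (\<xi> k)) \<longlonglongrightarrow> (\<integral>x. 1 \<partial>\<mu>)"
    unfolding fourier_transform_def
  proof (rule integral_dominated_convergence[where w = "\<lambda>_. 1"])
    show "AE x in \<mu>. (\<lambda>k. exp (2 * pi * \<i> * complex_of_real (\<xi> k \<bullet> x))) \<longlonglongrightarrow> 1"
    proof (rule AE_I2)
      fix x
      have "(\<lambda>k. exp (2 * pi * \<i> * complex_of_real (\<xi> k \<bullet> x))) \<longlonglongrightarrow> exp (2 * pi * \<i> * complex_of_real (0 \<bullet> x))"
        using assms by (intro tendsto_intros)
      then show "(\<lambda>k. exp (2 * pi * \<i> * complex_of_real (\<xi> k \<bullet> x))) \<longlonglongrightarrow> 1" by simp
    qed
  qed (use measurable_exp_inner in auto)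
  then show ?thesis by (simp add: \<mu>.prob_space)
qed

lemma fourier_eq_prod:
  "norm (fourier_transform \<mu> \<xi>) = (\<Prod>k<n. norm (mask (mpow B k \<xi>))) * norm (fourier_transform \<mu> (mpow B n \<xi>))"
proof (induction n)
  case (Suc n)
  then show ?case
    using fourier_self_affine[of "mpow B n \<xi>"] by (simp add: norm_mult)
qed simp

end

section \<open>Integer sequences close to linear recurrences\<close>

text \<open>A second moment: the coordinates of a uniformly chosen \<open>s\<close> are independent
  and centred, with variance at most \<open>h\<close>, so cross terms cancel. The constant
  \<open>c\<close> is there for the induction, where it collects the coordinate split off.\<close>

lemma sum_PiE_square_le:
  fixes D :: "int set" and f :: "'i \<Rightarrow> real"
  assumes "finite I" "finite D" "(\<Sum>y\<in>D. y) = 0" "\<And>y. y \<in> D \<Longrightarrow> (real_of_int y)\<^sup>2 \<le> h"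
  shows "(\<Sum>s\<in>PiE I (\<lambda>_. D). (c + (\<Sum>i\<in>I. real_of_int (s i) * f i))\<^sup>2)
    \<le> card (PiE I (\<lambda>_. D)) * (c\<^sup>2 + h * (\<Sum>i\<in>I. (f i)\<^sup>2))"
  using assms(1)
proof (induction I arbitrary: c rule: finite_induct)
  case (insert x I)
  let ?P = "PiE I (\<lambda>_. D)"
  have inj: "inj_on (\<lambda>(y, g). g(x := y)) (D \<times> ?P)"
    using inj_combinator[OF insert.hyps(2), of "\<lambda>_. D"] by simp
  have upd: "c + (\<Sum>i\<in>insert x I. real_of_int ((g(x := y)) i) * f i) =
      (c + y * f x) + (\<Sum>i\<in>I. real_of_int (g i) * f i)" for g y
  proof -
    have "(\<Sum>i\<in>I. real_of_int ((g(x := y)) i) * f i) = (\<Sum>i\<in>I. real_of_int (g i) * f i)"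
      using insert.hyps by (intro sum.cong) auto
    then have "(\<Sum>i\<in>insert x I. real_of_int ((g(x := y)) i) * f i) =
        y * f x + (\<Sum>i\<in>I. real_of_int (g i) * f i)"
      by (subst sum.insert[OF insert.hyps(1,2)], subst fun_upd_same) (rule arg_cong)
    then show ?thesis by (simp only: add.assoc)
  qed
  have D0: "(\<Sum>y\<in>D. real_of_int y) = 0" using arg_cong[OF assms(3), of real_of_int] by simp
  have D2: "(\<Sum>y\<in>D. (real_of_int y)\<^sup>2) \<le> card D * h"
    using sum_bounded_above[of D "\<lambda>y. (real_of_int y)\<^sup>2" h] assms(4) by simp
  have "(\<Sum>s\<in>PiE (insert x I) (\<lambda>_. D). (c + (\<Sum>i\<in>insert x I. real_of_int (s i) * f i))\<^sup>2) =
      (\<Sum>(y, g)\<in>D \<times> ?P. ((c + y * f x) + (\<Sum>i\<in>I. real_of_int (g i) * f i))\<^sup>2)"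
    unfolding PiE_insert_eq sum.reindex[OF inj] o_def by (intro sum.cong refl) (auto simp only: upd split: prod.split)
  also have "\<dots> = (\<Sum>y\<in>D. \<Sum>g\<in>?P. ((c + y * f x) + (\<Sum>i\<in>I. real_of_int (g i) * f i))\<^sup>2)"
    by (simp add: sum.cartesian_product)
  also have "\<dots> \<le> (\<Sum>y\<in>D. card ?P * ((c + y * f x)\<^sup>2 + h * (\<Sum>i\<in>I. (f i)\<^sup>2)))"
    by (intro sum_mono insert.IH)
  also have "\<dots> = card ?P * (card D * (c\<^sup>2 + h * (\<Sum>i\<in>I. (f i)\<^sup>2)) + 2 * c * f x * (\<Sum>y\<in>D. real_of_int y)
      + (f x)\<^sup>2 * (\<Sum>y\<in>D. (real_of_int y)\<^sup>2))"
  proof -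
    have "card ?P * ((c + y * f x)\<^sup>2 + h * (\<Sum>i\<in>I. (f i)\<^sup>2)) =
        card ?P * (c\<^sup>2 + h * (\<Sum>i\<in>I. (f i)\<^sup>2)) + (card ?P * (2 * c * f x)) * real_of_int y
        + (card ?P * (f x)\<^sup>2) * (real_of_int y)\<^sup>2" for y :: int
      by (simp add: power2_eq_square algebra_simps)
    then show ?thesis
      by (simp only: sum.distrib sum_distrib_left[symmetric] sum_constant) (simp add: algebra_simps)
  qed
  also have "\<dots> \<le> card ?P * (card D * (c\<^sup>2 + h * (\<Sum>i\<in>I. (f i)\<^sup>2)) + 2 * c * f x * 0
      + (f x)\<^sup>2 * (card D * h))"
    unfolding D0 using D2 by (intro mult_left_mono add_left_mono) auto
  also have "\<dots> = card (PiE (insert x I) (\<lambda>_. D)) * (c\<^sup>2 + h * (\<Sum>i\<in>insert x I. (f i)\<^sup>2))"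
    using insert.hyps by (simp add: card_PiE algebra_simps)
  finally show ?case .
qed simp

lemma sum_half_power_abs_le: "(\<Sum>j\<in>{- int n..int n}. (1/2::real) ^ nat \<bar>j\<bar>) = 3 - 2 * (1/2) ^ n"
proof (induction n)
  case (Suc n)
  have "{- int (Suc n)..int (Suc n)} = insert (- int (Suc n)) (insert (int (Suc n)) {- int n..int n})"
    by auto
  then show ?case using Suc by (simp add: nat_add_distrib)
qed simp

text \<open>Exponential weights: every counted vector has weight
  \<open>2 ^ W * (\<Prod>k<W. (1/2) ^ nat \<bar>r k\<bar>)\<close> at least 1, and over the whole
  box these weights factorize into coordinate sums below 3. Hence \<open>6 = 2 * 3\<close>, whatever
  \<open>n\<close> is.\<close>

lemma card_small_l1_le:
  "card {r \<in> PiE {..<W} (\<lambda>_. {- int n..int n}). (\<Sum>k<W. \<bar>r k\<bar>) \<le> int W} \<le> 6 ^ W"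
  (is "card ?R \<le> _")
proof -
  let ?P = "PiE {..<W} (\<lambda>_. {- int n..int n})"
  have finP: "finite ?P" by (intro finite_PiE) auto
  have "real (card ?R) = (\<Sum>r\<in>?R. 1)" by simp
  also have "\<dots> \<le> (\<Sum>r\<in>?R. 2 ^ W * (\<Prod>k<W. (1/2) ^ nat \<bar>r k\<bar>))"
  proof (rule sum_mono)
    fix r assume r: "r \<in> ?R"
    have "int (\<Sum>k<W. nat \<bar>r k\<bar>) \<le> int W"
      using r by simp
    then have "(\<Sum>k<W. nat \<bar>r k\<bar>) \<le> W" by (simp only: of_nat_le_iff)
    then have "(1/2::real) ^ W \<le> (1/2) ^ (\<Sum>k<W. nat \<bar>r k\<bar>)"
      by (intro power_decreasing) auto
    then have "(2::real) ^ W * (1/2) ^ W \<le> 2 ^ W * (1/2) ^ (\<Sum>k<W. nat \<bar>r k\<bar>)" by (intro mult_left_mono) auto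
    then show "1 \<le> (2::real) ^ W * (\<Prod>k<W. (1/2) ^ nat \<bar>r k\<bar>)"
      by (simp add: power_sum flip: power_mult_distrib)
  qed
  also have "\<dots> \<le> (\<Sum>r\<in>?P. 2 ^ W * (\<Prod>k<W. (1/2) ^ nat \<bar>r k\<bar>))"
  proof (rule sum_mono2[OF finP])
    show "?R \<subseteq> ?P" by blast
    show "0 \<le> (2::real) ^ W * (\<Prod>k<W. (1/2) ^ nat \<bar>r k\<bar>)" for r
      by (intro mult_nonneg_nonneg prod_nonneg ballI zero_le_power) simp_all
  qed
  also have "\<dots> = 2 ^ W * (\<Sum>r\<in>?P. \<Prod>k<W. (1/2) ^ nat \<bar>r k\<bar>)"
    by (rule sum_distrib_left[symmetric])
  also have "(\<Sum>r\<in>?P. \<Prod>k<W. (1/2::real) ^ nat \<bar>r k\<bar>) = (\<Prod>k<W. \<Sum>j\<in>{- int n..int n}. (1/2) ^ nat \<bar>j\<bar>)"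
    by (rule prod_sum_PiE[symmetric]) auto
  also have "2 ^ W * (\<Prod>k<W. \<Sum>j\<in>{- int n..int n}. (1/2::real) ^ nat \<bar>j\<bar>) \<le> 2 ^ W * 3 ^ W"
    unfolding sum_half_power_abs_le prod_constant card_lessThan
    by (intro mult_left_mono power_mono) (use power_le_one[of "1/2 :: real" n] in auto)
  finally have "real (card ?R) \<le> real (6 ^ W)" by (simp flip: power_mult_distrib)
  then show ?thesis by (simp only: of_nat_le_iff)
qed

text \<open>Siegel-type pigeonhole: a typical coefficient vector makes the forcing \<open>h s\<close> small in square
  mean, so the rounded forcing carries only \<open>6 ^ W\<close> possibilities, and together with the first
  \<open>degree q\<close> values it determines the sequence \<open>y s\<close> on the window.\<close>

lemma ex_int_relation_window:
  fixes N :: "nat \<Rightarrow> int" and q :: "real poly" and H L W Y :: nat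
  defines "f \<equiv> sq.pact q (\<lambda>k. real_of_int (N k))" and "d \<equiv> degree q"
  assumes monic: "lead_coeff q = 1"
    and f2: "summable (\<lambda>k. (f k)\<^sup>2)" "(\<Sum>k. (f k)\<^sup>2) \<le> \<epsilon>" "\<epsilon> > 0"
    and H: "H \<ge> 1" "32 * (real H)\<^sup>2 * \<epsilon> \<le> 1" and W: "W \<ge> 1"
    and Y: "\<And>k. k < L + d \<Longrightarrow> int (L + 1) * int H * \<bar>N k\<bar> \<le> int Y"
    and many: "2 * (2 * Y + 1) ^ d * 6 ^ W < (2 * H + 1) ^ (L + 1)"
  shows "\<exists>S. S \<noteq> 0 \<and> degree S \<le> L \<and> (\<forall>k<W + d. sq.pact S N k = 0)"
proof -
  define D where "D = {- int H..int H}"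
  define cube where "cube = PiE {..L} (\<lambda>_. D)"
  define y where "y s k = (\<Sum>i\<le>L. s i * N (k + i))" for s k
  define h where "h s k = (\<Sum>i\<le>L. real_of_int (s i) * f (k + i))" for s k
  define E where "E s = (\<Sum>k<W. (h s k)\<^sup>2)" for s
  define b where "b = real W * (real H)\<^sup>2 * \<epsilon>"
  have b0: "b > 0" using H W f2 by (simp add: b_def)
  have fin: "finite cube" unfolding cube_def D_def by (intro finite_PiE) auto
  have card_cube: "card cube = (2 * H + 1) ^ (L + 1)"
    by (simp add: cube_def D_def card_PiE nat_add_distrib nat_mult_distrib)
  have qy: "(\<Sum>j\<le>d. coeff q j * real_of_int (y s (k + j))) = h s k" for s k
    unfolding y_def h_def f_def d_def sq_pact_eq_sum
    by (simp add: sum_distrib_left, subst sum.swap) (simp add: algebra_simps)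
  have moment: "(\<Sum>s\<in>cube. E s) \<le> card cube * b"
  proof -
    have "(\<Sum>s\<in>cube. (h s k)\<^sup>2) \<le> card cube * ((real H)\<^sup>2 * \<epsilon>)" for k
    proof -
      have D0: "(\<Sum>y\<in>D. y) = 0"
      proof -
        have "(\<Sum>y\<in>D. y) = (\<Sum>y\<in>D. - y)"
          unfolding D_def by (rule sum.reindex_bij_witness[of _ uminus uminus]) auto
        then show ?thesis by (simp add: sum_negf)
      qed
      have "(\<Sum>s\<in>cube. (h s k)\<^sup>2) \<le> card cube * (0\<^sup>2 + (real H)\<^sup>2 * (\<Sum>i\<le>L. (f (k + i))\<^sup>2))"
        unfolding cube_def h_def
      proof (rule order.trans[OF eq_refl sum_PiE_square_le])
        show "(real_of_int y)\<^sup>2 \<le> (real H)\<^sup>2" if "y \<in> D" for y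
          using that by (subst abs_le_square_iff[symmetric]) (auto simp: D_def)
      qed (use D0 in \<open>auto simp: D_def\<close>)
      also have "(\<Sum>i\<le>L. (f (k + i))\<^sup>2) = (\<Sum>j\<in>(+) k ` {..L}. (f j)\<^sup>2)"
        by (simp add: sum.reindex)
      also have "\<dots> \<le> \<epsilon>"
        using sum_le_suminf[OF f2(1), of "(+) k ` {..L}"] f2(2) by simp
      finally show ?thesis by (simp add: mult_left_mono)
    qed
    then have "(\<Sum>k<W. \<Sum>s\<in>cube. (h s k)\<^sup>2) \<le> (\<Sum>k<W. card cube * ((real H)\<^sup>2 * \<epsilon>))"
      by (intro sum_mono)
    then show ?thesis
      unfolding E_def b_def by (subst sum.swap) (simp add: mult_ac)
  qed
  \<comment> \<open>Since \<open>b\<close> bounds the mean of \<open>E\<close> over the cube,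
    Markov's inequality keeps at least half of the cube; this costs the leading factor 2 in
    \<open>many\<close>.\<close>
  define Good where "Good = {s \<in> cube. E s \<le> 2 * b}"
  have card_Good: "card cube \<le> 2 * card Good"
  proof -
    have "card (cube - Good) * (2 * b) = (\<Sum>s\<in>cube - Good. 2 * b)" by simp
    also have "\<dots> \<le> (\<Sum>s\<in>cube - Good. E s)" by (intro sum_mono) (auto simp: Good_def)
    also have "\<dots> \<le> (\<Sum>s\<in>cube. E s)"
      using fin by (intro sum_mono2) (auto simp: E_def sum_nonneg)
    finally have "card (cube - Good) * (2 * b) \<le> card cube * b" using moment by linarith
    then have "2 * real (card (cube - Good)) \<le> card cube"
      using b0 by (simp add: mult.assoc[symmetric] mult.commute[of 2])
    moreover have "card (cube - Good) = card cube - card Good" "card Good \<le> card cube"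
      using fin by (auto simp: Good_def card_Diff_subset card_mono)
    ultimately show ?thesis by linarith
  qed
  \<comment> \<open>Doubling before rounding makes equal codes force forcings at distance at most
    1/2, which is less than the gap between integers.\<close>
  define code where "code s = (restrict (y s) {..<d}, restrict (\<lambda>k. round (2 * h s k)) {..<W})" for s
  let ?Y = "PiE {..<d} (\<lambda>_. {- int Y..int Y})"
  let ?R = "{r \<in> PiE {..<W} (\<lambda>_. {- int W..int W}). (\<Sum>k<W. \<bar>r k\<bar>) \<le> int W}"
  have "code s \<in> ?Y \<times> ?R" if s: "s \<in> Good" for s
  proof -
    have sD: "\<bar>s i\<bar> \<le> int H" if "i \<le> L" for i
      using s that PiE_mem[of s "{..L}" "\<lambda>_. D" i] by (auto simp: Good_def cube_def D_def)
    have "\<bar>y s k\<bar> \<le> int Y" if "k < d" for k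
    proof -
      have "int (L + 1) * \<bar>y s k\<bar> \<le> int (L + 1) * (\<Sum>i\<le>L. int H * \<bar>N (k + i)\<bar>)"
        unfolding y_def using sD
        by (intro mult_left_mono order.trans[OF sum_abs] sum_mono) (auto simp: abs_mult intro: mult_right_mono)
      also have "\<dots> = (\<Sum>i\<le>L. int (L + 1) * int H * \<bar>N (k + i)\<bar>)"
        by (simp add: sum_distrib_left algebra_simps)
      also have "\<dots> \<le> (\<Sum>i\<le>L. int Y)" using that by (intro sum_mono Y) auto
      also have "\<dots> = int (L + 1) * int Y" by simp
      finally show ?thesis by (simp del: of_nat_Suc of_nat_add)
    qed
    moreover have "(\<Sum>k<W. \<bar>round (2 * h s k)\<bar>) \<le> int W"
    proof -
      \<comment> \<open>A nonzero rounding requires \<open>\<bar>t\<bar> \<ge> 1/4\<close>, where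
        the square dominates. Together with \<open>E s \<le> 2 * b\<close> this produces the
        constant 32 in the hypothesis on \<open>\<epsilon>\<close>.\<close>
      have "real_of_int \<bar>round (2 * t)\<bar> \<le> 16 * t\<^sup>2" for t :: real
      proof (cases "round (2 * t) = 0")
        case False
        have rt: "\<bar>real_of_int (round (2 * t)) - 2 * t\<bar> \<le> 1/2" by (rule of_int_round_abs_le)
        with False have "1 \<le> \<bar>real_of_int (round (2 * t))\<bar>" by simp
        with rt have t: "\<bar>t\<bar> \<ge> 1/4" and "\<bar>real_of_int (round (2 * t))\<bar> \<le> 4 * \<bar>t\<bar>" by linarith+
        moreover have "4 * \<bar>t\<bar> * 1 \<le> 4 * \<bar>t\<bar> * (4 * \<bar>t\<bar>)" using t by (intro mult_left_mono) auto
        moreover have "4 * \<bar>t\<bar> * (4 * \<bar>t\<bar>) = 16 * t\<^sup>2" by (simp add: power2_eq_square)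
        ultimately show ?thesis by simp
      qed simp
      then have "real_of_int (\<Sum>k<W. \<bar>round (2 * h s k)\<bar>) \<le> (\<Sum>k<W. 16 * (h s k)\<^sup>2)"
        unfolding of_int_sum by (intro sum_mono)
      also have "\<dots> = 16 * E s" by (simp add: E_def sum_distrib_left)
      also have "\<dots> \<le> 32 * b" using s by (simp add: Good_def)
      also have "\<dots> = real W * (32 * (real H)\<^sup>2 * \<epsilon>)" by (simp add: b_def)
      also have "\<dots> \<le> real W * 1" using H by (intro mult_left_mono) auto
      finally show ?thesis by linarith
    qed
    moreover from this have "\<bar>round (2 * h s k)\<bar> \<le> int W" if "k < W" for k
      using that member_le_sum[of k "{..<W}" "\<lambda>k. \<bar>round (2 * h s k)\<bar>"] by auto
    ultimately show ?thesis
      unfolding code_def by (auto simp: abs_le_iff minus_le_iff)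
  qed
  then have sub: "code ` Good \<subseteq> ?Y \<times> ?R" by blast
  have "\<not> inj_on code Good"
  proof
    assume "inj_on code Good"
    then have "card Good \<le> card (?Y \<times> ?R)"
      using sub by (intro card_inj_on_le[of code]) (auto intro!: finite_PiE finite_cartesian_product finite_Collect_conjI)
    also have "\<dots> \<le> (2 * Y + 1) ^ d * 6 ^ W"
      unfolding card_cartesian_product using card_small_l1_le[of W W]
      by (intro mult_mono) (auto simp: card_PiE nat_add_distrib nat_mult_distrib)
    finally show False using card_Good many card_cube by simp
  qed
  then obtain s s' where ss: "s \<in> Good" "s' \<in> Good" "code s = code s'" "s \<noteq> s'"
    by (auto simp: inj_on_def)
  define S where "S = (\<Sum>i\<le>L. monom (s i - s' i) i)"
  have cS: "coeff S i = (if i \<le> L then s i - s' i else 0)" for i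
    by (simp add: S_def coeff_sum)
  define z where "z k = y s k - y s' k" for k
  have pz: "sq.pact S N k = z k" for k
    by (simp add: S_def sq_pact_sum_monom z_def y_def algebra_simps sum_subtractf)
  \<comment> \<open>As \<open>q\<close> is monic, each new value of \<open>z\<close> is the
    difference of two forcings once the \<open>d\<close> preceding values vanish; an integer of
    modulus at most 1/2 is 0.\<close>
  have "z k = 0" if "k < W + d" for k
    using that
  proof (induction k rule: less_induct)
    case (less k)
    show ?case
    proof (cases "k < d")
      case True
      then have "y s k = y s' k" using ss(3) by (auto simp: code_def restrict_def dest: fun_cong[of _ _ k])
      then show ?thesis by (simp add: z_def)
    next
      case False
      define j where "j = k - d"
      have j: "k = j + d" "j < W" using False less.prems by (auto simp: j_def)
      have "h s j - h s' j = (\<Sum>i\<le>d. coeff q i * real_of_int (z (j + i)))"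
        unfolding qy[symmetric] z_def by (simp add: algebra_simps sum_subtractf)
      also have "\<dots> = (\<Sum>i<d. coeff q i * real_of_int (z (j + i))) + coeff q d * real_of_int (z k)"
        by (simp add: lessThan_Suc_atMost[symmetric] j)
      also have "(\<Sum>i<d. coeff q i * real_of_int (z (j + i))) = 0"
        using less j by (intro sum.neutral) auto
      finally have "h s j - h s' j = real_of_int (z k)" using monic by (simp add: d_def)
      moreover have "round (2 * h s j) = round (2 * h s' j)"
        using ss(3) j by (auto simp: code_def restrict_def dest: fun_cong[of _ _ j])
      then have "\<bar>h s j - h s' j\<bar> \<le> 1/2"
        using of_int_round_abs_le[of "2 * h s j"] of_int_round_abs_le[of "2 * h s' j"] by linarith
      ultimately have "\<bar>real_of_int (z k)\<bar> \<le> 1/2" by simp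
      then show ?thesis by linarith
    qed
  qed
  moreover have "S \<noteq> 0"
  proof
    assume "S = 0"
    then have "s i = s' i" if "i \<le> L" for i using cS[of i] that by simp
    moreover have "s i = s' i" if "\<not> i \<le> L" for i
      using ss(1,2) that by (auto simp: Good_def cube_def PiE_def extensional_def)
    ultimately show False using ss(4) by blast
  qed
  moreover have "degree S \<le> L" by (rule degree_le) (simp add: cS)
  ultimately show ?thesis using pz by auto
qed

text \<open>A monic recurrence with bounded forcing grows at most geometrically; the forcing is
  absorbed into the rate \<open>C\<close> because \<open>K * C ^ k\<close> is at least 1. The
  constants are natural numbers because they enter a count.\<close>

lemma int_seq_growth:
  fixes N :: "nat \<Rightarrow> int" and q :: "real poly"
  assumes monic: "lead_coeff q = 1" and f: "\<And>k. \<bar>sq.pact q (\<lambda>k. real_of_int (N k)) k\<bar> \<le> F"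
  shows "\<exists>C K :: nat. C \<ge> 1 \<and> K \<ge> 1 \<and> (\<forall>k. \<bar>N k\<bar> \<le> int K * int C ^ k)"
proof -
  define d where "d = degree q"
  define c where "c = (\<Sum>i<d. \<bar>coeff q i\<bar>)"
  obtain C :: nat where C: "1 + F + c \<le> C" using real_arch_simple by blast
  obtain K :: nat where K: "1 + F + (\<Sum>k<d. \<bar>real_of_int (N k)\<bar>) \<le> K" using real_arch_simple by blast
  have F0: "F \<ge> 0" using f[of 0] by linarith
  have c0: "c \<ge> 0" by (simp add: c_def sum_nonneg)
  have C1: "real C \<ge> 1" using C F0 c0 by linarith
  have "(\<Sum>k<d. \<bar>real_of_int (N k)\<bar>) \<ge> 0" by (simp add: sum_nonneg)
  then have K1: "real K \<ge> 1" "real K \<ge> F" using K F0 by linarith+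
  have "\<bar>real_of_int (N k)\<bar> \<le> real K * real C ^ k" for k
  proof (induction k rule: less_induct)
    case (less k)
    show ?case
    proof (cases "k < d")
      case True
      have "\<bar>real_of_int (N k)\<bar> \<le> (\<Sum>k<d. \<bar>real_of_int (N k)\<bar>)" using True by (intro member_le_sum) auto
      also have "\<dots> \<le> real K * 1" using K F0 by simp
      also have "\<dots> \<le> real K * real C ^ k" using C1 by (intro mult_left_mono) auto
      finally show ?thesis .
    next
      case False
      define j where "j = k - d"
      have j: "k = j + d" using False by (simp add: j_def)
      have "sq.pact q (\<lambda>k. real_of_int (N k)) j = (\<Sum>i<d. coeff q i * real_of_int (N (j + i))) + N k"
        using monic by (simp add: sq_pact_eq_sum d_def[symmetric] lessThan_Suc_atMost[symmetric] j)
      then have *: "\<bar>real_of_int (N k)\<bar> \<le> F + \<bar>\<Sum>i<d. coeff q i * real_of_int (N (j + i))\<bar>"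
        using f[of j] by linarith
      show ?thesis
      proof (cases "d = 0")
        case True
        then have "\<bar>real_of_int (N k)\<bar> \<le> real K * 1" using * K1 by simp
        also have "\<dots> \<le> real K * real C ^ k" using C1 by (intro mult_left_mono) auto
        finally show ?thesis .
      next
        case False
        with j obtain k' where k': "k = Suc k'" using not0_implies_Suc[of k] by auto
        have "\<bar>\<Sum>i<d. coeff q i * real_of_int (N (j + i))\<bar> \<le> (\<Sum>i<d. \<bar>coeff q i\<bar> * (real K * real C ^ k'))"
        proof (intro order.trans[OF sum_abs] sum_mono)
          fix i assume "i \<in> {..<d}"
          then have i: "j + i < k" "j + i \<le> k'" using j k' by auto
          have "real K * real C ^ (j + i) \<le> real K * real C ^ k'"
            using i C1 by (intro mult_left_mono power_increasing) auto
          with less[OF i(1)] show "\<bar>coeff q i * real_of_int (N (j + i))\<bar> \<le> \<bar>coeff q i\<bar> * (real K * real C ^ k')"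
            by (auto simp: abs_mult intro!: mult_left_mono)
        qed
        also have "\<dots> = c * (real K * real C ^ k')" by (simp add: c_def sum_distrib_right)
        finally have "\<bar>real_of_int (N k)\<bar> \<le> F * 1 + c * (real K * real C ^ k')" using * by linarith
        also have "F * 1 \<le> F * (real K * real C ^ k')"
          using K1 C1 F0 mult_mono[of 1 "real K" 1 "real C ^ k'"] by (intro mult_left_mono) auto
        also have "F * (real K * real C ^ k') + c * (real K * real C ^ k') = (F + c) * (real K * real C ^ k')"
          by (simp add: algebra_simps)
        also have "\<dots> \<le> real C * (real K * real C ^ k')" using C by (intro mult_right_mono) auto
        finally show ?thesis by (simp add: k' mult_ac)
      qed
    qed
  qed
  then have "real_of_int \<bar>N k\<bar> \<le> real_of_int (int K * int C ^ k)" for k by simp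
  then have "\<bar>N k\<bar> \<le> int K * int C ^ k" for k by (simp only: of_int_le_iff)
  moreover have "C \<ge> 1" "K \<ge> 1" using C1 K1 by linarith+
  ultimately show ?thesis by blast
qed

text \<open>The relations of consecutive lengths hold on windows more than twice as long, which forces
  each of them to hold everywhere.\<close>

lemma ex_int_relation:
  fixes N :: "nat \<Rightarrow> int" and q :: "real poly"
  assumes monic: "lead_coeff q = 1" and f2: "summable (\<lambda>k. (sq.pact q (\<lambda>k. real_of_int (N k)) k)\<^sup>2)"
  shows "\<exists>S n. S \<noteq> 0 \<and> (\<forall>k. sq.pact S N (k + n) = 0)"
proof -
  define f where "f = sq.pact q (\<lambda>k. real_of_int (N k))"
  define d where "d = degree q"
  have "\<bar>f k\<bar> \<le> 1 + (\<Sum>k. (f k)\<^sup>2)" for k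
  proof -
    have "(f k)\<^sup>2 \<le> (\<Sum>k. (f k)\<^sup>2)"
      using sum_le_suminf[OF f2, of "{k}"] by (simp add: f_def)
    moreover have "\<bar>f k\<bar> \<le> 1 + (f k)\<^sup>2"
      using zero_le_power2[of "\<bar>f k\<bar> - 1"] zero_le_power2[of "f k"] by (simp add: power2_diff)
    ultimately show ?thesis by linarith
  qed
  then obtain C K :: nat where CK: "C \<ge> 1" "K \<ge> 1" "\<And>k. \<bar>N k\<bar> \<le> int K * int C ^ k"
    using int_seq_growth[OF monic, of N] unfolding f_def by blast
  \<comment> \<open>The window has \<open>2 * L + 2\<close> positions, each costing a factor 6,
    whence 36. The power \<open>(2 * C) ^ d\<close> pays for the \<open>d\<close> initial values:
    \<open>C\<close> for their growth in \<open>L\<close>, 2 for the factor \<open>L + 1\<close>.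
    The 2 in \<open>2 * H + 1\<close> remains to beat a constant.\<close>
  define H where "H = 36 * (2 * C) ^ d"
  have H1: "H \<ge> 1" using CK by (simp add: H_def)
  define \<epsilon> where "\<epsilon> = 1 / (32 * (real H)\<^sup>2)"
  have \<epsilon>: "\<epsilon> > 0" "32 * (real H)\<^sup>2 * \<epsilon> \<le> 1" using H1 by (auto simp: \<epsilon>_def)
  \<comment> \<open>Dropping \<open>n\<close> terms makes the forcing as small as \<open>H\<close>
    demands. It turns the growth constant into \<open>K'\<close> but leaves the rate
    \<open>C\<close> alone, which is why \<open>H\<close> could be fixed beforehand.\<close>
  obtain n where n: "norm (\<Sum>k. (f (k + n))\<^sup>2) < \<epsilon>"
    using suminf_exist_split[OF \<epsilon>(1) f2] unfolding f_def by blast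
  define N' where "N' k = N (k + n)" for k
  define K' where "K' = K * C ^ n"
  have K': "K' \<ge> 1" "\<bar>N' k\<bar> \<le> int K' * int C ^ k" for k
    using CK(1,2) CK(3)[of "k + n"] by (auto simp: K'_def N'_def power_add mult_ac)
  have f': "sq.pact q (\<lambda>k. real_of_int (N' k)) k = f (k + n)" for k
    unfolding N'_def f_def by (rule sq_pact_drop)
  define c where "c = 2 * (5 * H * K' * C ^ d) ^ d"
  obtain L0 where L0: "c < 2 ^ L0" using less_exp[of c] by blast
  have "\<exists>S. S \<noteq> 0 \<and> degree S \<le> L \<and> (\<forall>k<2 * L + 2 + d. sq.pact S N' k = 0)" if L: "L \<ge> L0" for L
    unfolding d_def
  proof (rule ex_int_relation_window[where H = H and \<epsilon> = \<epsilon> and Y = "(L + 1) * H * (K' * C ^ (L + d))"])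
    show "summable (\<lambda>k. (sq.pact q (\<lambda>k. real_of_int (N' k)) k)\<^sup>2)"
      unfolding f' using f2 unfolding f_def[symmetric] by (subst summable_iff_shift)
    show "(\<Sum>k. (sq.pact q (\<lambda>k. real_of_int (N' k)) k)\<^sup>2) \<le> \<epsilon>"
      unfolding f' using n by simp
    show "int (L + 1) * int H * \<bar>N' k\<bar> \<le> int ((L + 1) * H * (K' * C ^ (L + d)))" if "k < L + degree q" for k
    proof -
      have "int K' * int C ^ k \<le> int K' * int C ^ (L + d)"
        using that CK by (intro mult_left_mono power_increasing) (auto simp: d_def)
      then have "int (L + 1) * int H * \<bar>N' k\<bar> \<le> int (L + 1) * int H * (int K' * int C ^ (L + d))"
        using K'(2)[of k] by (intro mult_left_mono) auto
      then show ?thesis by (simp only: of_nat_mult of_nat_power mult.assoc)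
    qed
    show "2 * (2 * ((L + 1) * H * (K' * C ^ (L + d))) + 1) ^ degree q * 6 ^ (2 * L + 2) < (2 * H + 1) ^ (L + 1)"
    proof -
      have six: "(6::nat) ^ (2 * L + 2) = 36 ^ (L + 1)"
        using power_mult[of "6::nat" 2 "L + 1"] by (simp add: algebra_simps)
      have "1 \<le> (L + 1) * H * (K' * C ^ (L + d))" using H1 K' CK by simp
      then have "2 * ((L + 1) * H * (K' * C ^ (L + d))) + 1 \<le> 5 * ((L + 1) * H * (K' * C ^ (L + d)))"
        by linarith
      also have "\<dots> = (5 * H * K' * C ^ d) * ((L + 1) * C ^ L)" by (simp only: power_add mult_ac)
      also have "\<dots> \<le> (5 * H * K' * C ^ d) * (2 ^ (L + 1) * C ^ (L + 1))"
        using CK less_exp[of "L + 1"] by (intro mult_left_mono mult_mono power_increasing) auto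
      finally have "(2 * ((L + 1) * H * (K' * C ^ (L + d))) + 1) ^ d \<le>
          ((5 * H * K' * C ^ d) * (2 ^ (L + 1) * C ^ (L + 1))) ^ d"
        by (rule power_mono) simp
      also have "\<dots> = (5 * H * K' * C ^ d) ^ d * ((2 * C) ^ d) ^ (L + 1)"
        by (simp only: power_mult_distrib[symmetric] power_mult[symmetric] mult.commute[of d])
           (simp only: power_mult_distrib power_mult)
      finally have "2 * (2 * ((L + 1) * H * (K' * C ^ (L + d))) + 1) ^ d * 6 ^ (2 * L + 2) \<le>
          2 * ((5 * H * K' * C ^ d) ^ d * ((2 * C) ^ d) ^ (L + 1)) * 36 ^ (L + 1)"
        unfolding six by (intro mult_right_mono mult_left_mono) auto
      also have "2 * ((5 * H * K' * C ^ d) ^ d * ((2 * C) ^ d) ^ (L + 1)) * 36 ^ (L + 1) = c * H ^ (L + 1)"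
        by (simp only: c_def H_def power_mult_distrib[of 36] mult_ac)
      also have "\<dots> < 2 ^ (L + 1) * H ^ (L + 1)"
        using L0 L H1 power_increasing[of L0 "L + 1" "2::nat"] by (intro mult_strict_right_mono) auto
      also have "\<dots> = (2 * H) ^ (L + 1)" by (simp only: power_mult_distrib)
      also have "\<dots> \<le> (2 * H + 1) ^ (L + 1)" by (intro power_mono) auto
      finally show ?thesis by (simp only: d_def)
    qed
  qed (use monic \<epsilon> H1 in auto)
  then obtain S where S: "\<And>L. L \<ge> L0 \<Longrightarrow> S L \<noteq> 0" "\<And>L. L \<ge> L0 \<Longrightarrow> degree (S L) \<le> L"
      "\<And>L k. L \<ge> L0 \<Longrightarrow> k < 2 * L + 2 + d \<Longrightarrow> sq.pact (S L) N' k = 0"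
    by metis
  define y where "y = sq.pact (S L0) N'"
  have window: "y k = 0" if "L \<ge> L0" "k < L + 2" for L k
    using that
  proof (induction L arbitrary: k rule: dec_induct)
    case base
    then show ?case using S(3)[of L0 k] by (simp add: y_def)
  next
    case (step L)
    let ?S = "S (Suc L)"
    show ?case
    \<comment> \<open>The two relations commute, so \<open>?S\<close> annihilates \<open>y\<close>
      on the longer window. Its degree is at most \<open>L + 1\<close> and \<open>y\<close> vanishes
      below \<open>L + 2\<close>, so one more zero follows.\<close>
    proof (rule sq_pact_eq_0_imp_eq_0[where p = ?S and n = "L + 3"])
      show "?S \<noteq> 0" using S(1)[of "Suc L"] step by simp
      show "sq.pact ?S y j = 0" if "j + degree ?S < L + 3" for j
      proof -
        have "sq.pact (S L0) (sq.pact ?S N') j = 0"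
          unfolding sq_pact_eq_sum[of "S L0"]
        proof (intro sum.neutral ballI)
          fix i assume "i \<in> {..degree (S L0)}"
          then have "j + i < 2 * Suc L + 2 + d"
            using that step.hyps S(2)[of L0] by auto
          then show "coeff (S L0) i * sq.pact ?S N' (j + i) = 0"
            using S(3)[of "Suc L" "j + i"] step.hyps by simp
        qed
        then show ?thesis by (simp add: y_def sq.pact_commute[of ?S])
      qed
      show "y j = 0" if "j < degree ?S" for j
        using that S(2)[of "Suc L"] step.hyps by (intro step.IH) auto
    qed (use step in auto)
  qed
  have "sq.pact (S L0) N (k + n) = 0" for k
  proof -
    have "sq.pact (S L0) N (k + n) = y k"
      unfolding y_def N'_def by (rule sq_pact_drop[symmetric])
    also have "\<dots> = 0" by (rule window[of "L0 + k"]) auto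
    finally show ?thesis .
  qed
  then show ?thesis using S(1)[of L0] by blast
qed

text \<open>Division with remainder: the least positive integer combination of the terms divides all
  of them, and it involves only finitely many.\<close>

lemma int_ideal_stabilizes:
  fixes u :: "nat \<Rightarrow> int"
  shows "\<exists>n. \<forall>k. \<exists>r. u k = (\<Sum>j<n. r j * u j)"
proof (cases "\<forall>k. u k = 0")
  case False
  have ext: "(\<Sum>j<n. r j * u j) = (\<Sum>j<max n n'. (if j < n then r j else 0) * u j)" for n n' r
    by (rule sum.mono_neutral_cong_left) auto
  define P where "P g \<longleftrightarrow> g > 0 \<and> (\<exists>n r. int g = (\<Sum>j<n. r j * u j))" for g
  have single: "c * u k = (\<Sum>j<Suc k. (if j = k then c else 0) * u j)" for c k
  proof -
    have "(\<Sum>j<Suc k. (if j = k then c else 0) * u j) = (\<Sum>j<Suc k. if j = k then c * u j else 0)"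
      by (intro sum.cong) auto
    then show ?thesis by simp
  qed
  obtain k0 where "u k0 \<noteq> 0" using False by blast
  moreover have "int (nat \<bar>u k0\<bar>) = (\<Sum>j<Suc k0. (if j = k0 then sgn (u k0) else 0) * u j)"
    unfolding single[symmetric] by (simp add: sgn_mult_self_eq abs_mult_sgn mult.commute flip: abs_sgn)
  ultimately have "P (nat \<bar>u k0\<bar>)"
    unfolding P_def by (metis zero_less_abs_iff zero_less_nat_eq)
  then have "P (LEAST g. P g)" by (rule LeastI)
  then obtain g n r where g: "g = (LEAST g. P g)" "g > 0" "int g = (\<Sum>j<n. r j * u j)"
    unfolding P_def by blast
  have "u k mod int g = 0" for k
  proof (rule ccontr)
    assume nz: "u k mod int g \<noteq> 0"
    let ?x = "nat (u k mod int g)"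
    have x: "?x > 0" "?x < g" "int ?x = u k mod int g"
      using nz g(2) pos_mod_bound[of "int g" "u k"] pos_mod_sign[of "int g" "u k"] by linarith+
    let ?n = "max n (Suc k)"
    have "u k mod int g = 1 * u k - u k div int g * (\<Sum>j<n. r j * u j)"
      unfolding g(3)[symmetric] by (simp add: minus_div_mult_eq_mod)
    also have "\<dots> = (\<Sum>j<?n. (if j < Suc k then if j = k then 1 else 0 else 0) * u j)
        - u k div int g * (\<Sum>j<?n. (if j < n then r j else 0) * u j)"
      using single[of 1 k] ext[of "\<lambda>j. if j = k then 1 else 0" "Suc k" n] ext[of r n "Suc k"]
      by (simp add: max.commute)
    also have "\<dots> = (\<Sum>j<?n. ((if j < Suc k then if j = k then 1 else 0 else 0)
        - u k div int g * (if j < n then r j else 0)) * u j)"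
      by (simp add: left_diff_distrib sum_subtractf sum_distrib_left mult.assoc)
    finally have "int ?x = \<dots>" unfolding x(3) .
    with x(1) have "P ?x" unfolding P_def by (intro conjI exI)
    then have "g \<le> ?x" unfolding g(1) by (rule Least_le)
    with x show False by simp
  qed
  then have "u k = u k div int g * int g" for k
    by (metis add.right_neutral div_mult_mod_eq)
  then have "u k = (\<Sum>j<n. (u k div int g * r j) * u j)" for k
    unfolding mult.assoc sum_distrib_left[symmetric] g(3)[symmetric] .
  then show ?thesis by (intro exI allI)
qed (auto intro!: exI[of _ 0])

text \<open>A form of the Hilbert basis theorem for the \<open>\<int>\<close>-module \<open>\<int>\<^sup>I\<close>.\<close>

lemma int_span_stabilizes:
  fixes w :: "nat \<Rightarrow> 'i \<Rightarrow> int"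
  assumes "finite I"
  shows "\<exists>n r. \<forall>i\<in>I. w n i = (\<Sum>j<n. r j * w j i)"
  using assms
proof (induction I arbitrary: w rule: finite_induct)
  case (insert a I)
  obtain n r where r: "\<And>k. w k a = (\<Sum>j<n. r k j * w j a)"
    using int_ideal_stabilizes[of "\<lambda>k. w k a"] by metis
  \<comment> \<open>Subtracting the combination that matches coordinate \<open>a\<close> leaves
    vectors supported on \<open>I\<close>, to which the induction hypothesis applies;
    \<open>R\<close> collects the resulting coefficients.\<close>
  define w' where "w' k i = w (n + k) i - (\<Sum>j<n. r (n + k) j * w j i)" for k i
  have w'a: "w' k a = 0" for k using r[of "n + k"] by (simp add: w'_def)
  obtain n' c where c: "\<And>i. i \<in> I \<Longrightarrow> w' n' i = (\<Sum>k<n'. c k * w' k i)"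
    using insert.IH[of w'] by blast
  define R where "R j = (if j < n then r (n + n') j - (\<Sum>k<n'. c k * r (n + k) j) else c (j - n))" for j
  have "w (n + n') i = (\<Sum>j<n + n'. R j * w j i)" if "i \<in> insert a I" for i
  proof -
    have "w' n' i = (\<Sum>k<n'. c k * w' k i)"
      using that c w'a by (cases "i = a") auto
    then have "w (n + n') i = (\<Sum>j<n. r (n + n') j * w j i) + (\<Sum>k<n'. c k * w (n + k) i)
        - (\<Sum>k<n'. \<Sum>j<n. c k * r (n + k) j * w j i)"
      by (simp add: w'_def right_diff_distrib sum_subtractf sum_distrib_left mult.assoc)
    also have "(\<Sum>k<n'. \<Sum>j<n. c k * r (n + k) j * w j i) = (\<Sum>j<n. (\<Sum>k<n'. c k * r (n + k) j) * w j i)"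
      by (subst sum.swap) (simp add: sum_distrib_right)
    also have "(\<Sum>j<n. r (n + n') j * w j i) + (\<Sum>k<n'. c k * w (n + k) i) - \<dots> =
        (\<Sum>j<n. R j * w j i) + (\<Sum>k<n'. R (n + k) * w (n + k) i)"
      by (simp add: R_def left_diff_distrib sum_subtractf)
    also have "\<dots> = (\<Sum>j<n + n'. R j * w j i)"
      by (induction n') (simp_all add: R_def)
    finally show ?thesis .
  qed
  then show ?case by blast
qed auto

text \<open>The blocks of \<open>degree S\<close> consecutive values, for all sequences together,
  lie in a lattice of finite rank, so some block is an integer combination of earlier ones. This is
  a monic relation at the first \<open>degree S\<close> places; it persists because \<open>R\<close>
  applied to \<open>N l\<close> still satisfies \<open>S\<close>.\<close>

lemma ex_monic_int_relation:
  fixes N :: "'i \<Rightarrow> nat \<Rightarrow> int"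
  assumes "finite I" "S \<noteq> 0" "\<And>l k. l \<in> I \<Longrightarrow> sq.pact S (N l) k = 0"
  shows "\<exists>R. lead_coeff R = 1 \<and> (\<forall>l\<in>I. \<forall>k. sq.pact R (N l) k = 0)"
proof -
  obtain n r where nr: "\<forall>x\<in>I \<times> {..<degree S}. N (fst x) (snd x + n) = (\<Sum>j<n. r j * N (fst x) (snd x + j))"
    using int_span_stabilizes[of "I \<times> {..<degree S}" "\<lambda>j x. N (fst x) (snd x + j)"] assms(1) by auto
  define R where "R = monom 1 n - (\<Sum>j<n. monom (r j) j)"
  have cR: "coeff R j = (if j = n then 1 else if j < n then - r j else 0)" for j
    by (auto simp: R_def coeff_sum)
  have "degree R = n"
    by (rule antisym[OF degree_le le_degree]) (auto simp: cR)
  then have "lead_coeff R = 1" by (simp add: cR)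
  moreover have "sq.pact R (N l) k = 0" if l: "l \<in> I" for l k
  proof (rule sq_pact_eq_0_imp_eq_0[OF assms(2), where n = "Suc k"])
    show "sq.pact R (N l) j = 0" if "j < degree S" for j
      using nr l that
      by (simp add: R_def sq.pact_diff sq.pact_monom shift_funpow sq_pact_sum_monom)
    have "sq.pact S (N l) = 0" using assms(3)[OF l] by (simp add: fun_eq_iff)
    then show "sq.pact S (sq.pact R (N l)) j = 0" for j
      by (simp add: sq.pact_commute[of S])
  qed simp
  ultimately show ?thesis by blast
qed

section \<open>Generalized Pisot systems are not Rajchman for some weights\<close>

text \<open>Exhibits the coefficients of \<open>p / (X - c)\<close> as polynomials in
  \<open>c\<close> with coefficients taken from \<open>p\<close>; Newton's identities and the
  polynomials \<open>U l\<close> rest on this. The range may overshoot, since the extra coefficients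
  of \<open>p\<close> are zero.\<close>

lemma coeff_synthetic_div:
  fixes p :: "'a::comm_ring_1 poly"
  shows "coeff (synthetic_div p c) i = (\<Sum>j\<le>degree p. coeff p (Suc i + j) * c ^ j)"
proof -
  have tail: "coeff (synthetic_div p c) i = (\<Sum>j<n. coeff p (Suc i + j) * c ^ j)" if "degree p \<le> n" for n
    using that
  proof (induction p arbitrary: i n)
    case (pCons a p)
    show ?case
    proof (cases i)
      case 0
      have "poly p c = (\<Sum>j<n. coeff p j * c ^ j)"
      proof (cases "p = 0")
        case False
        then have "degree p < n" using pCons by simp
        then show ?thesis
          unfolding poly_altdef by (intro sum.mono_neutral_left) (auto simp: coeff_eq_0)
      qed simp
      then show ?thesis using 0 by simp
    next
      case (Suc i')
      have "degree p \<le> n" using pCons.prems by (cases "p = 0") auto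
      then show ?thesis using Suc pCons.IH[of n i'] by simp
    qed
  qed simp
  show ?thesis
    unfolding lessThan_Suc_atMost[symmetric] by (rule tail) simp
qed

lemma degree_synthetic_div_less: "degree p > 0 \<Longrightarrow> degree (synthetic_div p c) < degree p"
  by (simp add: degree_synthetic_div)

lemma synthetic_div_root: "poly p c = 0 \<Longrightarrow> [:- c, 1:] * synthetic_div p c = p" for c :: "'a::comm_ring_1"
  using synthetic_div_correct'[of c p] by simp

lemma synthetic_div_mult_linear: "synthetic_div ([:- c, 1:] * p) c = p" for c :: "'a::comm_ring_1"
  using synthetic_div_unique[of "[:- c, 1:] * p" c p 0] by (simp add: algebra_simps)

lemma synthetic_div_mult:
  fixes p q :: "'a::comm_ring_1 poly"
  assumes "poly p c = 0"
  shows "synthetic_div (q * p) c = q * synthetic_div p c"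
proof -
  have "q * p = [:- c, 1:] * (q * synthetic_div p c)"
    by (subst synthetic_div_root[OF assms, symmetric]) (simp only: mult_ac)
  then show ?thesis by (simp only: synthetic_div_mult_linear)
qed

text \<open>The logarithmic derivative with denominators cleared, each root counted with
  multiplicity.\<close>

lemma pderiv_prod_linear:
  fixes R :: "'a::idom multiset"
  shows "pderiv (\<Prod>x\<in>#R. [:- x, 1:]) = (\<Sum>x\<in>#R. synthetic_div (\<Prod>x\<in>#R. [:- x, 1:]) x)"
proof (induction R)
  case (add x R)
  let ?p = "\<Prod>x\<in>#R. [:- x, 1:]"
  have root: "poly ?p y = 0" if "y \<in># R" for y
    using that by (induction R) auto
  have "(\<Sum>y\<in>#R. synthetic_div ([:- x, 1:] * ?p) y) = (\<Sum>y\<in>#R. [:- x, 1:] * synthetic_div ?p y)"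
    by (intro arg_cong[where f = sum_mset] image_mset_cong synthetic_div_mult root)
  also have "\<dots> = [:- x, 1:] * (\<Sum>y\<in>#R. synthetic_div ?p y)" by (rule sum_mset_distrib_left[symmetric])
  finally have "(\<Sum>y\<in>#R. synthetic_div ([:- x, 1:] * ?p) y) = [:- x, 1:] * pderiv ?p" using add by simp
  moreover have "pderiv ([:- x, 1:] * ?p) = ?p + [:- x, 1:] * pderiv ?p"
    by (simp only: pderiv_mult) (simp add: pderiv_pCons)
  ultimately show ?case
    by (simp only: image_mset_add_mset sum_mset.add_mset prod_mset.add_mset synthetic_div_mult_linear)
qed simp

lemma sum_mset_eq_sum_count:
  "(\<Sum>x\<in>#R. f x) = (\<Sum>x\<in>set_mset R. of_nat (count R x) * f x)" for f :: "'a \<Rightarrow> 'b::comm_semiring_1"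
proof (induction R)
  case (add y R)
  have "(\<Sum>x\<in>set_mset (add_mset y R). of_nat (count (add_mset y R) x) * f x) =
      (\<Sum>x\<in>insert y (set_mset R). of_nat (count R x) * f x + (if x = y then f x else 0))"
    by (intro sum.cong) (auto simp: algebra_simps)
  also have "\<dots> = (\<Sum>x\<in>insert y (set_mset R). of_nat (count R x) * f x) + f y"
    by (simp add: sum.distrib)
  also have "(\<Sum>x\<in>insert y (set_mset R). of_nat (count R x) * f x) = (\<Sum>x\<in>set_mset R. of_nat (count R x) * f x)"
    by (intro sum.mono_neutral_right) (auto simp: not_in_iff)
  finally show ?case using add by (simp add: add.commute)
qed simp

lemma sum_mset_sum_swap: "(\<Sum>x\<in>#R. \<Sum>i\<in>I. g i x) = (\<Sum>i\<in>I. \<Sum>x\<in>#R. g i x)" for g :: "'i \<Rightarrow> 'a \<Rightarrow> 'b::comm_monoid_add"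
  by (induction R) (simp_all add: sum.distrib)

text \<open>Newton's identities, read off from the coefficients of the derivative.\<close>

lemma power_sum_in_Ints:
  fixes P :: "int poly" and R :: "complex multiset"
  assumes monic: "lead_coeff P = 1" and R: "map_poly of_int P = (\<Prod>x\<in>#R. [:- x, 1:])"
  shows "(\<Sum>x\<in>#R. x ^ n) \<in> \<int>"
proof (induction n rule: less_induct)
  case (less n)
  define D where "D = degree P"
  let ?P = "map_poly of_int P :: complex poly"
  have degP: "degree ?P = D" unfolding D_def by (rule degree_map_poly) auto
  have cP: "coeff ?P i = of_int (coeff P i)" for i by (simp add: coeff_map_poly)
  have coeff_sum_mset: "coeff (\<Sum>x\<in>#R. h x) i = (\<Sum>x\<in>#R. coeff (h x) i)" for h :: "complex \<Rightarrow> complex poly" and i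
    by (induction R) simp_all
  have lin: "(\<Sum>x\<in>#R. \<Sum>j\<in>J. of_int (c j) * x ^ e j) = (\<Sum>j\<in>J. of_int (c j) * (\<Sum>x\<in>#R. x ^ e j))"
    for J :: "nat set" and c :: "nat \<Rightarrow> int" and e :: "nat \<Rightarrow> nat"
    by (simp add: sum_mset_sum_swap sum_mset_distrib_left)
  show ?case
  proof (cases "n < D")
    case True
    define i where "i = D - 1 - n"
    have iD: "Suc i + n = D" using True by (simp add: i_def)
    have "of_nat (Suc i) * coeff ?P (Suc i) = (\<Sum>x\<in>#R. coeff (synthetic_div ?P x) i)"
      using arg_cong[OF pderiv_prod_linear[of R], of "\<lambda>p. coeff p i"]
      by (simp only: coeff_pderiv R[symmetric] coeff_sum_mset)
    also have "\<dots> = (\<Sum>x\<in>#R. \<Sum>j\<le>D. of_int (coeff P (Suc i + j)) * x ^ j)"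
      by (simp only: coeff_synthetic_div degP cP)
    also have "\<dots> = (\<Sum>j\<le>D. of_int (coeff P (Suc i + j)) * (\<Sum>x\<in>#R. x ^ j))" by (rule lin)
    also have "\<dots> = (\<Sum>j\<in>insert n {..<n}. of_int (coeff P (Suc i + j)) * (\<Sum>x\<in>#R. x ^ j))"
      using True iD by (intro sum.mono_neutral_right) (auto simp: coeff_eq_0 D_def)
    also have "\<dots> = (\<Sum>x\<in>#R. x ^ n) + (\<Sum>j<n. of_int (coeff P (Suc i + j)) * (\<Sum>x\<in>#R. x ^ j))"
      using monic iD by (simp add: D_def)
    finally have "(\<Sum>x\<in>#R. x ^ n) = of_int (int (Suc i) * coeff P (Suc i))
        - (\<Sum>j<n. of_int (coeff P (Suc i + j)) * (\<Sum>x\<in>#R. x ^ j))"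
      by (simp add: cP algebra_simps)
    also have "\<dots> \<in> \<int>" using less by (intro Ints_diff Ints_of_int Ints_sum Ints_mult) auto
    finally show ?thesis .
  next
    case False
    \<comment> \<open>From the degree on, the equation of a root is multiplied by
      \<open>x ^ k\<close> and summed over all roots.\<close>
    define k where "k = n - D"
    have nk: "n = D + k" using False by (simp add: k_def)
    have "(\<Sum>i\<le>D. of_int (coeff P i) * x ^ (i + k)) = 0" if "x \<in># R" for x
    proof -
      have "poly (\<Prod>x\<in>#R. [:- x, 1:]) x = 0" using that by (induction R) auto
      then have "poly ?P x * x ^ k = 0" by (simp add: R)
      then show ?thesis by (simp add: poly_altdef degP cP sum_distrib_right power_add mult.assoc)
    qed
    then have "(\<Sum>x\<in>#R. \<Sum>i\<le>D. of_int (coeff P i) * x ^ (i + k)) = (\<Sum>x\<in>#R. 0)"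
      by (intro arg_cong[where f = sum_mset] image_mset_cong)
    then have "0 = (\<Sum>i\<le>D. of_int (coeff P i) * (\<Sum>x\<in>#R. x ^ (i + k)))"
      unfolding lin by simp
    also have "\<dots> = (\<Sum>i<D. of_int (coeff P i) * (\<Sum>x\<in>#R. x ^ (i + k))) + (\<Sum>x\<in>#R. x ^ n)"
      using monic by (simp add: lessThan_Suc_atMost[symmetric] D_def nk)
    finally have "(\<Sum>x\<in>#R. x ^ n) = - (\<Sum>i<D. of_int (coeff P i) * (\<Sum>x\<in>#R. x ^ (i + k)))"
      by (simp add: eq_neg_iff_add_eq_0 add.commute)
    also have "\<dots> \<in> \<int>" using less nk by (intro Ints_minus Ints_sum Ints_mult) auto
    finally show ?thesis .
  qed
qed

text \<open>The weights are the multiplicities, for which the sum expands into integer multiples of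
  power sums.\<close>

lemma ex_root_weights:
  fixes P :: "int poly"
  assumes monic: "lead_coeff P = 1"
  shows "\<exists>c :: complex \<Rightarrow> nat. (\<forall>z. poly (map_poly of_int P) z = 0 \<longrightarrow> c z > 0) \<and>
    (\<forall>G :: int poly. \<forall>n. (\<Sum>z | poly (map_poly of_int P) z = 0. of_nat (c z) * z ^ n * poly (map_poly of_int G) z) \<in> \<int>)"
proof -
  let ?P = "map_poly of_int P :: complex poly"
  have deg: "degree ?P = degree P" by (rule degree_map_poly) auto
  have lc: "lead_coeff ?P = 1" using monic by (simp add: deg coeff_map_poly)
  then have "?P \<noteq> 0" by auto
  then obtain R where R: "?P = (\<Prod>x\<in>#R. [:- x, 1:])"
    using alg_closed_imp_factorization[of ?P] lc by auto
  have roots: "{z. poly ?P z = 0} = set_mset R"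
    unfolding R by (induction R) auto
  have "(\<Sum>z\<in>set_mset R. of_nat (count R z) * z ^ n * poly (map_poly of_int G) z) \<in> \<int>" for G :: "int poly" and n
  proof -
    have "(\<Sum>z\<in>set_mset R. of_nat (count R z) * z ^ n * poly (map_poly of_int G) z) =
        (\<Sum>z\<in>#R. z ^ n * poly (map_poly of_int G) z)"
      by (simp add: sum_mset_eq_sum_count mult.assoc)
    also have "\<dots> = (\<Sum>z\<in>#R. \<Sum>i\<le>degree (map_poly of_int G :: complex poly). of_int (coeff G i) * z ^ (n + i))"
      by (simp add: poly_altdef coeff_map_poly sum_distrib_left power_add mult_ac)
    also have "\<dots> = (\<Sum>i\<le>degree (map_poly of_int G :: complex poly). of_int (coeff G i) * (\<Sum>z\<in>#R. z ^ (n + i)))"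
      by (simp add: sum_mset_sum_swap sum_mset_distrib_left)
    also have "\<dots> \<in> \<int>"
      using power_sum_in_Ints[OF monic R] by (intro Ints_sum Ints_mult) auto
    finally show ?thesis .
  qed
  then show ?thesis unfolding roots using roots by (intro exI[of _ "count R"]) auto
qed

lemma norm_exp_2pi_sub_1_le:
  "norm (exp (2 * pi * \<i> * complex_of_real t) - 1) \<le> 2 * pi * \<bar>t - of_int n\<bar>"
proof -
  have "exp (2 * pi * \<i> * complex_of_real t) = exp (\<i> * of_real (2 * pi * (t - of_int n)))"
    by (simp add: exp_eq algebra_simps)
  then have "norm (exp (2 * pi * \<i> * complex_of_real t) - 1) = 2 * \<bar>sin (2 * pi * (t - of_int n) / 2)\<bar>"
    by (simp only: dist_exp_i_1)
  also have "\<dots> \<le> 2 * \<bar>2 * pi * (t - of_int n) / 2\<bar>"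
    by (intro mult_left_mono abs_sin_x_le_abs_x) auto
  finally show ?thesis by (simp add: abs_mult)
qed

section \<open>Lower bounds for the Fourier transform along orbits\<close>

context weighted_ifs
begin

lemma norm_mask: "norm (mask \<xi>) = norm (\<Sum>l=1..m. p l *\<^sub>R exp (2 * pi * \<i> * complex_of_real (\<xi> \<bullet> b l)))"
proof -
  have "mask \<xi> = exp (2 * pi * \<i> * complex_of_real (\<xi> \<bullet> a 1)) *
      (\<Sum>l=1..m. p l *\<^sub>R exp (2 * pi * \<i> * complex_of_real (\<xi> \<bullet> b l)))"
    by (simp add: mask_def b_def sum_distrib_left inner_diff_right exp_diff algebra_simps)
  then show ?thesis by (simp only: norm_mult norm_exp_2pi mult_1)
qed

lemma norm_mask_ge_near_Ints:
  assumes "\<And>l. l \<in> {1..m} \<Longrightarrow> \<exists>n::int. \<bar>\<xi> \<bullet> b l - of_int n\<bar> \<le> \<delta>"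
  shows "norm (mask \<xi>) \<ge> 1 - 2 * pi * \<delta>"
proof -
  let ?e = "\<lambda>l. exp (2 * pi * \<i> * complex_of_real (\<xi> \<bullet> b l))"
  have "norm (\<Sum>l=1..m. p l *\<^sub>R (?e l - 1)) \<le> (\<Sum>l=1..m. p l * (2 * pi * \<delta>))"
  proof (intro order.trans[OF norm_sum] sum_mono)
    fix l assume l: "l \<in> {1..m}"
    obtain n :: int where "\<bar>\<xi> \<bullet> b l - of_int n\<bar> \<le> \<delta>" using assms[OF l] by blast
    then have "2 * pi * \<bar>\<xi> \<bullet> b l - of_int n\<bar> \<le> 2 * pi * \<delta>" by (intro mult_left_mono) auto
    then have "norm (?e l - 1) \<le> 2 * pi * \<delta>" using norm_exp_2pi_sub_1_le[of "\<xi> \<bullet> b l" n] by linarith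
    then show "norm (p l *\<^sub>R (?e l - 1)) \<le> p l * (2 * pi * \<delta>)"
      using p_pos[OF l] by (simp add: mult_left_mono)
  qed
  also have "\<dots> = 2 * pi * \<delta>" using p_sum by (simp flip: sum_distrib_right)
  also have "(\<Sum>l=1..m. p l *\<^sub>R (?e l - 1)) = (\<Sum>l=1..m. p l *\<^sub>R ?e l) - of_real (\<Sum>l=1..m. p l)"
    by (simp add: right_diff_distrib sum_subtractf scaleR_conv_of_real)
  also have "norm \<dots> \<ge> 1 - norm (mask \<xi>)"
    unfolding norm_mask p_sum using norm_triangle_ineq2[of 1 "\<Sum>l=1..m. p l *\<^sub>R ?e l"]
    by (simp add: norm_minus_commute)
  finally show ?thesis by linarith
qed

text \<open>As \<open>b 1 = 0\<close>, the first term is the constant \<open>p 1\<close>; the others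
  amount to at most \<open>1 - p 1\<close>.\<close>

lemma norm_mask_ge: "norm (mask \<xi>) \<ge> 2 * p 1 - 1"
proof -
  let ?e = "\<lambda>l. exp (2 * pi * \<i> * complex_of_real (\<xi> \<bullet> b l))"
  have m: "{1..m} = insert 1 {2..m}" using m1 by auto
  have "norm (\<Sum>l\<in>{2..m}. p l *\<^sub>R ?e l) \<le> (\<Sum>l\<in>{2..m}. p l)"
    using p_pos by (intro order.trans[OF norm_sum] sum_mono) (simp add: less_imp_le)
  also have "\<dots> = 1 - p 1" using p_sum m by simp
  finally have "norm (\<Sum>l\<in>{2..m}. p l *\<^sub>R ?e l) \<le> 1 - p 1" .
  moreover have "(\<Sum>l=1..m. p l *\<^sub>R ?e l) = of_real (p 1) + (\<Sum>l\<in>{2..m}. p l *\<^sub>R ?e l)"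
    unfolding m by (subst sum.insert) (auto simp: b_def scaleR_conv_of_real)
  moreover have "norm (of_real (p 1) :: complex) = p 1" using p_pos[of 1] m1 by simp
  ultimately show ?thesis
    unfolding norm_mask using norm_diff_ineq[of "of_real (p 1) :: complex" "\<Sum>l\<in>{2..m}. p l *\<^sub>R ?e l"] by simp
qed

text \<open>Finitely many steps under \<open>B\<close> bring the frequency close to 0, where the
  transform is near 1, and none of the factors passed vanishes.\<close>

lemma fourier_nonzero:
  assumes "p 1 > 1 / 2"
  shows "fourier_transform \<mu> \<xi> \<noteq> 0"
proof -
  have "(\<lambda>n. fourier_transform \<mu> (mpow B n \<xi>)) \<longlonglongrightarrow> 1"
    by (rule fourier_tendsto_1[OF mpow_B_tendsto_0])
  then have "eventually (\<lambda>n. fourier_transform \<mu> (mpow B n \<xi>) \<noteq> 0) sequentially"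
    by (rule tendsto_imp_eventually_ne) simp
  then obtain n where n: "fourier_transform \<mu> (mpow B n \<xi>) \<noteq> 0"
    by (auto simp: eventually_sequentially)
  have "norm (mask \<eta>) > 0" for \<eta> using norm_mask_ge[of \<eta>] assms by linarith
  then have "norm (fourier_transform \<mu> \<xi>) > 0"
    unfolding fourier_eq_prod[of \<xi> n] using n by (intro mult_pos_pos prod_pos) auto
  then show ?thesis by simp
qed

text \<open>A backward \<open>B\<close>-orbit escapes to infinity, so it witnesses failure of the Rajchman property as
  soon as it approaches the integers summably fast.\<close>

lemma not_rajchman_of_orbit:
  assumes p1: "p 1 > 1 / 2" and orbit: "\<And>n. B *v \<xi> (Suc n) = \<xi> n" and nz: "\<xi> 0 \<noteq> 0"
    and u: "summable u" "\<And>n l. l \<in> {1..m} \<Longrightarrow> \<exists>k::int. \<bar>\<xi> n \<bullet> b l - of_int k\<bar> \<le> u n"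
  shows "\<not> rajchman \<mu>"
proof
  assume raj: "rajchman \<mu>"
  define g where "g n = norm (fourier_transform \<mu> (\<xi> n))" for n
  have g_pos: "g n > 0" for n using fourier_nonzero[OF p1] by (simp add: g_def)
  have u0: "u n \<ge> 0" for n using u(2)[of 1 n] m1 by force
  define v where "v n = 2 * pi * u (Suc n)" for n
  have v0: "v n \<ge> 0" for n using u0 by (simp add: v_def)
  have step: "g (Suc n) \<ge> g n * (1 - v n)" for n
  proof -
    have "g (Suc n) = norm (mask (\<xi> (Suc n))) * g n"
      unfolding g_def using fourier_self_affine[of "\<xi> (Suc n)"] by (simp add: orbit norm_mult)
    moreover have "norm (mask (\<xi> (Suc n))) \<ge> 1 - v n"
      unfolding v_def by (rule norm_mask_ge_near_Ints) (rule u(2))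
    ultimately show ?thesis using g_pos[of n] by (simp add: mult.commute mult_left_mono)
  qed
  have sv: "summable v" unfolding v_def using u(1) by (intro summable_mult) (simp add: summable_Suc_iff)
  obtain n0 where n0: "norm (\<Sum>i. v (i + n0)) < 1 / 2"
    using suminf_exist_split[of "1/2" v] sv by auto
  have tail: "(\<Sum>i<n. v (i + n0)) \<le> 1 / 2" for n
    using sum_le_suminf[of "\<lambda>i. v (i + n0)" "{..<n}"] sv v0 n0 by (simp add: summable_iff_shift)
  \<comment> \<open>The product of the \<open>1 - v i\<close> is at least 1 minus their sum;
    starting where the remaining sum is at most 1/2, half of the value survives.\<close>
  have low: "g (n + n0) \<ge> g n0 * (1 - (\<Sum>i<n. v (i + n0)))" for n
  proof (induction n)
    case (Suc n)
    let ?S = "\<Sum>i<n. v (i + n0)"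
    have S: "?S + v (n + n0) \<le> 1 / 2" using tail[of "Suc n"] by simp
    have S0: "?S \<ge> 0" by (simp add: sum_nonneg v0)
    have "g n0 * (1 - (?S + v (n + n0))) \<le> g n0 * ((1 - ?S) * (1 - v (n + n0)))"
      using g_pos[of n0] S0 v0[of "n + n0"] by (intro mult_left_mono) (auto simp: algebra_simps)
    also have "\<dots> \<le> g (n + n0) * (1 - v (n + n0))"
      using Suc S S0 v0 unfolding mult.assoc[symmetric] by (intro mult_right_mono) auto
    also have "\<dots> \<le> g (Suc n + n0)" using step[of "n + n0"] by simp
    finally show ?case by simp
  qed simp
  have "g n \<ge> g n0 / 2" if "n \<ge> n0" for n
  proof -
    have "g n0 * (1 / 2) \<le> g n0 * (1 - (\<Sum>i<n - n0. v (i + n0)))"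
      using tail[of "n - n0"] g_pos[of n0] by (intro mult_left_mono) auto
    also have "\<dots> \<le> g n" using low[of "n - n0"] that by simp
    finally show ?thesis by simp
  qed
  moreover obtain R where R: "R > 0" "\<And>\<xi>. norm \<xi> \<ge> R \<Longrightarrow> norm (fourier_transform \<mu> \<xi>) < g n0 / 2"
  proof -
    have "\<forall>e>0. \<exists>R. \<forall>\<xi>. R \<le> norm \<xi> \<longrightarrow> dist (norm (fourier_transform \<mu> \<xi>)) 0 < e"
      using raj unfolding rajchman_def Lim_at_infinity .
    then obtain R where "\<forall>\<xi>. R \<le> norm \<xi> \<longrightarrow> dist (norm (fourier_transform \<mu> \<xi>)) 0 < g n0 / 2"
      using g_pos[of n0] half_gt_zero by blast
    then show ?thesis by (intro that[of "max R 1"]) auto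
  qed
  \<comment> \<open>On a bounded orbit the pairing of \<open>\<xi> n\<close> with
    \<open>mpow A n (\<xi> 0)\<close> would tend to 0, yet it always equals
    \<open>\<xi> 0 \<bullet> \<xi> 0\<close>.\<close>
  moreover have "\<exists>n\<ge>n0. norm (\<xi> n) \<ge> R"
  proof (rule ccontr)
    assume "\<not> ?thesis"
    then have small: "norm (\<xi> n) \<le> R" if "n \<ge> n0" for n using that by force
    have "mpow B n (\<xi> n) = \<xi> 0" for n
      by (induction n) (simp_all add: funpow_swap1 orbit del: funpow.simps(2), simp add: funpow_swap1 orbit)
    then have eq: "\<xi> 0 \<bullet> \<xi> 0 = \<xi> n \<bullet> mpow A n (\<xi> 0)" for n
      by (metis inner_mpow)
    have "(\<lambda>n. R * norm (mpow A n (\<xi> 0))) \<longlonglongrightarrow> 0"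
      by (intro tendsto_mult_right_zero tendsto_norm_zero mpow_tendsto_0)
    moreover have "\<xi> 0 \<bullet> \<xi> 0 \<le> R * norm (mpow A n (\<xi> 0))" if "n \<ge> n0" for n
    proof -
      have "\<xi> 0 \<bullet> \<xi> 0 \<le> norm (\<xi> n) * norm (mpow A n (\<xi> 0))" unfolding eq[of n] by (rule norm_cauchy_schwarz)
      also have "\<dots> \<le> R * norm (mpow A n (\<xi> 0))" using small[OF that] by (intro mult_right_mono) auto
      finally show ?thesis .
    qed
    ultimately have "\<xi> 0 \<bullet> \<xi> 0 \<le> 0" by (intro LIMSEQ_le_const[where X = "\<lambda>n. R * norm (mpow A n (\<xi> 0))"]) auto
    with nz show False by (simp flip: not_less)
  qed
  ultimately show False unfolding g_def by (metis linorder_not_less)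
qed

lemma generalized_pisot_imp_not_rajchman:
  assumes gp: "generalized_pisot_ifs m A a" and p1: "p 1 > 1 / 2"
  shows "\<not> rajchman \<mu>"
proof -
  obtain k \<beta> \<zeta> where k: "k \<ge> 1" and nz: "\<And>j. j \<in> {1..k} \<Longrightarrow> \<zeta> j \<noteq> 0" and tuple: "pisot_tuple k \<beta>"
    and eig: "\<And>j. j \<in> {1..k} \<Longrightarrow> transpose (cmat A) *v \<zeta> j = inverse (\<beta> j) *s \<zeta> j"
    and val: "\<And>l. l \<in> {1..m} \<Longrightarrow> \<exists>P :: int poly. \<forall>j\<in>{1..k}. cinner (\<zeta> j) (cvec (b l)) = poly (map_poly of_int P) (\<beta> j)"
    using gp unfolding generalized_pisot_ifs_def b_def by metis
  from val obtain G :: "nat \<Rightarrow> int poly" where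
    G: "\<And>l j. l \<in> {1..m} \<Longrightarrow> j \<in> {1..k} \<Longrightarrow> cinner (\<zeta> j) (cvec (b l)) = poly (map_poly of_int (G l)) (\<beta> j)"
    by metis
  from tuple obtain P :: "int poly" where inj: "inj_on \<beta> {1..k}" and big: "\<And>j. j \<in> {1..k} \<Longrightarrow> norm (\<beta> j) > 1"
    and P: "lead_coeff P = 1" "\<And>j. j \<in> {1..k} \<Longrightarrow> poly (map_poly of_int P) (\<beta> j) = 0"
      "\<And>z. poly (map_poly of_int P) z = 0 \<Longrightarrow> z \<notin> \<beta> ` {1..k} \<Longrightarrow> norm z < 1"
    unfolding pisot_tuple_def by metis
  let ?P = "map_poly of_int P :: complex poly"
  define Z where "Z = {z. poly ?P z = 0}"
  have "?P \<noteq> 0" using P(1) by (auto simp: map_poly_eq_0_iff)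
  then have finZ: "finite Z" unfolding Z_def by (rule poly_roots_finite)
  define Y where "Y = Z - \<beta> ` {1..k}"
  have Z: "Z = \<beta> ` {1..k} \<union> Y" "\<beta> ` {1..k} \<inter> Y = {}" using P(2) by (auto simp: Y_def Z_def)
  have Y: "finite Y" "\<And>z. z \<in> Y \<Longrightarrow> norm z < 1" using P(3) finZ by (auto simp: Y_def Z_def)
  obtain c where c: "\<And>z. poly ?P z = 0 \<Longrightarrow> c z > 0"
      "\<And>G n. (\<Sum>z\<in>Z. of_nat (c z) * z ^ n * poly (map_poly of_int G) z) \<in> \<int>"
    using ex_root_weights[OF P(1)] unfolding Z_def by blast
  have eigM: "cmat M *v \<zeta> j = \<beta> j *s \<zeta> j" if j: "j \<in> {1..k}" for j
  proof -
    have "transpose (cmat A) = cmat B" by (simp add: B_def cmat_def map_matrix_def transpose_def)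
    then have "\<zeta> j = inverse (\<beta> j) *s (cmat M *v \<zeta> j)"
      using arg_cong[OF eig[OF j], of "(*v) (cmat M)"] by (simp add: vc.g_scale)
    then have "\<beta> j *s \<zeta> j = \<beta> j *s (inverse (\<beta> j) *s (cmat M *v \<zeta> j))" by simp
    moreover have "\<beta> j \<noteq> 0" using big[OF j] by auto
    ultimately show ?thesis by simp
  qed
  define v where "v n = (\<Sum>j\<in>{1..k}. (of_nat (c (\<beta> j)) * \<beta> j ^ n) *s \<zeta> j)" for n
  have vM: "v n = mpow (cmat M) n (v 0)" for n
    unfolding v_def mpow_sum
    by (intro sum.cong refl) (simp add: mpow_scale mpow_eigenvector[OF eigM])
  \<comment> \<open>Matrix and translations are real, so the real part keeps both the orbit relation
    and the closeness to integers.\<close>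
  define \<xi> where "\<xi> n = (\<chi> i. Re (v n $ i))" for n
  have \<xi>_inner: "\<xi> n \<bullet> w = Re (cinner (v n) (cvec w))" for n w
    by (simp add: inner_vec_def \<xi>_def cinner_def cvec_def)
  have orbit: "B *v \<xi> (Suc n) = \<xi> n" for n
  proof -
    have "cmat B *v v (Suc n) = v n" unfolding vM[of "Suc n"] vM[of n] by simp
    then have "(cmat B *v v (Suc n)) $ i = v n $ i" for i by simp
    then have "Re ((cmat B *v v (Suc n)) $ i) = Re (v n $ i)" for i by simp
    then show ?thesis
      by (simp add: vec_eq_iff \<xi>_def matrix_vector_mult_def cmat_def map_matrix_def)
  qed
  \<comment> \<open>The terms of the integral power sum that \<open>v n\<close> lacks: roots inside
    the disc carry no eigenvector. Summing over \<open>l\<close> gives one bound for all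
    translations.\<close>
  define u where "u n = (\<Sum>l\<in>{1..m}. \<Sum>z\<in>Y. (of_nat (c z) * norm (poly (map_poly of_int (G l)) z)) * norm z ^ n)" for n
  have su: "summable u"
    unfolding u_def by (intro summable_sum summable_mult summable_geometric) (use Y in auto)
  have near: "\<exists>i::int. norm (cinner (v n) (cvec (b l)) - of_int i) \<le> u n" if l: "l \<in> {1..m}" for l n
  proof -
    let ?g = "\<lambda>z. poly (map_poly of_int (G l)) z :: complex"
    have "cinner (v n) (cvec (b l)) = (\<Sum>j\<in>{1..k}. of_nat (c (\<beta> j)) * \<beta> j ^ n * cinner (\<zeta> j) (cvec (b l)))"
      unfolding v_def cinner_def by (simp add: sum_distrib_left sum_distrib_right mult_ac) (rule sum.swap)
    also have "\<dots> = (\<Sum>z\<in>\<beta> ` {1..k}. of_nat (c z) * z ^ n * ?g z)"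
      unfolding sum.reindex[OF inj] using G[OF l] by simp
    also have "\<dots> = (\<Sum>z\<in>Z. of_nat (c z) * z ^ n * ?g z) - (\<Sum>z\<in>Y. of_nat (c z) * z ^ n * ?g z)"
      unfolding Z(1) using Y(1) Z(2) by (subst sum.union_disjoint) auto
    finally have eq: "cinner (v n) (cvec (b l)) = (\<Sum>z\<in>Z. of_nat (c z) * z ^ n * ?g z) - (\<Sum>z\<in>Y. of_nat (c z) * z ^ n * ?g z)" .
    have "(\<Sum>z\<in>Z. of_nat (c z) * z ^ n * ?g z) \<in> \<int>" by (rule c(2))
    then obtain i where i: "(\<Sum>z\<in>Z. of_nat (c z) * z ^ n * ?g z) = of_int i" by (rule Ints_cases)
    have "norm (\<Sum>z\<in>Y. of_nat (c z) * z ^ n * ?g z) \<le> (\<Sum>z\<in>Y. (of_nat (c z) * norm (?g z)) * norm z ^ n)"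
      by (intro order.trans[OF norm_sum] sum_mono) (simp add: norm_mult norm_power mult_ac)
    also have "\<dots> \<le> u n"
      unfolding u_def
      by (rule member_le_sum[OF l, of "\<lambda>l. \<Sum>z\<in>Y. (of_nat (c z) * norm (poly (map_poly of_int (G l)) z)) * norm z ^ n"])
        (auto intro!: sum_nonneg)
    finally show ?thesis unfolding eq i by (intro exI[of _ i]) simp
  qed
  have "\<xi> 0 \<noteq> 0"
  proof
    assume "\<xi> 0 = 0"
    then have \<xi>0: "\<xi> n = 0" for n
    proof (induction n)
      case (Suc n)
      then have "M *v (B *v \<xi> (Suc n)) = M *v 0" by (simp only: orbit)
      then show ?case by simp
    qed
    \<comment> \<open>Pairings that are purely imaginary yet within \<open>u n\<close> of an integer
      are themselves of size at most \<open>2 * u n\<close>, hence tend to 0.\<close>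
    have "v 0 = 0"
    proof (rule cinner_mpow_tendsto_0_imp_eq_0)
      fix l assume l: "l \<in> {1..m}"
      have bound: "norm (cinner (v n) (cvec (b l))) \<le> 2 * u n" for n
      proof -
        let ?w = "cinner (v n) (cvec (b l))"
        obtain i :: int where i: "norm (?w - of_int i) \<le> u n" using near[OF l] by blast
        have "Re ?w = 0" using \<xi>_inner[of n "b l"] \<xi>0[of n] by simp
        then have "\<bar>real_of_int i\<bar> \<le> u n" using abs_Re_le_cmod[of "?w - of_int i"] i by simp
        then show ?thesis using i norm_triangle_ineq[of "?w - of_int i" "of_int i"] by simp
      qed
      show "(\<lambda>n. cinner (mpow (cmat M) n (v 0)) (cvec (b l))) \<longlonglongrightarrow> 0"
        unfolding vM[symmetric]
      proof (rule Lim_null_comparison)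
        show "(\<lambda>n. 2 * u n) \<longlonglongrightarrow> 0"
          by (rule tendsto_mult_right_zero[OF summable_LIMSEQ_zero[OF su]])
      qed (rule always_eventually[OF allI[OF bound]])
    qed
    \<comment> \<open>This polynomial in \<open>M\<close> annihilates all eigenvectors but the
      first, which isolates a nonzero multiple of \<open>\<zeta> 1\<close>.\<close>
    define q where "q = (\<Prod>j\<in>{2..k}. [:- \<beta> j, 1:])"
    have "vc.pact (cmat M) q (\<Sum>j\<in>J. f j) = (\<Sum>j\<in>J. vc.pact (cmat M) q (f j))" for f and J :: "nat set"
      by (induction J rule: infinite_finite_induct) (simp_all add: vc.pact_add_right)
    then have "vc.pact (cmat M) q (v 0) = (\<Sum>j\<in>{1..k}. (of_nat (c (\<beta> j)) * poly q (\<beta> j)) *s \<zeta> j)"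
      unfolding v_def by (simp add: vc.pact_scale_right vc.pact_eigenvector[OF eigM])
    also have "\<dots> = (\<Sum>j\<in>{1}. (of_nat (c (\<beta> j)) * poly q (\<beta> j)) *s \<zeta> j)"
      using k by (intro sum.mono_neutral_right) (auto simp: q_def poly_prod)
    finally have "(of_nat (c (\<beta> 1)) * poly q (\<beta> 1)) *s \<zeta> 1 = 0" using \<open>v 0 = 0\<close> by simp
    moreover have "poly q (\<beta> 1) \<noteq> 0"
      using inj_onD[OF inj, of 1] k unfolding q_def poly_prod by fastforce
    moreover have "c (\<beta> 1) > 0" using c(1)[OF P(2)] k by simp
    ultimately show False using nz[of 1] k by simp
  qed
  show ?thesis
  proof (rule not_rajchman_of_orbit[where \<xi> = \<xi> and u = u, OF p1 orbit \<open>\<xi> 0 \<noteq> 0\<close> su])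
    fix n l assume "l \<in> {1..m}"
    then obtain i :: int where "norm (cinner (v n) (cvec (b l)) - of_int i) \<le> u n" using near by blast
    then have "\<bar>\<xi> n \<bullet> b l - of_int i\<bar> \<le> u n"
      unfolding \<xi>_inner using abs_Re_le_cmod[of "cinner (v n) (cvec (b l)) - of_int i"] by simp
    then show "\<exists>i::int. \<bar>\<xi> n \<bullet> b l - of_int i\<bar> \<le> u n" by blast
  qed
qed

end

lemma ex_dominant_prob_vector:
  assumes "m \<ge> 1"
  shows "\<exists>p. strictly_positive_prob_vector m p \<and> p 1 > 1 / 2"
proof -
  define p where "p l = (if l = 1 then 1 - real (m - 1) / (4 * m) else 1 / (4 * m))" for l :: nat
  have p1: "p 1 > 1 / 2" using assms by (simp add: p_def field_simps)
  have "{1..m} = insert 1 {2..m}" using assms by auto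
  then have "(\<Sum>l=1..m. p l) = p 1 + (\<Sum>l\<in>{2..m}. p l)" by simp
  also have "(\<Sum>l\<in>{2..m}. p l) = (\<Sum>l\<in>{2..m}. 1 / (4 * m))" by (intro sum.cong) (auto simp: p_def)
  finally have "(\<Sum>l=1..m. p l) = 1" by (simp add: p_def)
  moreover have "p l > 0" for l using p1 assms by (cases "l = 1") (auto simp: p_def)
  ultimately show ?thesis using p1 unfolding strictly_positive_prob_vector_def by blast
qed

section \<open>Non-Rajchman measures come from generalized Pisot systems\<close>

text \<open>The cubic Taylor bound suffices: \<open>pi * t \<le> 2\<close> leaves at least a third
  of \<open>pi * t\<close>, and \<open>pi > 3\<close>.\<close>

lemma sin_pi_mult_ge:
  fixes t :: real
  assumes "0 \<le> t" "t \<le> 1 / 2"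
  shows "sin (pi * t) \<ge> t"
proof -
  let ?x = "pi * t"
  have "?x \<le> 4 * (1 / 2)" using assms pi_less_4 by (intro mult_mono) auto
  then have x: "0 \<le> ?x" "?x \<le> 2" using assms by auto
  have "\<bar>sin ?x - ?x\<bar> \<le> ?x ^ 3 / 6"
    using Maclaurin_sin_bound[of ?x 3] x
    by (simp add: sin_coeff_def lessThan_Suc eval_nat_numeral)
  moreover have "?x ^ 3 \<le> ?x * 4"
  proof -
    have "?x * ?x \<le> 2 * 2" using x by (intro mult_mono) auto
    then have "?x * (?x * ?x) \<le> ?x * 4" using x by (intro mult_left_mono) auto
    then show ?thesis by (simp add: eval_nat_numeral mult.assoc)
  qed
  ultimately have "sin ?x \<ge> ?x / 3" by linarith
  moreover have "3 * t \<le> ?x" using pi_gt3 assms by (intro mult_right_mono) auto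
  ultimately show ?thesis by linarith
qed

text \<open>Turns the summable cosine defects supplied by the Fourier product into square-summable
  distances to the integers.\<close>

lemma dist_round_square_le: "(x - of_int (round x))\<^sup>2 \<le> 1 - cos (2 * pi * x)" for x :: real
proof -
  define t where "t = \<bar>x - of_int (round x)\<bar>"
  have t: "0 \<le> t" "t \<le> 1 / 2"
    using of_int_round_abs_le[of x] by (auto simp: t_def abs_minus_commute)
  have "cos (2 * pi * x) = cos (2 * pi * (x - of_int (round x)) + 2 * pi * of_int (round x))"
    by (simp add: algebra_simps)
  also have "\<dots> = cos (2 * pi * (x - of_int (round x)))"
    by (simp only: cos_add cos_int_2pin sin_int_2pin)
  also have "\<dots> = cos (2 * (pi * t))"
    using cos_abs_real[of "2 * pi * (x - of_int (round x))"] by (simp add: t_def abs_mult mult.assoc)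
  also have "\<dots> = 1 - 2 * (sin (pi * t))\<^sup>2" by (rule cos_double_sin)
  finally have "1 - cos (2 * pi * x) = 2 * (sin (pi * t))\<^sup>2" by simp
  moreover have "t\<^sup>2 \<le> (sin (pi * t))\<^sup>2" using sin_pi_mult_ge[OF t] t by (intro power_mono)
  moreover have "(x - of_int (round x))\<^sup>2 = t\<^sup>2" by (simp add: t_def)
  ultimately show ?thesis using zero_le_power2[of t] by linarith
qed

text \<open>With \<open>c = 1 - cos (2 * pi * t)\<close> the squared norm is
  \<open>(p + q)\<^sup>2 - 2 * p * q * c\<close>; because \<open>p + q \<le> 1\<close>, the square
  of the right side is no smaller.\<close>

lemma norm_add_exp_le:
  assumes "0 < p" "0 < q" "p + q \<le> 1"
  shows "norm (complex_of_real p + q *\<^sub>R exp (2 * pi * \<i> * complex_of_real t)) \<le> p + q - p * q * (1 - cos (2 * pi * t))"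
proof (rule power2_le_imp_le)
  define c where "c = 1 - cos (2 * pi * t)"
  have c: "0 \<le> c" "c \<le> 2" using cos_ge_minus_one[of "2 * pi * t"] by (auto simp: c_def)
  have e: "exp (2 * pi * \<i> * complex_of_real t) = cis (2 * pi * t)"
    by (simp add: cis_conv_exp mult_ac)
  have "(norm (complex_of_real p + q *\<^sub>R exp (2 * pi * \<i> * complex_of_real t)))\<^sup>2 =
      (p + q * cos (2 * pi * t))\<^sup>2 + (q * sin (2 * pi * t))\<^sup>2"
    unfolding e by (simp add: cmod_power2)
  also have "\<dots> = p\<^sup>2 + 2 * p * q * cos (2 * pi * t) + q\<^sup>2 * ((sin (2 * pi * t))\<^sup>2 + (cos (2 * pi * t))\<^sup>2)"
    by (simp only: power2_eq_square algebra_simps)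
  also have "\<dots> = (p + q)\<^sup>2 - 2 * (p * q * c)"
    by (simp only: sin_cos_squared_add) (simp add: c_def power2_eq_square algebra_simps)
  also have "\<dots> \<le> (p + q)\<^sup>2 - 2 * ((p + q) * (p * q * c)) + (p * q * c)\<^sup>2"
  proof -
    have "(p + q) * (p * q * c) \<le> 1 * (p * q * c)" using assms c by (intro mult_right_mono) auto
    then show ?thesis using zero_le_power2[of "p * q * c"] by linarith
  qed
  also have "\<dots> = (p + q - p * q * c)\<^sup>2" by (simp add: power2_eq_square algebra_simps)
  finally show "(norm (complex_of_real p + q *\<^sub>R exp (2 * pi * \<i> * complex_of_real t)))\<^sup>2 \<le>
      (p + q - p * q * (1 - cos (2 * pi * t)))\<^sup>2" by (simp only: c_def)
  have "p * q * c \<le> p * q * 2" using assms c by (intro mult_left_mono) auto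
  also have "\<dots> \<le> p * 1 + q * 1"
  proof -
    have "p * q \<le> p * 1" "p * q \<le> 1 * q" using assms by (intro mult_left_mono mult_right_mono; simp)+
    then show ?thesis by simp
  qed
  finally show "0 \<le> p + q - p * q * (1 - cos (2 * pi * t))" by (simp add: c_def)
qed

section \<open>Upper bounds for the Fourier transform and a limit orbit\<close>

context weighted_ifs
begin

text \<open>Only the cancellation between the constant first term and term \<open>l\<close> is
  exploited; the remaining terms are bounded by their weights.\<close>

lemma norm_mask_le:
  assumes l: "l \<in> {1..m}"
  shows "norm (mask \<xi>) \<le> 1 - p 1 * p l * (1 - cos (2 * pi * (\<xi> \<bullet> b l)))"
proof -
  let ?e = "\<lambda>l. exp (2 * pi * \<i> * complex_of_real (\<xi> \<bullet> b l))"
  have rest: "norm (\<Sum>j\<in>I. p j *\<^sub>R ?e j) \<le> (\<Sum>j\<in>I. p j)" if "I \<subseteq> {1..m}" for I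
    using that p_pos by (intro order.trans[OF norm_sum] sum_mono) (auto simp: less_imp_le)
  show ?thesis
  proof (cases "l = 1")
    case True
    then show ?thesis
      using rest[of "{1..m}"] p_sum unfolding norm_mask by (simp add: b_def)
  next
    case False
    let ?I = "{1..m} - {1, l}"
    have split: "(\<Sum>j\<in>{1..m}. f j) = f 1 + f l + (\<Sum>j\<in>?I. f j)" for f :: "nat \<Rightarrow> 'x::ab_group_add"
    proof -
      have "{1..m} = insert 1 (insert l ?I)" using l m1 by auto
      then have "(\<Sum>j\<in>{1..m}. f j) = (\<Sum>j\<in>insert 1 (insert l ?I). f j)" by simp
      also have "\<dots> = f 1 + f l + (\<Sum>j\<in>?I. f j)" using False by (simp add: add.assoc)
      finally show ?thesis .
    qed
    have p0: "p 1 > 0" "p l > 0" using p_pos l m1 by auto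
    have I0: "(\<Sum>j\<in>?I. p j) \<ge> 0" using p_pos by (intro sum_nonneg) (auto simp: less_imp_le)
    have sum1: "p 1 + p l + (\<Sum>j\<in>?I. p j) = 1" using p_sum split[of p] by simp
    have "norm (mask \<xi>) = norm (p 1 *\<^sub>R ?e 1 + p l *\<^sub>R ?e l + (\<Sum>j\<in>?I. p j *\<^sub>R ?e j))"
      unfolding norm_mask split ..
    also have "\<dots> \<le> norm (p 1 *\<^sub>R ?e 1 + p l *\<^sub>R ?e l) + norm (\<Sum>j\<in>?I. p j *\<^sub>R ?e j)" by (rule norm_triangle_ineq)
    also have "p 1 *\<^sub>R ?e 1 = complex_of_real (p 1)" by (simp add: b_def scaleR_conv_of_real)
    also have "norm (complex_of_real (p 1) + p l *\<^sub>R ?e l) \<le> p 1 + p l - p 1 * p l * (1 - cos (2 * pi * (\<xi> \<bullet> b l)))"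
      using p0 I0 sum1 by (intro norm_add_exp_le) auto
    also have "norm (\<Sum>j\<in>?I. p j *\<^sub>R ?e j) \<le> (\<Sum>j\<in>?I. p j)" by (rule rest) auto
    finally show ?thesis using sum1 by linarith
  qed
qed

text \<open>The inequality \<open>1 - x \<le> exp (- x)\<close> turns the product into a sum. The
  bound depends on neither \<open>n\<close> nor \<open>\<xi>\<close>, as the passage to a limit
  requires.\<close>

lemma sum_cos_defect_le:
  assumes l: "l \<in> {1..m}" and \<delta>: "\<delta> > 0" "norm (fourier_transform \<mu> \<xi>) \<ge> \<delta>"
  shows "(\<Sum>k<n. 1 - cos (2 * pi * (mpow B k \<xi> \<bullet> b l))) \<le> - ln \<delta> / (p 1 * p l)"
proof -
  let ?c = "p 1 * p l"
  let ?d = "\<lambda>k. 1 - cos (2 * pi * (mpow B k \<xi> \<bullet> b l))"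
  have c: "?c > 0" using p_pos l m1 by simp
  have "\<delta> \<le> (\<Prod>k<n. norm (mask (mpow B k \<xi>))) * norm (fourier_transform \<mu> (mpow B n \<xi>))"
    using \<delta>(2) fourier_eq_prod[of \<xi> n] by simp
  also have "\<dots> \<le> (\<Prod>k<n. norm (mask (mpow B k \<xi>))) * 1"
    by (intro mult_left_mono norm_fourier_le_1 prod_nonneg) auto
  also have "\<dots> \<le> (\<Prod>k<n. exp (- (?c * ?d k)))"
    unfolding mult_1_right
  proof (intro prod_mono conjI)
    show "norm (mask (mpow B k \<xi>)) \<le> exp (- (?c * ?d k))" for k
      using norm_mask_le[OF l, of "mpow B k \<xi>"] exp_ge_add_one_self[of "- (?c * ?d k)"] by linarith
  qed auto
  also have "\<dots> = exp (- (?c * (\<Sum>k<n. ?d k)))"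
    by (simp add: exp_sum[symmetric] sum_negf sum_distrib_left)
  finally have "ln \<delta> \<le> ln (exp (- (?c * (\<Sum>k<n. ?d k))))" using \<delta>(1) by (subst ln_le_cancel_iff) auto
  then have "ln \<delta> \<le> - (?c * (\<Sum>k<n. ?d k))" by (simp only: ln_exp)
  then have "(\<Sum>k<n. ?d k) * ?c \<le> - ln \<delta>" unfolding mult.commute[of _ ?c] by linarith
  then show ?thesis unfolding pos_le_divide_eq[OF c] .
qed

text \<open>Rescale a sequence of frequencies with Fourier coefficients bounded below into a compact annulus
  by powers of \<open>B\<close>, and pass to a limit point.\<close>

lemma not_rajchman_imp_ex_orbit:
  assumes "\<not> rajchman \<mu>"
  shows "\<exists>\<eta>. \<eta> \<noteq> 0 \<and> (\<forall>l\<in>{1..m}. summable (\<lambda>k. 1 - cos (2 * pi * (mpow M (Suc k) \<eta> \<bullet> b l))))"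
proof -
  obtain \<delta> where \<delta>: "\<delta> > 0" "\<And>R. \<exists>\<xi>. norm \<xi> \<ge> R \<and> norm (fourier_transform \<mu> \<xi>) \<ge> \<delta>"
    using assms unfolding rajchman_def Lim_at_infinity by (auto simp: not_less)
  obtain C0 where C0: "\<And>v. norm (M *v v) \<le> norm v * C0"
    using bounded_linear.bounded[OF matrix_vector_mul_bounded_linear[of M]] by blast
  define C where "C = max C0 1"
  have C1: "C \<ge> 1" by (simp add: C_def)
  have C: "norm (M *v v) \<le> C * norm v" for v
  proof -
    have "norm v * C0 \<le> norm v * C" by (intro mult_left_mono) (auto simp: C_def)
    with C0[of v] show ?thesis by (simp add: mult.commute)
  qed
  have CN: "norm (mpow M n v) \<le> C ^ n * norm v" for n v
  proof (induction n)
    case (Suc n)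
    have "norm (mpow M (Suc n) v) \<le> C * norm (mpow M n v)" using C by simp
    also have "\<dots> \<le> C * (C ^ n * norm v)" using Suc C1 by (intro mult_left_mono) auto
    finally show ?case by (simp add: mult.assoc)
  qed simp
  let ?d = "\<lambda>l \<eta> k. 1 - cos (2 * pi * (mpow M (Suc k) \<eta> \<bullet> b l))"
  define K where "K l = - ln \<delta> / (p 1 * p l)" for l
  have "\<exists>\<eta>. 1 / C \<le> norm \<eta> \<and> norm \<eta> \<le> 1 \<and> (\<forall>l\<in>{1..m}. (\<Sum>k<n. ?d l \<eta> k) \<le> K l)" for n
  proof -
    \<comment> \<open>One step under \<open>B\<close> shrinks the norm by at most the factor
      \<open>C\<close>, so a frequency this large needs more than \<open>n\<close> steps to reach
      the unit ball.\<close>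
    obtain \<xi> where \<xi>: "norm \<xi> \<ge> C ^ n + 1" "norm (fourier_transform \<mu> \<xi>) \<ge> \<delta>" using \<delta>(2) by blast
    have "eventually (\<lambda>N. norm (mpow B N \<xi>) < 1) sequentially"
      using tendsto_norm[OF mpow_B_tendsto_0[of \<xi>]] by (intro order_tendstoD(2)) auto
    then obtain N0 where N0: "norm (mpow B N0 \<xi>) \<le> 1" by (auto simp: eventually_sequentially intro: less_imp_le)
    \<comment> \<open>First entry into the unit ball: the preceding point is still outside, which
      bounds \<open>\<eta>\<close> away from 0.\<close>
    define N where "N = (LEAST N. norm (mpow B N \<xi>) \<le> 1)"
    have N: "norm (mpow B N \<xi>) \<le> 1" unfolding N_def using N0 by (rule LeastI)
    define \<eta> where "\<eta> = mpow B N \<xi>"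
    have \<xi>\<eta>: "\<xi> = mpow M N \<eta>" unfolding \<eta>_def by (rule mpow_inverse[symmetric]) simp
    have "norm \<xi> \<le> C ^ N * norm \<eta>" using CN[of N \<eta>] by (simp only: \<xi>\<eta>[symmetric])
    also have "\<dots> \<le> C ^ N * 1" using N C1 unfolding \<eta>_def by (intro mult_left_mono) auto
    finally have "norm \<xi> \<le> C ^ N * 1" .
    with \<xi>(1) have "C ^ n < C ^ N" by linarith
    then have nN: "n < N" using C1 power_less_imp_less_exp[of C n N] power_increasing[of N n C]
      by (meson linorder_not_le)
    then obtain N' where N': "N = Suc N'" by (cases N) auto
    have "\<not> norm (mpow B N' \<xi>) \<le> 1"
      using not_less_Least[of N' "\<lambda>N. norm (mpow B N \<xi>) \<le> 1"] N' unfolding N_def by simp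
    moreover have "mpow B N' \<xi> = M *v \<eta>" by (simp add: \<eta>_def N')
    ultimately have "1 \<le> C * norm \<eta>" using C[of \<eta>] by simp
    then have "1 / C \<le> norm \<eta>" using C1 by (simp add: divide_le_eq mult.commute)
    moreover have "(\<Sum>k<n. ?d l \<eta> k) \<le> K l" if l: "l \<in> {1..m}" for l
    proof -
      \<comment> \<open>The orbit of \<open>\<xi>\<close> is read backwards from
        \<open>\<eta>\<close>. Its first \<open>N\<close> points are the images of
        \<open>\<eta>\<close> under the powers 1 to \<open>N\<close> of \<open>M\<close>, whence the
        \<open>Suc k\<close> in the statement.\<close>
      have BM: "mpow B (N - Suc i) \<xi> = mpow M (Suc i) \<eta>" if "i < N" for i
      proof -
        have "mpow M N \<eta> = mpow M ((N - Suc i) + Suc i) \<eta>" using that by simp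
        then have "\<xi> = mpow M (N - Suc i) (mpow M (Suc i) \<eta>)"
          unfolding \<xi>\<eta>[symmetric] by (simp only: funpow_add o_apply)
        then show ?thesis by (simp only: mpow_inverse[of B M, OF B_M])
      qed
      have "(\<Sum>k<n. ?d l \<eta> k) \<le> (\<Sum>k<N. ?d l \<eta> k)"
        using nN by (intro sum_mono2) auto
      also have "\<dots> = (\<Sum>i<N. 1 - cos (2 * pi * (mpow B (N - Suc i) \<xi> \<bullet> b l)))"
        by (intro sum.cong refl) (simp only: BM lessThan_iff)
      also have "\<dots> = (\<Sum>k<N. 1 - cos (2 * pi * (mpow B k \<xi> \<bullet> b l)))"
        by (rule sum.nat_diff_reindex)
      also have "\<dots> \<le> K l" unfolding K_def by (rule sum_cos_defect_le[OF l \<delta>(1) \<xi>(2)])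
      finally show ?thesis .
    qed
    ultimately show ?thesis using N by (auto simp: \<eta>_def)
  qed
  then obtain H where H: "\<And>n. 1 / C \<le> norm (H n)" "\<And>n. norm (H n) \<le> 1"
      "\<And>n l. l \<in> {1..m} \<Longrightarrow> (\<Sum>k<n. ?d l (H n) k) \<le> K l" by metis
  have "compact {\<eta> :: real^'d. 1 / C \<le> norm \<eta> \<and> norm \<eta> \<le> 1}"
  proof -
    have "{\<eta> :: real^'d. 1 / C \<le> norm \<eta> \<and> norm \<eta> \<le> 1} = cball 0 1 - ball 0 (1 / C)" by auto
    then show ?thesis by (simp add: compact_diff)
  qed
  then obtain \<eta> r where \<eta>: "1 / C \<le> norm \<eta>" and r: "strict_mono (r :: nat \<Rightarrow> nat)" and lim: "(H \<circ> r) \<longlonglongrightarrow> \<eta>"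
    unfolding compact_def using H(1,2) by (smt (verit) mem_Collect_eq)
  have "summable (\<lambda>k. ?d l \<eta> k)" if l: "l \<in> {1..m}" for l
  proof (rule summableI_nonneg_bounded)
    fix J
    show "(\<Sum>k<J. ?d l \<eta> k) \<le> K l"
    proof (rule LIMSEQ_le_const2)
      have "(\<lambda>n. mpow M k ((H \<circ> r) n)) \<longlonglongrightarrow> mpow M k \<eta>" for k
        by (induction k) (use lim in \<open>auto simp: o_def intro!: bounded_linear.tendsto[OF matrix_vector_mul_bounded_linear]\<close>)
      then show "(\<lambda>n. \<Sum>k<J. ?d l ((H \<circ> r) n) k) \<longlonglongrightarrow> (\<Sum>k<J. ?d l \<eta> k)"
        by (intro tendsto_intros)
      show "\<exists>N. \<forall>n\<ge>N. (\<Sum>k<J. ?d l ((H \<circ> r) n) k) \<le> K l"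
      proof (intro exI[of _ J] allI impI)
        fix n assume "J \<le> n"
        then have "J \<le> r n" using seq_suble[OF r, of n] by linarith
        then have "(\<Sum>k<J. ?d l ((H \<circ> r) n) k) \<le> (\<Sum>k<r n. ?d l (H (r n)) k)"
          unfolding o_def by (intro sum_mono2) auto
        also have "\<dots> \<le> K l" by (rule H(3)[OF l])
        finally show "(\<Sum>k<J. ?d l ((H \<circ> r) n) k) \<le> K l" .
      qed
    qed
  qed auto
  moreover have "\<eta> \<noteq> 0" using \<eta> C1 by auto
  ultimately show ?thesis by blast
qed

end

lemma summable_sq_pact_square:
  fixes y :: "nat \<Rightarrow> real"
  assumes "summable (\<lambda>k. (y k)\<^sup>2)"
  shows "summable (\<lambda>k. (sq.pact q y k)\<^sup>2)"
proof (induction q)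
  case (pCons c q)
  have "(sq.pact (pCons c q) y k)\<^sup>2 \<le> 2 * c\<^sup>2 * (y k)\<^sup>2 + 2 * (sq.pact q y (Suc k))\<^sup>2" for k
    using sum_squares_bound[of "c * y k" "sq.pact q y (Suc k)"]
    by (simp add: power2_sum power_mult_distrib algebra_simps)
  moreover have "summable (\<lambda>k. 2 * c\<^sup>2 * (y k)\<^sup>2 + 2 * (sq.pact q y (Suc k))\<^sup>2)"
    using pCons.IH assms by (intro summable_add summable_mult) (simp_all add: summable_Suc_iff[where f = "\<lambda>k. (sq.pact q y k)\<^sup>2"])
  ultimately show ?case
    by (elim summable_comparison_test'[where N = 0]) (simp only: real_norm_def abs_power2)
qed simp

text \<open>Linear factors of \<open>Q\<close> are removed until what remains no longer kills
  \<open>v\<close>; the resulting vector is an eigenvector for the root just removed.\<close>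

lemma ex_eigenvalue_root:
  fixes C :: "complex^'n^'n"
  assumes "Q \<noteq> 0" "vc.pact C Q v = 0" "v \<noteq> 0"
  shows "\<exists>z w. poly Q z = 0 \<and> w \<noteq> 0 \<and> C *v w = z *s w"
  using assms
proof (induction "degree Q" arbitrary: Q)
  case 0
  then obtain c where "Q = [:c:]" "c \<noteq> 0" by (metis degree_eq_zeroE pCons_0_0)
  then show ?case using 0 by simp
next
  case (Suc n)
  then obtain z where z: "poly Q z = 0"
    using alg_closed_imp_poly_has_root[of Q] by (metis zero_less_Suc)
  then obtain r where r: "Q = [:-z, 1:] * r" by (auto simp: poly_eq_0_iff_dvd dvd_def)
  with Suc.prems have "r \<noteq> 0" by auto
  then have n: "n = degree r" using Suc.hyps unfolding r by (subst (asm) degree_mult_eq) auto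
  let ?w = "vc.pact C r v"
  show ?case
  proof (cases "?w = 0")
    case True
    then show ?thesis using Suc.hyps(1)[OF n \<open>r \<noteq> 0\<close>] Suc.prems(3) by (auto simp: r)
  next
    case False
    have "C *v ?w = z *s ?w"
      using Suc.prems(2) unfolding r vc.pact_mult
      by (simp add: vc.g_add eq_neg_iff_add_eq_0 vector_smult_lneg)
    with z False show ?thesis by blast
  qed
qed

lemma poly_of_int_add:
  "poly (map_poly of_int (p + q)) z = poly (map_poly of_int p) z + (poly (map_poly of_int q) z :: complex)"
  by (induction p q rule: poly_induct2) (simp_all add: map_poly_pCons algebra_simps)

lemma poly_of_int_smult:
  "poly (map_poly of_int (smult c p)) z = of_int c * (poly (map_poly of_int p) z :: complex)"
  by (induction p) (simp_all add: map_poly_pCons algebra_simps)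

lemma poly_of_int_mult:
  "poly (map_poly of_int (p * q)) z = poly (map_poly of_int p) z * (poly (map_poly of_int q) z :: complex)"
  by (induction p) (simp_all add: map_poly_pCons poly_of_int_add poly_of_int_smult algebra_simps)

lemma poly_of_int_sum:
  "poly (map_poly of_int (\<Sum>i\<in>I. p i)) z = (\<Sum>i\<in>I. poly (map_poly of_int (p i)) z :: complex)"
  by (induction I rule: infinite_finite_induct) (simp_all add: poly_of_int_add)

lemma poly_of_int_monom: "poly (map_poly of_int (monom c n)) z = (of_int c * z ^ n :: complex)"
  by (simp add: map_poly_monom poly_monom)

text \<open>Gauss's lemma: contents multiply, so \<open>D\<close> has content
  \<open>\<bar>c\<bar>\<close>. Cancelling it and comparing leading coefficients leaves a product of
  integers equal to a unit.\<close>

lemma primitive_dvd_monic_imp_lead_coeff_unit: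
  fixes R S D :: "int poly"
  assumes "lead_coeff R = 1" "content S = 1" "c \<noteq> 0" "smult c R = S * D"
  shows "\<bar>lead_coeff S\<bar> = 1"
proof -
  have "content R dvd 1" using content_dvd_coeff[of R "degree R"] assms(1) by simp
  then have "content R = 1" by (simp only: is_unit_content_iff)
  then have "content D = \<bar>c\<bar>"
    using arg_cong[OF assms(4), of content] assms(2) by (simp add: content_mult)
  then have "smult c R = smult \<bar>c\<bar> (S * primitive_part D)"
    unfolding assms(4) by (metis content_times_primitive_part mult_smult_right)
  then have "c * lead_coeff R = \<bar>c\<bar> * (lead_coeff S * lead_coeff (primitive_part D))"
    by (metis lead_coeff_mult lead_coeff_smult)
  then have "\<bar>c\<bar> = \<bar>c\<bar> * (\<bar>lead_coeff S\<bar> * \<bar>lead_coeff (primitive_part D)\<bar>)"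
    using assms(1) by (metis abs_abs abs_mult mult.right_neutral)
  then have "\<bar>lead_coeff S\<bar> * \<bar>lead_coeff (primitive_part D)\<bar> = 1" using assms(3) by simp
  then show ?thesis by (metis abs_mult abs_zmult_eq_1)
qed

section \<open>Orbits asymptotic to integer sequences\<close>

context irreducible_ifs
begin

definition coord :: "nat \<Rightarrow> real^'d \<Rightarrow> nat \<Rightarrow> real" where
  "coord l \<theta> = (\<lambda>k. mpow M k \<theta> \<bullet> b l)"

definition ccoord :: "nat \<Rightarrow> complex^'d \<Rightarrow> nat \<Rightarrow> complex" where
  "ccoord l v = (\<lambda>k. cinner (mpow (cmat M) k v) (cvec (b l)))"

lemma coord_pact: "coord l (vc.pact M q \<theta>) = sq.pact q (coord l \<theta>)"
proof (rule pact_hom)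
  show "coord l (v + w) = coord l v + coord l w" for v w
    by (simp add: coord_def mpow_add_right inner_add_left fun_eq_iff)
  show "coord l (c *s v) = (\<lambda>k. c * coord l v k)" for c v
    unfolding coord_def mpow_scale by (simp add: scalar_mult_eq_scaleR)
  show "coord l (M *v v) = (\<lambda>k. coord l v (Suc k))" for v
    by (simp add: coord_def funpow_swap1)
qed (simp_all add: vc.module_endo_axioms sq.module_endo_axioms)

lemma ccoord_pact: "ccoord l (vc.pact (cmat M) q v) = sq.pact q (ccoord l v)"
proof (rule pact_hom)
  show "ccoord l (v + w) = ccoord l v + ccoord l w" for v w
    by (simp add: ccoord_def mpow_add_right cinner_def fun_eq_iff algebra_simps sum.distrib)
  show "ccoord l (c *s v) = (\<lambda>k. c * ccoord l v k)" for c v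
    by (simp add: ccoord_def mpow_scale cinner_def sum_distrib_left mult_ac)
  show "ccoord l (cmat M *v v) = (\<lambda>k. ccoord l v (Suc k))" for v
    by (simp add: ccoord_def funpow_swap1)
qed (simp_all add: vc.module_endo_axioms sq.module_endo_axioms)

lemma ccoord_cvec: "ccoord l (cvec \<theta>) = (\<lambda>k. of_real (coord l \<theta> k))"
  unfolding ccoord_def coord_def mpow_cmat_cvec by (simp add: cinner_def cvec_def inner_vec_def)

lemma ccoord_tendsto_0: "(\<And>l. l \<in> {1..m} \<Longrightarrow> ccoord l v \<longlonglongrightarrow> 0) \<Longrightarrow> v = 0"
  unfolding ccoord_def by (rule cinner_mpow_tendsto_0_imp_eq_0)

lemma coord_tendsto_0:
  assumes "\<And>l. l \<in> {1..m} \<Longrightarrow> coord l \<theta> \<longlonglongrightarrow> 0"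
  shows "\<theta> = 0"
proof -
  have "ccoord l (cvec \<theta>) \<longlonglongrightarrow> 0" if "l \<in> {1..m}" for l
    unfolding ccoord_cvec using tendsto_of_real[OF assms[OF that]] by simp
  then have "cvec \<theta> = 0" by (rule ccoord_tendsto_0)
  then show ?thesis by simp
qed

text \<open>Closeness to integers is asymptotic while the recurrence is exact from index 0, which a
  shift of the orbit arranges. Only convergence is recorded: square summability has done its work
  once a recurrence exists.\<close>

definition int_orbit :: "real^'d \<Rightarrow> (nat \<Rightarrow> nat \<Rightarrow> int) \<Rightarrow> int poly \<Rightarrow> bool" where
  "int_orbit \<theta> N S \<longleftrightarrow> \<theta> \<noteq> 0 \<and> S \<noteq> 0 \<and> (\<forall>l\<in>{1..m}. (\<lambda>k. coord l \<theta> k - of_int (N l k)) \<longlonglongrightarrow> 0) \<and>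
     (\<forall>l\<in>{1..m}. sq.pact S (N l) = 0)"

lemma coord_mpow: "coord l (mpow M n \<theta>) k = coord l \<theta> (k + n)"
  by (simp add: coord_def funpow_add)

lemma mpow_M_eq_0_iff: "mpow M n \<theta> = 0 \<longleftrightarrow> \<theta> = 0"
  using mpow_inverse[of B M n \<theta>] by auto

lemma near_pact:
  assumes "(\<lambda>k. coord l \<theta> k - of_int (N k)) \<longlonglongrightarrow> 0"
  shows "(\<lambda>k. coord l (vc.pact M (map_poly of_int U) \<theta>) k - of_int (sq.pact U N k)) \<longlonglongrightarrow> 0"
  using sq_pact_tendsto_0[OF assms, of "map_poly of_int U"]
  by (simp add: coord_pact sq_pact_diff sq_pact_of_int)

text \<open>Applying one factor of the recurrence to the orbit leaves the complementary factor as
  recurrence. The scalar \<open>c\<close> accounts for pseudo-division over the integers.\<close>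

lemma int_orbit_factor:
  assumes orb: "int_orbit \<theta> N S" and c: "c \<noteq> 0" "smult c S = U * D"
    and nz: "vc.pact M (map_poly of_int U) \<theta> \<noteq> 0"
  shows "int_orbit (vc.pact M (map_poly of_int U) \<theta>) (\<lambda>l. sq.pact U (N l)) D"
  unfolding int_orbit_def
proof (intro conjI ballI)
  show "D \<noteq> 0" using orb c by (auto simp: int_orbit_def)
  fix l assume l: "l \<in> {1..m}"
  show "(\<lambda>k. coord l (vc.pact M (map_poly of_int U) \<theta>) k - of_int (sq.pact U (N l) k)) \<longlonglongrightarrow> 0"
    using orb l by (intro near_pact) (auto simp: int_orbit_def)
  have "sq.pact D (sq.pact U (N l)) = sq.pact (smult c S) (N l)"
    unfolding c(2) by (simp only: sq.pact_mult mult.commute[of U])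
  also have "\<dots> = 0" using orb l by (simp add: int_orbit_def sq.pact_smult fun_eq_iff)
  finally show "sq.pact D (sq.pact U (N l)) = 0" .
qed (fact nz)

text \<open>If \<open>U\<close> kills the vector, its values on the integer sequences tend to 0;
  being integers, they are eventually 0, so \<open>U\<close> is itself a recurrence for a shifted
  orbit.\<close>

lemma int_orbit_degenerate:
  assumes orb: "int_orbit \<theta> N S" and U: "U \<noteq> 0" "vc.pact M (map_poly of_int U) \<theta> = 0"
  shows "\<exists>n. int_orbit (mpow M n \<theta>) (\<lambda>l k. N l (k + n)) U"
proof -
  have "eventually (\<lambda>k. sq.pact U (N l) k = 0) sequentially" if l: "l \<in> {1..m}" for l
  proof -
    have "(\<lambda>k. coord l \<theta> k - of_int (N l k)) \<longlonglongrightarrow> 0" using orb l by (auto simp: int_orbit_def)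
    then have "(\<lambda>k. coord l 0 k - of_int (sq.pact U (N l) k)) \<longlonglongrightarrow> 0"
      using near_pact[of l \<theta> "N l" U] U(2) by simp
    then have "(\<lambda>k. real_of_int (sq.pact U (N l) k)) \<longlonglongrightarrow> 0"
      using tendsto_minus by (fastforce simp: coord_def)
    then have "eventually (\<lambda>k. \<bar>real_of_int (sq.pact U (N l) k)\<bar> < 1) sequentially"
      by (intro order_tendstoD(2)[OF tendsto_rabs_zero]) auto
    then show ?thesis by (rule eventually_mono) linarith
  qed
  then have "eventually (\<lambda>k. \<forall>l\<in>{1..m}. sq.pact U (N l) k = 0) sequentially"
    by (intro eventually_ball_finite) auto
  then obtain n where "\<forall>k\<ge>n. \<forall>l\<in>{1..m}. sq.pact U (N l) k = 0"
    unfolding eventually_sequentially by blast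
  then have n: "sq.pact U (N l) k = 0" if "l \<in> {1..m}" "k \<ge> n" for l k using that by blast
  have "sq.pact U (\<lambda>k. N l (k + n)) = 0" if "l \<in> {1..m}" for l
    using n[OF that] by (simp add: fun_eq_iff sq_pact_drop)
  moreover have "(\<lambda>k. coord l \<theta> (k + n) - of_int (N l (k + n))) \<longlonglongrightarrow> 0" if "l \<in> {1..m}" for l
    using orb that LIMSEQ_ignore_initial_segment[of "\<lambda>k. coord l \<theta> k - of_int (N l k)" 0 n]
    by (auto simp: int_orbit_def)
  ultimately show ?thesis
    using orb U(1) by (intro exI[of _ n]) (auto simp: int_orbit_def mpow_M_eq_0_iff coord_mpow)
qed

text \<open>By minimality the pseudo-remainder of any recurrence of the same sequences modulo the
  primitive part of \<open>S\<close> vanishes. Applied to a monic recurrence, Gauss's lemma makes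
  the leading coefficient a unit.\<close>

lemma ex_minimal_monic_int_orbit:
  assumes "int_orbit \<theta>0 N0 S0"
  shows "\<exists>\<theta> N Q. int_orbit \<theta> N Q \<and> lead_coeff Q = 1 \<and>
    (\<forall>\<theta>' N' S'. int_orbit \<theta>' N' S' \<longrightarrow> degree Q \<le> degree S')"
proof -
  define P where "P n \<longleftrightarrow> (\<exists>\<theta> N S. int_orbit \<theta> N S \<and> degree S = n)" for n
  have "P (LEAST n. P n)" by (rule LeastI[of P "degree S0"]) (use assms in \<open>auto simp: P_def\<close>)
  then obtain \<theta> N S where orb: "int_orbit \<theta> N S" and deg: "degree S = (LEAST n. P n)"
    unfolding P_def by blast
  have min: "degree S \<le> degree S'" if "int_orbit \<theta>' N' S'" for \<theta>' N' S'
    unfolding deg by (rule Least_le) (use that in \<open>auto simp: P_def\<close>)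
  define S1 where "S1 = primitive_part S"
  have S: "S \<noteq> 0" using orb by (simp add: int_orbit_def)
  have S1: "S = smult (content S) S1" "content S1 = 1" "degree S1 = degree S" "content S \<noteq> 0"
    using S by (simp_all add: S1_def)
  have S1_kill: "sq.pact S1 (N l) = 0" if "l \<in> {1..m}" for l
  proof -
    have "sq.pact (smult (content S) S1) (N l) = 0"
      using orb that S1(1) by (simp add: int_orbit_def)
    then show ?thesis using S1(4) by (simp only: sq.pact_smult) (simp add: fun_eq_iff)
  qed
  have S1nz: "S1 \<noteq> 0" using S1(2) by auto
  obtain R where R: "lead_coeff R = 1" "\<And>l. l \<in> {1..m} \<Longrightarrow> sq.pact R (N l) = 0"
    using ex_monic_int_relation[of "{1..m}" S1 N] S1nz S1_kill by (auto simp: fun_eq_iff)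
  obtain c D where cD: "c \<noteq> 0" "smult c R = S1 * D + pseudo_mod R S1"
    using pseudo_mod(1)[OF S1nz, of R] by blast
  let ?r = "pseudo_mod R S1"
  have "?r = 0"
  proof (rule ccontr)
    assume r: "?r \<noteq> 0"
    have "sq.pact ?r (N l) = 0" if l: "l \<in> {1..m}" for l
    proof -
      have "?r = smult c R - D * S1" using cD(2) by (simp add: mult.commute)
      then have "sq.pact ?r (N l) = sq.pact (smult c R) (N l) - sq.pact (D * S1) (N l)"
        by (simp only: sq.pact_diff)
      then show ?thesis using R(2)[OF l] S1_kill[OF l] by (simp add: sq.pact_smult sq.pact_mult fun_eq_iff)
    qed
    then have "int_orbit \<theta> N ?r" using orb r by (simp add: int_orbit_def)
    from min[OF this] pseudo_mod(2)[OF S1nz, of R] r S1(3) show False by auto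
  qed
  then have lc: "\<bar>lead_coeff S1\<bar> = 1"
    using primitive_dvd_monic_imp_lead_coeff_unit[OF R(1) S1(2) cD(1), of D] cD(2) by simp
  define Q where "Q = smult (lead_coeff S1) S1"
  have lc0: "lead_coeff S1 \<noteq> 0" using S1nz by simp
  have "lead_coeff Q = 1" using lc unfolding Q_def lead_coeff_smult by (metis abs_mult_self_eq mult.right_neutral)
  moreover have "int_orbit \<theta> N Q"
    using orb S1_kill lc0 S1nz by (auto simp: int_orbit_def Q_def sq.pact_smult fun_eq_iff)
  moreover have "degree Q = degree S" using lc0 by (simp add: Q_def S1(3))
  ultimately show ?thesis using min by metis
qed

text \<open>The substitute for irreducibility of \<open>Q\<close>. An integer polynomial
  \<open>V\<close> of least degree vanishing at \<open>z\<close> would split \<open>Q\<close> up to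
  a scalar into factors of smaller degree. If \<open>V\<close> kills the vector, \<open>V\<close>
  becomes a recurrence; otherwise its cofactor does, for a new vector.\<close>

lemma minimal_int_orbit_no_smaller_root:
  assumes orb: "int_orbit \<theta> N Q" and min: "\<And>\<theta>' N' S'. int_orbit \<theta>' N' S' \<Longrightarrow> degree Q \<le> degree S'"
    and z: "poly (map_poly of_int Q) z = (0::complex)" "poly (map_poly of_int U) z = 0" "degree U < degree Q"
  shows "U = 0"
proof (rule ccontr)
  assume "U \<noteq> 0"
  define P where "P n \<longleftrightarrow> (\<exists>V :: int poly. V \<noteq> 0 \<and> poly (map_poly of_int V) z = 0 \<and> degree V = n)" for n
  have "P (LEAST n. P n)" by (rule LeastI[of P "degree U"]) (use \<open>U \<noteq> 0\<close> z in \<open>auto simp: P_def\<close>)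
  then obtain V :: "int poly" where V: "V \<noteq> 0" "poly (map_poly of_int V) z = 0" "degree V = (LEAST n. P n)"
    unfolding P_def by blast
  have minV: "degree V \<le> degree V'" if "V' \<noteq> 0" "poly (map_poly of_int V') z = 0" for V' :: "int poly"
    unfolding V(3) by (rule Least_le) (use that in \<open>auto simp: P_def\<close>)
  obtain c D where cD: "c \<noteq> 0" "smult c Q = V * D + pseudo_mod Q V"
    using pseudo_mod(1)[OF V(1), of Q] by blast
  have ev: "poly (map_poly of_int (p + q)) z = poly (map_poly of_int p) z + poly (map_poly of_int q) z"
    "poly (map_poly of_int (p * q)) z = poly (map_poly of_int p) z * poly (map_poly of_int q) z"
    "poly (map_poly of_int (smult c p)) z = of_int c * poly (map_poly of_int p) z" for p q :: "int poly" and c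
    by (simp_all add: poly_of_int_add poly_of_int_mult poly_of_int_smult)
  have "poly (map_poly of_int (pseudo_mod Q V)) z = 0"
    using arg_cong[OF cD(2), of "\<lambda>p. poly (map_poly of_int p) z"] z(1) V(2) by (simp add: ev)
  then have "pseudo_mod Q V = 0" using minV pseudo_mod(2)[OF V(1), of Q] by force
  then have eq: "smult c Q = V * D" using cD by simp
  have degV: "degree V < degree Q" using minV[OF \<open>U \<noteq> 0\<close> z(2)] z(3) by simp
  have "degree V > 0"
  proof (rule ccontr)
    assume "\<not> degree V > 0"
    then obtain a where "V = [:a:]" by (auto elim: degree_eq_zeroE)
    then show False using V(1,2) by (simp add: map_poly_pCons)
  qed
  have Dnz: "D \<noteq> 0" using eq cD(1) orb by (auto simp: int_orbit_def)
  have "degree Q = degree V + degree D"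
    using arg_cong[OF eq, of degree] cD(1) V(1) Dnz by (simp add: degree_mult_eq)
  then have degD: "degree D < degree Q" using \<open>degree V > 0\<close> by simp
  show False
  proof (cases "vc.pact M (map_poly of_int V) \<theta> = 0")
    case True
    from int_orbit_degenerate[OF orb V(1) True] min degV show False by (meson linorder_not_le)
  next
    case False
    from int_orbit_factor[OF orb cD(1) eq False] min degD show False by (meson linorder_not_le)
  qed
qed

text \<open>A monic real \<open>q\<close> annihilates \<open>M\<close>, hence every coordinate
  sequence. Applied to the nearest integers it leaves minus its value on the errors, which is square
  summable.\<close>

lemma ex_int_orbit:
  assumes \<eta>: "\<eta> \<noteq> 0" "\<And>l. l \<in> {1..m} \<Longrightarrow> summable (\<lambda>k. 1 - cos (2 * pi * (mpow M (Suc k) \<eta> \<bullet> b l)))"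
  shows "\<exists>\<theta> N S. int_orbit \<theta> N S"
proof -
  define \<theta> where "\<theta> = M *v \<eta>"
  define N where "N l k = round (coord l \<theta> k)" for l k
  define e where "e l k = coord l \<theta> k - of_int (N l k)" for l k
  have "\<theta> \<noteq> 0" using \<eta>(1) mpow_M_eq_0_iff[of 1 \<eta>] by (simp add: \<theta>_def)
  have coord_\<theta>: "coord l \<theta> k = mpow M (Suc k) \<eta> \<bullet> b l" for l k
    by (simp add: coord_def \<theta>_def funpow_swap1)
  have e2: "summable (\<lambda>k. (e l k)\<^sup>2)" if "l \<in> {1..m}" for l
    using \<eta>(2)[OF that] dist_round_square_le unfolding coord_\<theta>[symmetric] e_def N_def
    by (elim summable_comparison_test'[where N = 0]) simp
  have e0: "(\<lambda>k. e l k) \<longlonglongrightarrow> 0" if "l \<in> {1..m}" for l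
    using summable_LIMSEQ_zero[OF e2[OF that]] by simp
  obtain q0 where q0: "q0 \<noteq> 0" "\<And>v. vc.pact M q0 v = 0" using ex_annihilating_poly[of M] by blast
  define q where "q = smult (inverse (lead_coeff q0)) q0"
  have q: "lead_coeff q = 1" "vc.pact M q v = 0" for v
    using q0 by (simp_all add: q_def vc.pact_smult)
  have "\<exists>S n. S \<noteq> 0 \<and> (\<forall>k. sq.pact S (N l) (k + n) = 0)" if l: "l \<in> {1..m}" for l
  proof (rule ex_int_relation[OF q(1)])
    have "sq.pact q (coord l \<theta>) = 0" using coord_pact[of l q \<theta>] q(2) by (simp add: coord_def fun_eq_iff)
    moreover have "(\<lambda>k. real_of_int (N l k)) = (\<lambda>k. coord l \<theta> k - e l k)" by (simp add: e_def)
    ultimately have "sq.pact q (\<lambda>k. real_of_int (N l k)) = (\<lambda>k. - sq.pact q (e l) k)"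
      by (simp add: sq_pact_diff)
    then show "summable (\<lambda>k. (sq.pact q (\<lambda>k. real_of_int (N l k)) k)\<^sup>2)"
      using summable_sq_pact_square[OF e2[OF l]] by simp
  qed
  then obtain T n where T: "\<And>l. l \<in> {1..m} \<Longrightarrow> T l \<noteq> 0" "\<And>l k. l \<in> {1..m} \<Longrightarrow> sq.pact (T l) (N l) (k + n l) = 0"
    by metis
  \<comment> \<open>A single recurrence and a single delay for all \<open>l\<close>: the product
    contains every \<open>T l\<close> as a factor, and \<open>n0\<close> is at least every
    \<open>n l\<close>.\<close>
  define S where "S = (\<Prod>l\<in>{1..m}. T l)"
  define n0 where "n0 = (\<Sum>l\<in>{1..m}. n l)"
  have "sq.pact S (\<lambda>k. N l (k + n0)) = 0" if l: "l \<in> {1..m}" for l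
  proof -
    have n0: "n0 = (n0 - n l) + n l" using member_le_sum[OF l, of n] by (simp add: n0_def)
    have "sq.pact (T l) (\<lambda>k. N l (k + n0)) = 0"
    proof
      fix k
      have "sq.pact (T l) (\<lambda>k. N l (k + n0)) k = sq.pact (T l) (N l) ((k + (n0 - n l)) + n l)"
        unfolding sq_pact_drop using n0 by (simp add: add.assoc)
      then show "sq.pact (T l) (\<lambda>k. N l (k + n0)) k = 0 k" using T(2)[OF l] by simp
    qed
    moreover have "S = (\<Prod>l\<in>{1..m} - {l}. T l) * T l"
      unfolding S_def by (subst prod.remove[OF _ l]) (simp_all only: finite_atLeastAtMost mult.commute)
    ultimately show ?thesis by (simp only: sq.pact_mult sq.pact_0_right)
  qed
  moreover have "S \<noteq> 0" using T(1) by (simp add: S_def)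
  moreover have "(\<lambda>k. coord l (mpow M n0 \<theta>) k - of_int (N l (k + n0))) \<longlonglongrightarrow> 0" if "l \<in> {1..m}" for l
    using LIMSEQ_ignore_initial_segment[OF e0[OF that], of n0] by (simp add: coord_mpow e_def)
  ultimately have "int_orbit (mpow M n0 \<theta>) (\<lambda>l k. N l (k + n0)) S"
    using \<open>\<theta> \<noteq> 0\<close> by (simp add: int_orbit_def mpow_M_eq_0_iff)
  then show ?thesis by blast
qed

text \<open>The value at a root \<open>z\<close> of the polynomial \<open>U l\<close> below is the initial term of the geometric sequence
  obtained from \<open>N l\<close> by applying \<open>Q / (X - z)\<close>.\<close>

lemma int_orbit_imp_generalized_pisot:
  assumes hom: "homogeneous_affine_ifs m A a"
    and orb: "int_orbit \<theta> N Q" and monic: "lead_coeff Q = 1"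
    and min: "\<And>\<theta>' N' S'. int_orbit \<theta>' N' S' \<Longrightarrow> degree Q \<le> degree S'"
  shows "generalized_pisot_ifs m A a"
proof -
  let ?Q = "map_poly of_int Q :: complex poly"
  define D where "D = degree Q"
  have degQ: "degree ?Q = D" unfolding D_def by (rule degree_map_poly) auto
  have Qnz: "?Q \<noteq> 0" using monic by (auto simp: map_poly_eq_0_iff)
  have \<theta>: "\<theta> \<noteq> 0" and near: "\<And>l. l \<in> {1..m} \<Longrightarrow> (\<lambda>k. coord l \<theta> k - of_int (N l k)) \<longlonglongrightarrow> 0"
    and kill: "\<And>l. l \<in> {1..m} \<Longrightarrow> sq.pact Q (N l) = 0" and "Q \<noteq> 0"
    using orb by (auto simp: int_orbit_def)
  let ?N = "\<lambda>l k. of_int (N l k) :: complex"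
  have cnear: "(\<lambda>k. ccoord l (cvec \<theta>) k - ?N l k) \<longlonglongrightarrow> 0" if "l \<in> {1..m}" for l
    using tendsto_of_real[OF near[OF that], where 'a = complex] by (simp add: ccoord_cvec)
  have ckill: "sq.pact ?Q (?N l) = 0" if "l \<in> {1..m}" for l
    using kill[OF that] by (simp add: fun_eq_iff sq_pact_of_int)
  have Nnz: "\<not> (\<forall>l\<in>{1..m}. \<forall>k. N l k = 0)"
  proof
    assume "\<forall>l\<in>{1..m}. \<forall>k. N l k = 0"
    then have "\<theta> = 0" using near by (intro coord_tendsto_0) simp
    then show False using \<theta> by simp
  qed
  have D0: "D > 0"
  proof (rule ccontr)
    assume "\<not> D > 0"
    then have "Q = 1" using monic by (metis D_def degree_eq_zeroE lead_coeff_pCons(2) not_gr_zero one_pCons)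
    then show False using kill Nnz by (simp add: fun_eq_iff)
  qed
  \<comment> \<open>\<open>Q\<close> kills the integers exactly and the errors in the limit, so all
    pairings of the resulting vector tend to 0.\<close>
  have Qkill: "vc.pact (cmat M) ?Q (cvec \<theta>) = 0"
  proof (rule ccoord_tendsto_0)
    fix l assume l: "l \<in> {1..m}"
    have "sq.pact ?Q (\<lambda>k. ccoord l (cvec \<theta>) k - ?N l k) \<longlonglongrightarrow> 0" by (rule sq_pact_tendsto_0[OF cnear[OF l]])
    then show "ccoord l (vc.pact (cmat M) ?Q (cvec \<theta>)) \<longlonglongrightarrow> 0"
      by (simp add: sq_pact_diff ckill[OF l] ccoord_pact)
  qed
  define \<zeta> where "\<zeta> z = vc.pact (cmat M) (synthetic_div ?Q z) (cvec \<theta>)" for z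
  define U where "U l = (\<Sum>i<D. \<Sum>j\<le>D. monom (coeff Q (Suc i + j) * N l i) j)" for l
  have eig: "cmat M *v \<zeta> z = z *s \<zeta> z" if "poly ?Q z = 0" for z
  proof -
    have "vc.pact (cmat M) [:- z, 1:] (\<zeta> z) = 0"
      unfolding \<zeta>_def vc.pact_mult[symmetric] synthetic_div_root[OF that] by (rule Qkill)
    then show ?thesis by (simp add: vc.g_add eq_neg_iff_add_eq_0 vector_smult_lneg)
  qed
  have U_eval: "poly (map_poly of_int (U l)) z = sq.pact (synthetic_div ?Q z) (?N l) 0" for l z
  proof -
    have "sq.pact (synthetic_div ?Q z) (?N l) 0 = (\<Sum>i\<le>degree (synthetic_div ?Q z). coeff (synthetic_div ?Q z) i * ?N l i)"
      by (simp add: sq_pact_eq_sum)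
    also have "\<dots> = (\<Sum>i<D. coeff (synthetic_div ?Q z) i * ?N l i)"
      using degree_synthetic_div_less[of ?Q z] D0 degQ
      by (intro sum.mono_neutral_left) (auto simp: coeff_eq_0)
    also have "\<dots> = (\<Sum>i<D. \<Sum>j\<le>D. of_int (coeff Q (Suc i + j) * N l i) * z ^ j)"
      by (simp add: coeff_synthetic_div degQ coeff_map_poly sum_distrib_right sum_distrib_left mult_ac)
    also have "\<dots> = poly (map_poly of_int (U l)) z"
      unfolding U_def by (simp add: poly_of_int_sum poly_of_int_monom)
    finally show ?thesis ..
  qed
  have degU: "degree (U l) < D" for l
  proof -
    have "coeff (U l) j = 0" if "j \<ge> D" for j
      unfolding U_def coeff_sum using that
      by (intro sum.neutral ballI) (auto simp: coeff_eq_0 D_def)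
    then have "degree (U l) \<le> D - 1" by (intro degree_le) auto
    then show ?thesis using D0 by simp
  qed
  \<comment> \<open>Triangularity: the coefficient of \<open>U l\<close> at \<open>D - Suc i\<close>
    is \<open>N l i\<close> plus multiples of earlier terms, so \<open>U l = 0\<close> forces the
    initial values, then the whole sequence, to vanish.\<close>
  have U_zero: "N l k = 0" if l: "l \<in> {1..m}" and "U l = 0" for l k
  proof (rule sq_pact_eq_0_imp_eq_0[OF \<open>Q \<noteq> 0\<close>, where n = "Suc k"])
    show "N l i = 0" if "i < degree Q" for i
      using that
    proof (induction i rule: less_induct)
      case (less i)
      then have iD: "i < D" by (simp add: D_def)
      let ?j = "D - Suc i"
      have "coeff (U l) ?j = (\<Sum>i'<D. \<Sum>j\<le>D. if j = ?j then coeff Q (Suc i' + j) * N l i' else 0)"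
        unfolding U_def by (simp add: coeff_sum)
      also have "\<dots> = (\<Sum>i'<D. coeff Q (Suc i' + ?j) * N l i')" by simp
      also have "\<dots> = (\<Sum>i'\<in>{i}. coeff Q (Suc i' + ?j) * N l i')"
      proof (rule sum.mono_neutral_right)
        show "\<forall>i'\<in>{..<D} - {i}. coeff Q (Suc i' + ?j) * N l i' = 0"
        proof
          fix i' assume i': "i' \<in> {..<D} - {i}"
          show "coeff Q (Suc i' + ?j) * N l i' = 0"
          proof (cases "i' < i")
            case True
            then show ?thesis using less by simp
          next
            case False
            then have "Suc i' + ?j > degree Q" using i' iD unfolding D_def by auto
            then show ?thesis by (simp add: coeff_eq_0)
          qed
        qed
      qed (use iD in auto)
      also have "\<dots> = N l i" using monic iD by (simp add: D_def)
      finally show ?case using \<open>U l = 0\<close> by simp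
    qed
  qed (use kill[OF l] in auto)
  \<comment> \<open>Dividing \<open>X - z\<close> out of \<open>Q\<close> makes both the pairings
    and the integers geometric with ratio \<open>z\<close>. As \<open>norm z \<ge> 1\<close>, their
    difference can tend to 0 only if the initial terms agree.\<close>
  have pairing: "cinner (\<zeta> z) (cvec (b l)) = poly (map_poly of_int (U l)) z"
    if z: "poly ?Q z = 0" "norm z \<ge> 1" and l: "l \<in> {1..m}" for z l
  proof -
    let ?P = "synthetic_div ?Q z"
    have geo: "y k = z ^ k * y 0" if "sq.pact [:- z, 1:] y = 0" for y :: "nat \<Rightarrow> complex" and k
    proof (induction k)
      case (Suc k)
      have "sq.pact [:- z, 1:] y k = 0" using that by simp
      then have "y (Suc k) = z * y k" by simp
      with Suc show ?case by simp
    qed simp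
    have "sq.pact [:- z, 1:] (sq.pact ?P (?N l)) = 0"
      unfolding sq.pact_mult[symmetric] synthetic_div_root[OF z(1)] by (rule ckill[OF l])
    then have y1: "sq.pact ?P (?N l) k = z ^ k * poly (map_poly of_int (U l)) z" for k
      unfolding U_eval by (rule geo)
    have y2: "sq.pact ?P (ccoord l (cvec \<theta>)) k = z ^ k * cinner (\<zeta> z) (cvec (b l))" for k
      unfolding ccoord_pact[symmetric] \<zeta>_def[symmetric]
      by (simp add: ccoord_def mpow_eigenvector[OF eig[OF z(1)]] cinner_def sum_distrib_left mult_ac)
    let ?w = "cinner (\<zeta> z) (cvec (b l)) - poly (map_poly of_int (U l)) z"
    have "sq.pact ?P (\<lambda>k. ccoord l (cvec \<theta>) k - ?N l k) \<longlonglongrightarrow> 0" by (rule sq_pact_tendsto_0[OF cnear[OF l]])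
    then have "(\<lambda>k. z ^ k * ?w) \<longlonglongrightarrow> 0"
      unfolding sq_pact_diff y1 y2 by (simp add: right_diff_distrib)
    then have "(\<lambda>k. norm (z ^ k * ?w)) \<longlonglongrightarrow> 0" by (rule tendsto_norm_zero)
    moreover have "norm ?w \<le> norm (z ^ k * ?w)" for k
      using z(2) one_le_power[of "norm z" k] mult_right_mono[of 1 "norm z ^ k" "norm ?w"]
      by (simp add: norm_mult norm_power)
    ultimately have "norm ?w \<le> 0" by (intro LIMSEQ_le_const[where X = "\<lambda>k. norm (z ^ k * ?w)"]) auto
    then show ?thesis by simp
  qed
  \<comment> \<open>Otherwise every \<open>U l\<close> would vanish at \<open>z\<close>; its degree
    is below that of \<open>Q\<close>, so minimality would make it 0, and all the integers with
    it.\<close>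
  have \<zeta>nz: "\<zeta> z \<noteq> 0" if z: "poly ?Q z = 0" "norm z \<ge> 1" for z
  proof
    assume "\<zeta> z = 0"
    then have "poly (map_poly of_int (U l)) z = 0" if "l \<in> {1..m}" for l
      using pairing[OF z that] by (simp add: cinner_def)
    then have "U l = 0" if "l \<in> {1..m}" for l
      using that degU[of l] by (intro minimal_int_orbit_no_smaller_root[OF orb min z(1)]) (auto simp: D_def)
    then show False using U_zero Nnz by blast
  qed
  \<comment> \<open>The two preceding facts include the unit circle, so a root on it would be an
    eigenvalue of \<open>M\<close>; but these lie strictly outside.\<close>
  have off_circle: "norm z > 1" if "poly ?Q z = 0" "norm z \<ge> 1" for z
    using eigenvalue_M_norm_gt_1[OF eig[OF that(1)] \<zeta>nz[OF that]] .
  define Z where "Z = {z. poly ?Q z = 0 \<and> norm z > 1}"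
  have finZ: "finite Z" using poly_roots_finite[OF Qnz] by (rule rev_finite_subset) (auto simp: Z_def)
  \<comment> \<open>\<open>Q\<close> annihilates the nonzero complexified vector, so one of its
    roots is an eigenvalue of \<open>M\<close>.\<close>
  have "Z \<noteq> {}"
    using ex_eigenvalue_root[OF Qnz Qkill] \<theta> eigenvalue_M_norm_gt_1 by (auto simp: Z_def)
  obtain \<beta> where \<beta>: "bij_betw \<beta> {1..card Z} Z" using ex_bij_betw_nat_finite_1[OF finZ] by blast
  have \<beta>Z: "poly ?Q (\<beta> j) = 0" "norm (\<beta> j) > 1" if "j \<in> {1..card Z}" for j
    using bij_betwE[OF \<beta>] that by (auto simp: Z_def)
  have "pisot_tuple (card Z) \<beta>"
    unfolding pisot_tuple_def
  proof (intro conjI ballI exI[of _ Q] allI impI)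
    show "inj_on \<beta> {1..card Z}" using \<beta> by (rule bij_betw_imp_inj_on)
    show "algebraic_int (\<beta> j)" if "j \<in> {1..card Z}" for j
      unfolding algebraic_int_altdef_ipoly using \<beta>Z(1)[OF that] monic by blast
    show "norm z < 1" if "poly ?Q z = 0 \<and> z \<notin> \<beta> ` {1..card Z}" for z
      using that off_circle[of z] bij_betw_imp_surj_on[OF \<beta>] by (force simp: Z_def)
  qed (use \<beta>Z monic in auto)
  moreover have "transpose (cmat A) *v \<zeta> (\<beta> j) = inverse (\<beta> j) *s \<zeta> (\<beta> j)" if j: "j \<in> {1..card Z}" for j
  proof -
    have "transpose (cmat A) = cmat B" by (simp add: B_def cmat_def map_matrix_def transpose_def)
    moreover have "\<zeta> (\<beta> j) = \<beta> j *s (cmat B *v \<zeta> (\<beta> j))"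
      using arg_cong[OF eig[OF \<beta>Z(1)[OF j]], of "(*v) (cmat B)"] by (simp add: vc.g_scale)
    then have "inverse (\<beta> j) *s \<zeta> (\<beta> j) = inverse (\<beta> j) *s (\<beta> j *s (cmat B *v \<zeta> (\<beta> j)))" by simp
    moreover have "\<beta> j \<noteq> 0" using \<beta>Z(2)[OF j] by auto
    ultimately show ?thesis by simp
  qed
  moreover have "\<exists>P :: int poly. \<forall>j\<in>{1..card Z}. cinner (\<zeta> (\<beta> j)) (cvec (a l - a 1)) = poly (map_poly of_int P) (\<beta> j)"
    if l: "l \<in> {1..m}" for l
  proof (intro exI ballI)
    fix j assume j: "j \<in> {1..card Z}"
    show "cinner (\<zeta> (\<beta> j)) (cvec (a l - a 1)) = poly (map_poly of_int (U l)) (\<beta> j)"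
      using pairing[OF \<beta>Z(1)[OF j] _ l] \<beta>Z(2)[OF j] by (simp add: b_def)
  qed
  moreover have "\<zeta> (\<beta> j) \<noteq> 0" if "j \<in> {1..card Z}" for j
    using \<zeta>nz \<beta>Z[OF that] by simp
  moreover have "card Z \<ge> 1" using \<open>Z \<noteq> {}\<close> finZ by (simp add: Suc_le_eq card_gt_0_iff)
  ultimately show ?thesis
    unfolding generalized_pisot_ifs_def using hom
    by (intro conjI exI[of _ "card Z"] exI[of _ \<beta>] exI[of _ "\<lambda>j. \<zeta> (\<beta> j)"]) auto
qed

end

theorem theorem1p7:
  fixes A :: "real ^ 'd ^ 'd" and a :: "nat \<Rightarrow> real ^ 'd" and m :: nat
  assumes "homogeneous_affine_ifs m A a"
    and "affinely_irreducible m A a"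
  shows "(\<exists>p. strictly_positive_prob_vector m p \<and> \<not> rajchman (self_affine_measure m A a p))
    \<longleftrightarrow> generalized_pisot_ifs m A a"
proof -
  interpret irreducible_ifs A m a
    using assms by unfold_locales (auto simp: homogeneous_affine_ifs_def)
  show ?thesis
  proof
    assume "\<exists>p. strictly_positive_prob_vector m p \<and> \<not> rajchman (self_affine_measure m A a p)"
    then obtain p where prob: "strictly_positive_prob_vector m p" and nr: "\<not> rajchman (self_affine_measure m A a p)"
      by blast
    interpret weighted_ifs A m a p by unfold_locales (fact prob)
    from not_rajchman_imp_ex_orbit[OF nr] obtain \<eta> where "\<eta> \<noteq> 0"
      and \<eta>: "\<forall>l\<in>{1..m}. summable (\<lambda>k. 1 - cos (2 * pi * (mpow M (Suc k) \<eta> \<bullet> b l)))"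
      by (elim exE conjE)
    then have "\<exists>\<theta> N S. int_orbit \<theta> N S" by (intro ex_int_orbit[of \<eta>] bspec[OF \<eta>])
    then show "generalized_pisot_ifs m A a"
      using ex_minimal_monic_int_orbit int_orbit_imp_generalized_pisot[OF assms(1)] by metis
  next
    assume gp: "generalized_pisot_ifs m A a"
    obtain p where prob: "strictly_positive_prob_vector m p" and p1: "p 1 > 1 / 2"
      using ex_dominant_prob_vector[OF m1] by blast
    interpret weighted_ifs A m a p by unfold_locales (fact prob)
    show "\<exists>p. strictly_positive_prob_vector m p \<and> \<not> rajchman (self_affine_measure m A a p)"
      using generalized_pisot_imp_not_rajchman[OF gp p1] prob by blast
  qed
qed

end
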